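(* Let $X\in\mathfrak{sl}_n(\mathbb H)$ be a non-zero nilpotent element, and let $\{X,H,Y\}$ be an $\mathfrak{sl}_2(\mathbb R)$-triple in $\mathfrak{sl}_n(\mathbb H)$. Let $\mathbf d$ be the partition of $n$ corresponding to the nilpotent orbit $\mathcal O_X$, let $\mathbb N_{\mathbf d}$ be its set of parts and $t_d$ the multiplicity of $d\in\mathbb N_{\mathbf d}$. Then $$\mathcal Z_{\mathrm{SL}_n(\mathbb H)}(X,H,Y)\simeq S\Big(\prod_{d\in\mathbb N_{\mathbf d}}\mathrm{GL}_{t_d}(\mathbb H)^d_\Delta\Big).$$
   Context: $\mathbb H$ is the real quaternions; $\mathrm{SL}_n(\mathbb H)$ is the group of $g\in\mathrm{GL}_n(\mathbb H)$ with reduced norm $\mathrm{Nrd}(g)=1$, and $\mathfrak{sl}_n(\mathbb H)$ its Lie algebra. An $\mathfrak{sl}_2(\mathbb R)$-triple satisfies $X\ne0$, $[H,X]=2X$, $[H,Y]=-2Y$, $[X,Y]=H$. $\mathcal Z_G(X,H,Y)$ is the subgroup of $G$ fixing $X,H,Y$ under the adjoint action. The partition corresponding to $\mathcal O_X$ (the adjoint $\mathrm{SL}_n(\mathbb H)$-orbit): on the right $\mathbb H$-space $V=\mathbb H^n$, let $M(d-1)$ be the sum of all irreducible $\mathrm{Span}_{\mathbb R}\{X,H,Y\}$-submodules of real dimension $d$, $L(d-1)=M(d-1)\cap\ker Y$ (an $\mathbb H$-subspace) and $t_d=\dim_{\mathbb H}L(d-1)$; the parts of $\mathbf d$ are the $d$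 with $t_d>0$, each with multiplicity $t_d$, and $\sum_d t_dd=n$. For a group $G$, $G^d_\Delta$ is the diagonally embedded copy of $G$ in $G^d$; here $\mathrm{GL}_{t_d}(\mathbb H)^d_\Delta\subset\mathrm{GL}_{t_dd}(\mathbb H)$ as block diagonal matrices with $d$ equal blocks. $S(\prod_iH_i)$, for matrix groups $H_i$ over $\mathbb H$, is the subgroup of tuples $(h_i)\in\prod_iH_i$ with $\prod_i\mathrm{Nrd}(h_i)=1$. *)

theory Defs
  imports
    Jordan_Normal_Form.Determinant
    "HOL-Algebra.Product_Groups"
    "HOL-Analysis.Function_Topology"
begin

section \<open>The real quaternions\<close>

datatype quat = Quat (qRe: real) (qI: real) (qJ: real) (qK: real)

lemma quat_eq_iff: "p = q \<longleftrightarrow> qRe p = qRe q \<and> qI p = qI q \<and> qJ p = qJ q \<and> qK p = qK q"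
  by (cases p; cases q) simp

instantiation quat :: ring_1
begin
definition zero_quat :: quat where "0 = Quat 0 0 0 0"
definition one_quat :: quat where "1 = Quat 1 0 0 0"
definition plus_quat :: "quat \<Rightarrow> quat \<Rightarrow> quat" where
  "p + q = Quat (qRe p + qRe q) (qI p + qI q) (qJ p + qJ q) (qK p + qK q)"
definition uminus_quat :: "quat \<Rightarrow> quat" where
  "- p = Quat (- qRe p) (- qI p) (- qJ p) (- qK p)"
definition minus_quat :: "quat \<Rightarrow> quat \<Rightarrow> quat" where
  "p - q = Quat (qRe p - qRe q) (qI p - qI q) (qJ p - qJ q) (qK p - qK q)"
definition times_quat :: "quat \<Rightarrow> quat \<Rightarrow> quat" where
  "p * q = Quat
    (qRe p * qRe q - qI p * qI q - qJ p * qJ q - qK p * qK q)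
    (qRe p * qI q + qI p * qRe q + qJ p * qK q - qK p * qJ q)
    (qRe p * qJ q - qI p * qK q + qJ p * qRe q + qK p * qI q)
    (qRe p * qK q + qI p * qJ q - qJ p * qI q + qK p * qRe q)"
instance
  by standard
    (simp_all add: quat_eq_iff zero_quat_def one_quat_def plus_quat_def uminus_quat_def
      minus_quat_def times_quat_def algebra_simps)
end

instantiation quat :: real_normed_div_algebra
begin
definition scaleR_quat :: "real \<Rightarrow> quat \<Rightarrow> quat" where
  "r *\<^sub>R q = Quat (r * qRe q) (r * qI q) (r * qJ q) (r * qK q)"
definition inverse_quat :: "quat \<Rightarrow> quat" where
  "inverse q = (let s = (qRe q)\<^sup>2 + (qI q)\<^sup>2 + (qJ q)\<^sup>2 + (qK q)\<^sup>2
     in Quat (qRe q / s) (- qI q / s) (- qJ q / s) (- qK q / s))"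
definition divide_quat :: "quat \<Rightarrow> quat \<Rightarrow> quat" where
  "p div (q::quat) = p * inverse q"
definition norm_quat :: "quat \<Rightarrow> real" where
  "norm q = sqrt ((qRe q)\<^sup>2 + (qI q)\<^sup>2 + (qJ q)\<^sup>2 + (qK q)\<^sup>2)"
definition sgn_quat :: "quat \<Rightarrow> quat" where "sgn (q::quat) = inverse (norm q) *\<^sub>R q"
definition dist_quat :: "quat \<Rightarrow> quat \<Rightarrow> real" where "dist p q = norm (p - q :: quat)"
definition uniformity_quat :: "(quat \<times> quat) filter" where
  "uniformity = (INF e\<in>{0<..}. principal {(x::quat, y). dist x y < e})"
definition open_quat :: "quat set \<Rightarrow> bool" where
  "open (U::quat set) \<longleftrightarrow> (\<forall>x\<in>U. \<forall>\<^sub>F (x', y) in uniformity. x' = x \<longrightarrow> y \<in> U)"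

lemma norm_quat_pair: "norm q = norm (Complex (qRe q) (qI q), Complex (qJ q) (qK q))"
  by (simp add: norm_quat_def norm_Pair cmod_def add.assoc)

lemma norm_quat_zero_iff: "(qRe q)\<^sup>2 + (qI q)\<^sup>2 + (qJ q)\<^sup>2 + (qK q)\<^sup>2 = 0 \<longleftrightarrow> q = 0"
  for q :: quat
proof
  assume *: "(qRe q)\<^sup>2 + (qI q)\<^sup>2 + (qJ q)\<^sup>2 + (qK q)\<^sup>2 = 0"
  have "(qRe q)\<^sup>2 = 0" "(qI q)\<^sup>2 = 0" "(qJ q)\<^sup>2 = 0" "(qK q)\<^sup>2 = 0"
    using * zero_le_power2[of "qRe q"] zero_le_power2[of "qI q"] zero_le_power2[of "qJ q"]
      zero_le_power2[of "qK q"] by linarith+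
  then show "q = 0" by (simp add: quat_eq_iff zero_quat_def)
qed (simp add: zero_quat_def)

instance
proof
  fix p q :: quat and a b :: real
  show "norm q = 0 \<longleftrightarrow> q = 0"
    using norm_quat_zero_iff[of q] by (simp add: norm_quat_def)
  show "norm (p + q) \<le> norm p + norm q"
    using norm_triangle_ineq[of "(Complex (qRe p) (qI p), Complex (qJ p) (qK p))"
        "(Complex (qRe q) (qI q), Complex (qJ q) (qK q))"]
    by (simp add: norm_quat_pair plus_quat_def complex_add)
  have "norm (a *\<^sub>R q) = norm (a *\<^sub>R (Complex (qRe q) (qI q), Complex (qJ q) (qK q)))"
    by (simp add: norm_quat_pair scaleR_quat_def complex_scaleR)
  then show "norm (a *\<^sub>R q) = \<bar>a\<bar> * norm q"
    by (simp only: norm_scaleR norm_quat_pair)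
  show "norm (p * q) = norm p * norm q"
    unfolding norm_quat_def real_sqrt_mult[symmetric]
    by (simp add: times_quat_def power2_eq_square algebra_simps)
  show "a *\<^sub>R (p + q) = a *\<^sub>R p + a *\<^sub>R q" "(a + b) *\<^sub>R p = a *\<^sub>R p + b *\<^sub>R p"
    "a *\<^sub>R b *\<^sub>R p = (a * b) *\<^sub>R p" "1 *\<^sub>R p = p"
    "(a *\<^sub>R p) * q = a *\<^sub>R (p * q)" "p * (a *\<^sub>R q) = a *\<^sub>R (p * q)"
    by (simp_all add: quat_eq_iff scaleR_quat_def plus_quat_def times_quat_def algebra_simps)
  show "inverse q * q = 1" "q * inverse q = 1" if "q \<noteq> 0"
    using norm_quat_zero_iff[of q] that
    by (simp_all add: quat_eq_iff one_quat_def times_quat_def inverse_quat_def Let_def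
        power2_eq_square add_divide_distrib[symmetric] diff_divide_distrib[symmetric])
  show "inverse (0::quat) = 0"
    by (simp add: inverse_quat_def zero_quat_def)
qed (simp_all add: sgn_quat_def dist_quat_def uniformity_quat_def open_quat_def divide_quat_def)
end

section \<open>Right linear algebra over the quaternions\<close>

definition smult_vec_right :: "quat vec \<Rightarrow> quat \<Rightarrow> quat vec" (infixl \<open>\<cdot>\<^sub>r\<close> 70) where
  "v \<cdot>\<^sub>r q = map_vec (\<lambda>x. x * q) v"

text \<open>The scalars \<open>K\<close> form a division subring of the quaternions: \<open>K = UNIV\<close> gives right
  \<open>\<bbbH>\<close>-subspaces of the right \<open>\<bbbH>\<close>-space \<open>\<bbbH>\<^sup>n\<close>, and \<open>K = \<real>\<close> (the image of
  \<open>of_real\<close>) gives real subspaces.\<close>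

definition right_subspace :: "quat set \<Rightarrow> nat \<Rightarrow> quat vec set \<Rightarrow> bool" where
  "right_subspace K n W \<longleftrightarrow> W \<subseteq> carrier_vec n \<and> 0\<^sub>v n \<in> W \<and>
     (\<forall>v\<in>W. \<forall>w\<in>W. v + w \<in> W) \<and> (\<forall>v\<in>W. \<forall>q\<in>K. v \<cdot>\<^sub>r q \<in> W)"

definition right_span :: "quat set \<Rightarrow> nat \<Rightarrow> quat vec set \<Rightarrow> quat vec set" where
  "right_span K n S = \<Inter>{W. right_subspace K n W \<and> S \<subseteq> W}"

definition right_basis :: "quat set \<Rightarrow> nat \<Rightarrow> quat vec set \<Rightarrow> quat vec set \<Rightarrow> bool" where
  "right_basis K n W B \<longleftrightarrow> right_span K n B = W \<and> (\<forall>b\<in>B. b \<notin> right_span K n (B - {b}))"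

definition right_dim :: "quat set \<Rightarrow> nat \<Rightarrow> quat vec set \<Rightarrow> nat" where
  "right_dim K n W = card (SOME B. right_basis K n W B)"

section \<open>Matrix groups over the quaternions\<close>

text \<open>Writing a quaternion matrix as \<open>P + Q j\<close> with complex \<open>P\<close>, \<open>Q\<close>, this is the block matrix
  with rows \<open>(P, Q)\<close> and \<open>(- cnj Q, cnj P)\<close>. It realises the splitting of \<open>M\<^sub>n(\<bbbH>)\<close> over
  \<open>\<complex>\<close>, so that its determinant is the reduced norm.\<close>

definition complexify :: "quat mat \<Rightarrow> complex mat" where
  "complexify A = four_block_mat
     (map_mat (\<lambda>q. Complex (qRe q) (qI q)) A)
     (map_mat (\<lambda>q. Complex (qJ q) (qK q)) A)
     (map_mat (\<lambda>q. - cnj (Complex (qJ q) (qK q))) A)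
     (map_mat (\<lambda>q. cnj (Complex (qRe q) (qI q))) A)"

definition Nrd :: "quat mat \<Rightarrow> complex" where
  "Nrd A = det (complexify A)"

definition GL :: "nat \<Rightarrow> quat mat monoid" where
  "GL n = units_of (ring_mat TYPE(quat) n ())"

definition SL :: "nat \<Rightarrow> quat mat monoid" where
  "SL n = (GL n)\<lparr>carrier := {g \<in> carrier (GL n). Nrd g = 1}\<rparr>"

text \<open>The Lie algebra of a closed matrix group, as its tangent space at the identity: the
  velocities at \<open>0\<close> of curves in the group through the identity.\<close>

definition lie_algebra :: "nat \<Rightarrow> quat mat monoid \<Rightarrow> quat mat set" where
  "lie_algebra n G = {Z \<in> carrier_mat n n. \<exists>\<gamma> :: real \<Rightarrow> quat mat.
     range \<gamma> \<subseteq> carrier G \<and> \<gamma> 0 = 1\<^sub>m n \<and>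
     (\<forall>i<n. \<forall>j<n. ((\<lambda>s. \<gamma> s $$ (i, j)) has_vector_derivative Z $$ (i, j)) (at 0))}"

definition sl :: "nat \<Rightarrow> quat mat set" where
  "sl n = lie_algebra n (SL n)"

definition nilpotent_mat :: "quat mat \<Rightarrow> bool" where
  "nilpotent_mat A \<longleftrightarrow> (\<exists>k. A ^\<^sub>m k = 0\<^sub>m (dim_row A) (dim_col A))"

definition bracket :: "quat mat \<Rightarrow> quat mat \<Rightarrow> quat mat" where
  "bracket A B = A * B - B * A"

definition sl2_triple :: "nat \<Rightarrow> quat mat \<Rightarrow> quat mat \<Rightarrow> quat mat \<Rightarrow> bool" where
  "sl2_triple n X H Y \<longleftrightarrow> X \<in> sl n \<and> H \<in> sl n \<and> Y \<in> sl n \<and> X \<noteq> 0\<^sub>m n n \<and>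
     bracket H X = 2 \<cdot>\<^sub>m X \<and> bracket H Y = (- 2) \<cdot>\<^sub>m Y \<and> bracket X Y = H"

definition Ad :: "nat \<Rightarrow> quat mat \<Rightarrow> quat mat \<Rightarrow> quat mat" where
  "Ad n g Z = g * Z * inv\<^bsub>GL n\<^esub> g"

definition triple_centralizer ::
    "nat \<Rightarrow> quat mat monoid \<Rightarrow> quat mat \<Rightarrow> quat mat \<Rightarrow> quat mat \<Rightarrow> quat mat monoid" where
  "triple_centralizer n G X H Y =
     G\<lparr>carrier := {g \<in> carrier G. Ad n g X = X \<and> Ad n g H = H \<and> Ad n g Y = Y}\<rparr>"

section \<open>The partition attached to a triple\<close>

definition triple_span :: "quat mat \<Rightarrow> quat mat \<Rightarrow> quat mat \<Rightarrow> quat mat set" where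
  "triple_span X H Y =
     {of_real a \<cdot>\<^sub>m X + of_real b \<cdot>\<^sub>m H + of_real c \<cdot>\<^sub>m Y | a b c. True}"

definition real_submodule :: "nat \<Rightarrow> quat mat set \<Rightarrow> quat vec set \<Rightarrow> bool" where
  "real_submodule n \<A> W \<longleftrightarrow> right_subspace \<real> n W \<and> (\<forall>A\<in>\<A>. \<forall>w\<in>W. A *\<^sub>v w \<in> W)"

definition irreducible_submodule :: "nat \<Rightarrow> quat mat set \<Rightarrow> quat vec set \<Rightarrow> bool" where
  "irreducible_submodule n \<A> W \<longleftrightarrow> real_submodule n \<A> W \<and> W \<noteq> {0\<^sub>v n} \<and>
     (\<forall>U. real_submodule n \<A> U \<and> U \<subseteq> W \<longrightarrow> U = {0\<^sub>v n} \<or> U = W)"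

text \<open>As in the usual notation, the index of \<open>M\<close> and \<open>L\<close> is the highest weight \<open>k\<close>, one less
  than the real dimension of the irreducible submodules concerned.\<close>

definition M_space :: "nat \<Rightarrow> quat mat \<Rightarrow> quat mat \<Rightarrow> quat mat \<Rightarrow> nat \<Rightarrow> quat vec set" where
  "M_space n X H Y k = right_span \<real> n
     (\<Union>{W. irreducible_submodule n (triple_span X H Y) W \<and> right_dim \<real> n W = k + 1})"

definition L_space :: "nat \<Rightarrow> quat mat \<Rightarrow> quat mat \<Rightarrow> quat mat \<Rightarrow> nat \<Rightarrow> quat vec set" where
  "L_space n X H Y k = M_space n X H Y k \<inter> {v \<in> carrier_vec n. Y *\<^sub>v v = 0\<^sub>v n}"

definition multiplicity_of :: "nat \<Rightarrow> quat mat \<Rightarrow> quat mat \<Rightarrow> quat mat \<Rightarrow> nat \<Rightarrow> nat" where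
  "multiplicity_of n X H Y d = right_dim UNIV n (L_space n X H Y (d - 1))"

definition parts :: "nat \<Rightarrow> quat mat \<Rightarrow> quat mat \<Rightarrow> quat mat \<Rightarrow> nat set" where
  "parts n X H Y = {d. 1 \<le> d \<and> 0 < multiplicity_of n X H Y d}"

section \<open>Block groups\<close>

definition GL_diagonal :: "nat \<Rightarrow> nat \<Rightarrow> quat mat monoid" where
  "GL_diagonal t d =
     (GL (t * d))\<lparr>carrier := (\<lambda>A. diag_block_mat (replicate d A)) ` carrier (GL t)\<rparr>"

definition S_product :: "nat set \<Rightarrow> (nat \<Rightarrow> quat mat monoid) \<Rightarrow> (nat \<Rightarrow> quat mat) monoid" where
  "S_product I G = (product_group I G)
     \<lparr>carrier := {h \<in> carrier (product_group I G). (\<Prod>i\<in>I. Nrd (h i)) = 1}\<rparr>"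

section \<open>Isomorphism of topological groups\<close>

definition mat_topology :: "nat \<Rightarrow> quat mat topology" where
  "mat_topology n = pullback_topology (carrier_mat n n)
     (\<lambda>A. \<lambda>ij\<in>{..<n} \<times> {..<n}. A $$ ij)
     (product_topology (\<lambda>_. euclidean) ({..<n} \<times> {..<n}))"

text \<open>The carriers get the subspace topologies. Between closed matrix groups these isomorphisms
  are exactly the isomorphisms of Lie groups, since continuous homomorphisms are smooth.\<close>

definition topological_group_isomorphic ::
    "'a topology \<Rightarrow> 'a monoid \<Rightarrow> 'b topology \<Rightarrow> 'b monoid \<Rightarrow> bool" where
  "topological_group_isomorphic S G T H \<longleftrightarrow> (\<exists>\<phi> \<in> iso G H.
     homeomorphic_map (subtopology S (carrier G)) (subtopology T (carrier H)) \<phi>)"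

end

theory Submission
  imports Defs "HOL-Library.Function_Algebras"
begin

text \<open>Let \<open>\<Lambda>\<^sub>k\<close> be the space of all \<open>v\<close> with \<open>Y v = 0\<close> and \<open>H v = - k v\<close>. Since \<open>X\<close> and \<open>Y\<close> are nilpotent,
  \<open>V = \<bbbH>\<^sup>n\<close> is the direct sum of the spaces \<open>X\<^sup>l \<Lambda>\<^sub>k\<close> with \<open>l \<le> k\<close>, and \<open>L(k) = \<Lambda>\<^sub>k\<close>. An element that
  commutes with the triple preserves each \<open>\<Lambda>\<^sub>k\<close> and is determined by its restrictions to them.
  Hence in a basis \<open>X\<^sup>l b\<close>, where \<open>b\<close> runs through \<open>\<bbbH>\<close>-bases of the \<open>\<Lambda>\<^sub>k\<close>, the centralizer consists of
  the block diagonal matrices in which, for each part \<open>d\<close>, the same block of size \<open>t\<^sub>d\<close> occurs \<open>d\<close>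
  times. The change of basis is linear in the matrix entries, thus a homeomorphism, and it preserves
  the reduced norm.\<close>

section \<open>Representations of the three-dimensional simple Lie algebra\<close>

text \<open>Only \<open>X\<close> is given as nilpotent. For \<open>Y\<close> this is forced by
  \<open>[H, Y] = -2 Y\<close>, which a norm estimate turns into a bound on the exponents of nonzero
  powers of \<open>Y\<close>. Diagonalizability of \<open>H\<close> is not given either: it is
  obtained on the kernel of \<open>Y\<close> from the nilpotency of \<open>X\<close> and spreads to
  V along the strings \<open>X^l v\<close>. The link is that no nonzero vector lies both in the
  kernel of \<open>X\<close> and in the image of \<open>Y\<close>; this takes the place of complete
  reducibility. The spaces L(k) are defined through real irreducible submodules, so it is not
  visible that they are right H-subspaces. The Casimir operator settles this: it acts on M(k) by the
  scalar k (k + 2), and on the kernel of \<open>Y\<close> this and nilpotency leave for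
  \<open>H\<close> only the eigenvalue -k, a condition stable under right scalars. The number of
  string vectors is not known beforehand. Their matrix is first shown to be invertible as a
  rectangular matrix, and comparing traces then yields that the sum of t_d d is n.\<close>

lemma eigenvectors_independent:
  fixes T :: "'v::real_vector \<Rightarrow> 'v"
  assumes "linear T" "finite I" "inj_on \<mu> I" "\<And>i. i \<in> I \<Longrightarrow> T (e i) = \<mu> i *\<^sub>R e i"
    and "(\<Sum>i\<in>I. e i) = 0"
  shows "\<forall>i\<in>I. e i = 0"
  using assms(2-)
proof (induction I arbitrary: e rule: finite_induct)
  case empty
  then show ?case by simp
next
  case (insert j I)
  interpret T: linear T by fact
  have "T (\<Sum>i\<in>insert j I. e i) - \<mu> j *\<^sub>R (\<Sum>i\<in>insert j I. e i) = 0"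
    by (simp add: insert.prems(3) T.zero del: sum.insert)
  moreover have "T (\<Sum>i\<in>insert j I. e i) = (\<Sum>i\<in>insert j I. \<mu> i *\<^sub>R e i)"
    unfolding T.sum by (intro sum.cong refl insert.prems(2))
  ultimately have "(\<Sum>i\<in>insert j I. (\<mu> i - \<mu> j) *\<^sub>R e i) = 0"
    by (simp add: scaleR_sum_right sum_subtractf scaleR_diff_left del: sum.insert)
  then have "(\<Sum>i\<in>I. (\<mu> i - \<mu> j) *\<^sub>R e i) = 0"
    using insert.hyps by simp
  moreover have "inj_on \<mu> I" "\<And>i. i \<in> I \<Longrightarrow> T ((\<mu> i - \<mu> j) *\<^sub>R e i) = \<mu> i *\<^sub>R (\<mu> i - \<mu> j) *\<^sub>R e i"
    using insert.prems by (auto simp: T.scaleR)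
  ultimately have "\<forall>i\<in>I. (\<mu> i - \<mu> j) *\<^sub>R e i = 0"
    by (rule insert.IH[rotated 2])
  then have z: "\<forall>i\<in>I. e i = 0"
    using insert.prems(1) insert.hyps by (auto simp: inj_on_def)
  then show ?case
    using insert.prems(3) insert.hyps by simp
qed

lemma span_zeros:
  fixes v :: "'v::real_vector"
  assumes "\<And>w. w \<in> E \<Longrightarrow> w = 0" "v \<in> span E"
  shows "v = 0"
  using span_mono[of E "{0}"] assms by (auto simp: span_insert_0)

text \<open>Each generator is an eigenvector with nonzero eigenvalue, so a preimage is found by
  dividing its coefficient by that eigenvalue; the generators may be linearly dependent. Used to
  correct a vector by elements of known weights.\<close>

lemma right_inverse_on_span:
  fixes T :: "'v::real_vector \<Rightarrow> 'v"
  assumes "linear T" "\<And>w. w \<in> E \<Longrightarrow> \<exists>c. c \<noteq> 0 \<and> T w = c *\<^sub>R w" "v \<in> span E"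
  shows "\<exists>v'\<in>span E. T v' = v"
  using assms(3)
proof (induction rule: span_induct_alt)
  case base
  show ?case using assms(1) by (auto intro!: bexI[of _ 0] span_zero simp: linear_0)
next
  case (step c w v)
  then obtain v' where v': "v' \<in> span E" "T v' = v" by auto
  obtain a where a: "a \<noteq> 0" "T w = a *\<^sub>R w" using assms(2) step(1) by blast
  have "T ((c / a) *\<^sub>R w + v') = c *\<^sub>R w + v"
    using v' a assms(1) by (simp add: linear_add linear_scale)
  moreover have "(c / a) *\<^sub>R w + v' \<in> span E"
    using v'(1) step(1) by (simp add: span_add span_scale span_base)
  ultimately show ?case by blast
qed

text \<open>Nilpotency is asked vector by vector instead of finite dimension, since the space of
  application is the infinite-dimensional space of functions from the natural numbers to
  \<open>quat\<close>.\<close>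

locale sl2_rep =
  fixes x h y :: "'v::real_vector \<Rightarrow> 'v"
  assumes linear_x: "linear x" and linear_h: "linear h" and linear_y: "linear y"
    and hx: "h (x v) = x (h v) + 2 *\<^sub>R x v"
    and hy: "h (y v) = y (h v) - 2 *\<^sub>R y v"
    and xy: "x (y v) = y (x v) + h v"
    and nilpotent_x: "\<exists>m. (x ^^ m) v = 0" and nilpotent_y: "\<exists>m. (y ^^ m) v = 0"
begin

sublocale x: linear x by (rule linear_x)
sublocale h: linear h by (rule linear_h)
sublocale y: linear y by (rule linear_y)

lemma linear_pow: "linear (x ^^ l)"
proof (induction l)
  case (Suc l)
  show ?case using linear_compose[OF Suc linear_x] by (simp add: o_def)
qed (simp add: linear_id[unfolded id_def] id_def)

lemma pow_zero: "(x ^^ l) 0 = 0" and pow_add: "(x ^^ l) (u + v) = (x ^^ l) u + (x ^^ l) v"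
  and pow_scale: "(x ^^ l) (c *\<^sub>R v) = c *\<^sub>R (x ^^ l) v"
  using linear_pow[of l] by (auto simp: linear_0 linear_add linear_scale)

text \<open>The symmetry exchanging raising and lowering operators; it carries facts about the
  kernel of \<open>y\<close> over to the kernel of \<open>x\<close>.\<close>

lemma opposite: "sl2_rep y (\<lambda>v. - h v) x"
  using linear_h nilpotent_x nilpotent_y
  by unfold_locales
    (auto simp: hx hy xy x.add y.add x.scaleR y.scaleR h.add h.scaleR x.neg y.neg algebra_simps)

lemma h_pow: "h ((x ^^ l) v) = (x ^^ l) (h v) + (2 * real l) *\<^sub>R (x ^^ l) v"
  by (induction l) (simp_all add: hx x.add x.scaleR algebra_simps)

text \<open>The commutator \<open>[y, x^(l+1)] = -(l+1) x^l (h + l)\<close>: each \<open>x\<close>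
  that \<open>y\<close> passes leaves a term \<open>-h\<close>, and moving these to the right
  through \<open>x\<close> adds shifts by 2 that sum to \<open>l (l + 1)\<close>. The string
  coefficients come from here.\<close>

lemma y_pow:
  "y ((x ^^ Suc l) u) = (x ^^ Suc l) (y u) - (real l + 1) *\<^sub>R (x ^^ l) (h u + real l *\<^sub>R u)"
proof (induction l)
  case 0
  show ?case using xy[of u] by simp
next
  case (Suc l)
  have *: "y (x v) = x (y v) - h v" for v using xy[of v] by simp
  have "y ((x ^^ Suc (Suc l)) u) = x (y ((x ^^ Suc l) u)) - h ((x ^^ Suc l) u)"
    by (simp add: *)
  also have "\<dots> = (x ^^ Suc (Suc l)) (y u)
      - (real (Suc l) + 1) *\<^sub>R (x ^^ Suc l) (h u + real (Suc l) *\<^sub>R u)"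
    unfolding Suc h_pow
    by (simp add: x.diff x.add x.scaleR pow_add pow_scale algebra_simps scaleR_2)
  finally show ?case .
qed

text \<open>If \<open>x^(m+1) u = 0\<close>, applying \<open>y\<close> leaves
  \<open>(m + 1) (\<mu> + m) x^m u = 0\<close> with a nonzero factor, so the exponent descends to 0.
  The hypothesis concerns \<open>x (y u)\<close> and not \<open>y u\<close>: only
  \<open>x^(m+1) (y u)\<close> enters, and \<open>ker_x_range_y_weight\<close> has nothing stronger
  at hand.\<close>

lemma weight_eq_zero:
  assumes "x (y u) = 0" "h u = \<mu> *\<^sub>R u" "\<And>j. \<mu> \<noteq> - real j"
  shows "u = 0"
proof -
  obtain m where "(x ^^ m) u = 0" using nilpotent_x by blast
  then show ?thesis
  proof (induction m)
    case (Suc m)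
    have "(x ^^ Suc m) (y u) = 0"
      using assms(1) by (simp only: funpow_Suc_right o_apply pow_zero)
    then have "y ((x ^^ Suc m) u) = - ((real m + 1) *\<^sub>R (x ^^ m) (h u + real m *\<^sub>R u))"
      unfolding y_pow by (simp only: diff_0)
    moreover have "h u + real m *\<^sub>R u = (\<mu> + real m) *\<^sub>R u"
      by (simp add: assms(2) scaleR_add_left)
    ultimately have "((real m + 1) * (\<mu> + real m)) *\<^sub>R (x ^^ m) u = 0"
      using Suc.prems by (simp only: y.zero pow_scale) (simp only: neg_0_equal_iff_equal scaleR_scaleR)
    moreover have "(real m + 1) * (\<mu> + real m) \<noteq> 0"
      using assms(3)[of m] by (auto simp: add_eq_0_iff2)
    ultimately have "(x ^^ m) u = 0" by simp
    then show ?case by (rule Suc.IH)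
  qed simp
qed

section \<open>Lowest weight vectors and the kernel of y\<close>

definition lowest :: "nat \<Rightarrow> 'v set" where
  "lowest k = {v. y v = 0 \<and> h v = - real k *\<^sub>R v}"

lemma subspace_lowest: "subspace (lowest k)"
  unfolding subspace_def lowest_def
  by (auto simp: y.zero h.zero y.add h.add y.scaleR h.scaleR algebra_simps)

text \<open>For \<open>v\<close> in the kernel of \<open>y\<close>, \<open>y\<^sup>m x\<^sup>m v\<close> is a non-zero multiple of
  \<open>h (h + 1) \<cdots> (h + m - 1) v\<close>, so nilpotency of \<open>x\<close> makes \<open>h\<close> diagonalizable on that kernel.\<close>

lemma ker_y_decomp_aux:
  assumes U: "subspace U" "\<And>v. v \<in> U \<Longrightarrow> y v = 0" "\<And>v. v \<in> U \<Longrightarrow> h v \<in> U"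
    and "v \<in> U" "(y ^^ m) ((x ^^ m) v) = 0"
  shows "v \<in> span {w \<in> U. \<exists>k<m. w \<in> lowest k}"
  using assms(4,5)
proof (induction m arbitrary: v)
  case 0
  then show ?case by (simp add: span_zero)
next
  case (Suc m)
  let ?E = "{w \<in> U. \<exists>k<m. w \<in> lowest k}"
  let ?u = "h v + real m *\<^sub>R v"
  have u: "?u \<in> U"
    using Suc.prems U by (intro subspace_add subspace_scale) auto
  interpret opp: sl2_rep y "\<lambda>v. - h v" x by (rule opposite)
  define c where "c = - (real m + 1)"
  have c: "c \<noteq> 0" unfolding c_def by linarith
  have "y ((x ^^ Suc m) v) = c *\<^sub>R (x ^^ m) ?u"
    unfolding y_pow U(2)[OF Suc.prems(1)] pow_zero c_def by (simp only: diff_0 scaleR_minus_left)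
  then have "(y ^^ m) (c *\<^sub>R (x ^^ m) ?u) = 0"
    using Suc.prems(2) by (simp only: funpow_Suc_right[of m y] o_apply)
  then have "(y ^^ m) ((x ^^ m) ?u) = 0"
    using c unfolding opp.pow_scale by simp
  with u have "?u \<in> span ?E" by (rule Suc.IH)
  moreover have "linear (\<lambda>v. h v + real m *\<^sub>R v)"
    by (intro linear_compose_add linear_h linear_compose_scale_right linear_ident)
  moreover have "\<exists>c. c \<noteq> 0 \<and> h w + real m *\<^sub>R w = c *\<^sub>R w" if "w \<in> ?E" for w
  proof -
    from that obtain k where k: "k < m" "h w = - real k *\<^sub>R w" by (auto simp: lowest_def)
    then show ?thesis by (intro exI[of _ "real m - real k"]) (simp add: scaleR_diff_left)
  qed
  \<comment> \<open>\<open>h + m\<close> is onto on the span of the weights \<open>-k\<close> with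
    \<open>k < m\<close>, so \<open>?u\<close> has a preimage \<open>v'\<close> there; the
    difference \<open>v - v'\<close> is then killed by \<open>h + m\<close>, that is, it has weight
    \<open>-m\<close>.\<close>
  ultimately obtain v' where v': "v' \<in> span ?E" "h v' + real m *\<^sub>R v' = ?u"
    using right_inverse_on_span[of "\<lambda>v. h v + real m *\<^sub>R v" ?E ?u] by blast
  have "v' \<in> U" using v'(1) span_minimal[of ?E U] U(1) by auto
  then have d: "v - v' \<in> U" using Suc.prems U(1) by (intro subspace_diff)
  have "h (v - v') = - real m *\<^sub>R (v - v')"
    using v'(2) by (simp add: h.diff algebra_simps)
  with d U(2) have "v - v' \<in> {w \<in> U. \<exists>k<Suc m. w \<in> lowest k}"
    by (auto simp: lowest_def)
  moreover have "v' \<in> span {w \<in> U. \<exists>k<Suc m. w \<in> lowest k}"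
    using v'(1) span_mono[of ?E "{w \<in> U. \<exists>k<Suc m. w \<in> lowest k}"] by (auto intro: less_SucI)
  ultimately have "(v - v') + v' \<in> span {w \<in> U. \<exists>k<Suc m. w \<in> lowest k}"
    by (rule span_add[OF span_base])
  then show ?case by simp
qed

text \<open>The \<open>h\<close>-stable space \<open>U\<close> stays a parameter because it takes
  three values: the whole kernel of \<open>y\<close>, its part in an invariant subspace and, for the
  opposite representation, the intersection of the kernel of \<open>x\<close> with the range of
  \<open>y\<close>.\<close>

lemma ker_y_decomp:
  assumes "subspace U" "\<And>v. v \<in> U \<Longrightarrow> y v = 0" "\<And>v. v \<in> U \<Longrightarrow> h v \<in> U" "v \<in> U"
  shows "v \<in> span {w \<in> U. \<exists>k. w \<in> lowest k}"
proof -
  interpret opp: sl2_rep y "\<lambda>v. - h v" x by (rule opposite)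
  obtain m where "(x ^^ m) v = 0" using nilpotent_x by blast
  then have "v \<in> span {w \<in> U. \<exists>k<m. w \<in> lowest k}"
    using ker_y_decomp_aux[of U v m] assms by (simp add: opp.pow_zero)
  then show ?thesis using span_mono[of "{w \<in> U. \<exists>k<m. w \<in> lowest k}" "{w \<in> U. \<exists>k. w \<in> lowest k}"]
    by blast
qed

lemma subspace_ker_y: "subspace {v. y v = 0}"
  by (auto simp: subspace_def y.zero y.add y.scaleR)

lemma ker_y_h: "y v = 0 \<Longrightarrow> y (h v) = 0"
  using hy[of v] by (simp add: h.zero)

lemma ker_x_h: "x v = 0 \<Longrightarrow> x (h v) = 0"
  using hx[of v] by (simp add: h.zero)

text \<open>A vector of weight \<open>k \<ge> 0\<close> killed by \<open>x\<close> has no preimage under \<open>y\<close>: the preimage could be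
  corrected by an element of the kernel of \<open>y\<close> to have weight \<open>k + 2\<close>.\<close>

lemma ker_x_range_y_weight:
  assumes "x (y u) = 0" "h (y u) = real k *\<^sub>R y u"
  shows "y u = 0"
proof -
  define T where "T = (\<lambda>v. h v + (- (real k + 2)) *\<^sub>R v)"
  let ?E = "{w \<in> {v. y v = 0}. \<exists>k. w \<in> lowest k}"
  have "y (T u) = 0"
  proof -
    have "y (h u) = h (y u) + 2 *\<^sub>R y u"
      using hy[of u] by simp
    then show ?thesis
      unfolding T_def y.add y.scaleR assms(2) by (simp add: algebra_simps)
  qed
  then have "T u \<in> span ?E"
    by (intro ker_y_decomp subspace_ker_y) (auto simp: ker_y_h)
  moreover have "linear T"
    unfolding T_def by (intro linear_compose_add linear_h linear_compose_scale_right linear_ident)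
  \<comment> \<open>The weights in the kernel of \<open>y\<close> are \<open>-j \<le> 0\<close>, and
    the eigenvalue \<open>-(j + k + 2)\<close> of \<open>T\<close> vanishes for none of
    them.\<close>
  moreover have "\<exists>c. c \<noteq> 0 \<and> T w = c *\<^sub>R w" if "w \<in> ?E" for w
  proof -
    from that obtain j where j: "h w = - real j *\<^sub>R w" by (auto simp: lowest_def)
    then have "T w = (- (real j + real k + 2)) *\<^sub>R w" by (simp add: T_def algebra_simps)
    moreover have "- (real j + real k + 2) \<noteq> 0" by linarith
    ultimately show ?thesis by blast
  qed
  ultimately obtain u' where u': "u' \<in> span ?E" "T u' = T u"
    using right_inverse_on_span[of T ?E "T u"] by blast
  have "u' \<in> {v. y v = 0}" using u'(1) span_minimal[of ?E "{v. y v = 0}"] subspace_ker_y by auto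
  then have y: "y (u - u') = y u" by (simp add: y.diff)
  have "h (u - u') = (real k + 2) *\<^sub>R (u - u')"
    using u'(2) by (simp add: T_def h.diff algebra_simps)
  then have "u - u' = 0"
  proof (rule weight_eq_zero[rotated])
    show "x (y (u - u')) = 0" unfolding y by (rule assms(1))
  qed linarith
  then show ?thesis using y by (simp add: y.zero)
qed

text \<open>The intersection of the kernel of \<open>x\<close> with the range of \<open>y\<close> is
  stable under \<open>h\<close>. For the opposite representation it lies in the kernel of the
  lowering operator, so it is spanned by vectors of weight \<open>k \<ge> 0\<close>, and each of
  these vanishes.\<close>

lemma ker_x_range_y:
  assumes "x (y u) = 0"
  shows "y u = 0"
proof -
  interpret opp: sl2_rep y "\<lambda>v. - h v" x by (rule opposite)
  let ?U = "{w. x w = 0 \<and> w \<in> range y}"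
  have "y u \<in> span {w \<in> ?U. \<exists>k. w \<in> opp.lowest k}"
  proof (rule opp.ker_y_decomp)
    have "subspace {w. x w = 0}" by (auto simp: subspace_def x.zero x.add x.scaleR)
    moreover have "subspace (range y)" by (intro linear_subspace_image linear_y subspace_UNIV)
    ultimately show "subspace ?U" unfolding Collect_conj_eq by (simp add: subspace_inter)
    show "- h v \<in> ?U" if "v \<in> ?U" for v
    proof -
      from that obtain w where w: "v = y w" by blast
      have "- h v = y (2 *\<^sub>R w - h w)"
        by (simp add: w hy y.diff y.scaleR)
      then have "- h v \<in> range y" by blast
      moreover have "x (- h v) = 0" using that ker_x_h[of v] by (simp add: x.neg)
      ultimately show ?thesis by blast
    qed
  qed (use assms in auto)
  moreover have "w = 0" if w: "w \<in> {w \<in> ?U. \<exists>k. w \<in> opp.lowest k}" for w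
  proof -
    from w obtain u' k where k: "w = y u'" "x w = 0" "- h w = - real k *\<^sub>R w"
      by (auto simp: opp.lowest_def)
    from k(3) have "h w = real k *\<^sub>R w" by simp
    with k(2) show ?thesis unfolding k(1) by (rule ker_x_range_y_weight)
  qed
  ultimately show ?thesis by (rule span_zeros[rotated])
qed

section \<open>Strings generated by lowest weight vectors\<close>

lemma h_pow_lowest:
  assumes "v \<in> lowest k"
  shows "h ((x ^^ l) v) = (2 * real l - real k) *\<^sub>R (x ^^ l) v"
proof -
  have v: "h v = (- real k) *\<^sub>R v" using assms by (simp add: lowest_def)
  show ?thesis unfolding h_pow v pow_scale by (simp add: algebra_simps)
qed

lemma y_pow_lowest:
  assumes "v \<in> lowest k"
  shows "y ((x ^^ Suc l) v) = ((real l + 1) * (real k - real l)) *\<^sub>R (x ^^ l) v"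
proof -
  have "h v + real l *\<^sub>R v = (real l - real k) *\<^sub>R v" "y v = 0"
    using assms by (auto simp: lowest_def algebra_simps)
  then show ?thesis
    unfolding y_pow by (simp only: pow_scale pow_zero) (simp add: algebra_simps)
qed

text \<open>\<open>x^(k+1) v\<close> is killed by \<open>y\<close>, because the factor
  \<open>k - l\<close> vanishes at \<open>l = k\<close>, and it has the positive weight
  \<open>k + 2\<close>, which no nonzero vector of the kernel of \<open>y\<close> can have.\<close>

lemma pow_lowest_eq_0:
  assumes "v \<in> lowest k" "k < l"
  shows "(x ^^ l) v = 0"
proof -
  have "(x ^^ Suc k) v = 0"
  proof (rule weight_eq_zero)
    show "x (y ((x ^^ Suc k) v)) = 0"
      unfolding y_pow_lowest[OF assms(1)] by (simp add: x.zero)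
    show "h ((x ^^ Suc k) v) = (real k + 2) *\<^sub>R (x ^^ Suc k) v"
      unfolding h_pow_lowest[OF assms(1)] by simp
  qed linarith
  moreover have "(x ^^ l) v = (x ^^ (l - Suc k)) ((x ^^ Suc k) v)"
    using assms(2) by (metis Suc_leI comp_apply funpow_add le_add_diff_inverse2)
  ultimately show ?thesis by (simp only: pow_zero)
qed

text \<open>For \<open>l < k\<close> the operator \<open>y\<close> takes \<open>x^(l+1) v\<close> to
  a nonzero multiple of \<open>x^l v\<close>, so vanishing descends to \<open>l = 0\<close>.\<close>

lemma lowest_eq_0:
  assumes "v \<in> lowest k" "l \<le> k" "(x ^^ l) v = 0"
  shows "v = 0"
  using assms(2,3)
proof (induction l)
  case (Suc l)
  then have "((real l + 1) * (real k - real l)) *\<^sub>R (x ^^ l) v = 0"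
    using y_pow_lowest[OF assms(1), of l] by (simp add: y.zero del: mult_eq_0_iff)
  then show ?case using Suc by (auto simp: add_eq_0_iff2)
qed simp

definition strings :: "'v set" where
  "strings = {(x ^^ l) v | l k v. v \<in> lowest k \<and> l \<le> k}"

text \<open>Induction on the power of \<open>y\<close> that kills \<open>v\<close>. If
  \<open>y v\<close> is a combination of strings, \<open>lift\<close> gives \<open>u'\<close> in
  their span with \<open>y (v - u')\<close> in the kernel of \<open>x\<close>. This vector is also
  in the range of \<open>y\<close>, so it vanishes, and the kernel of \<open>y\<close> is covered by
  \<open>ker\<close>.\<close>

lemma span_strings: "v \<in> span strings"
proof -
  have ker: "v \<in> span strings" if "y v = 0" for v
  proof -
    have "v \<in> span {w \<in> {v. y v = 0}. \<exists>k. w \<in> lowest k}"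
      using that by (intro ker_y_decomp subspace_ker_y) (auto simp: ker_y_h)
    moreover have "{w \<in> {v. y v = 0}. \<exists>k. w \<in> lowest k} \<subseteq> strings"
    proof clarify
      fix w k assume "w \<in> lowest k"
      then have "(x ^^ 0) w \<in> strings" unfolding strings_def by blast
      then show "w \<in> strings" by simp
    qed
    ultimately show ?thesis using span_mono by blast
  qed
  \<comment> \<open>Up to the kernel of \<open>x\<close>, the span of the strings is contained in
    its own image under \<open>y\<close>: a top vector \<open>x^k v\<close> is killed by
    \<open>x\<close>, and any other string vector is a multiple of \<open>y\<close> applied to its
    successor.\<close>
  have lift: "\<exists>u'\<in>span strings. x (w - y u') = 0" if "w \<in> span strings" for w
    using that
  proof (induction rule: span_induct_alt)
    case base
    show ?case by (auto intro!: bexI[of _ 0] span_zero simp: x.zero y.zero)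
  next
    case (step c s w)
    then obtain u' where u': "u' \<in> span strings" "x (w - y u') = 0" by blast
    from step(1) obtain l k v where s: "s = (x ^^ l) v" "v \<in> lowest k" "l \<le> k"
      by (auto simp: strings_def)
    have "\<exists>s'\<in>span strings. x (s - y s') = 0"
    proof (cases "l = k")
      case True
      then have "x s = 0" using pow_lowest_eq_0[OF s(2), of "Suc l"] s(1) by simp
      then show ?thesis by (auto intro!: bexI[of _ 0] span_zero simp: y.zero)
    next
      case False
      let ?c = "(real l + 1) * (real k - real l)"
      have "?c \<noteq> 0" using False s(3) by (auto simp: add_eq_0_iff2)
      then have "s = y ((1 / ?c) *\<^sub>R (x ^^ Suc l) v)"
        unfolding y.scaleR y_pow_lowest[OF s(2)] s(1) by simp
      moreover have "(x ^^ Suc l) v \<in> strings"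
        unfolding strings_def using s(2) False s(3)
        by (intro CollectI exI[of _ "Suc l"] exI[of _ k] exI[of _ v]) auto
      ultimately show ?thesis
        by (intro bexI[of _ "(1 / ?c) *\<^sub>R (x ^^ Suc l) v"])
          (simp only: diff_self x.zero, intro span_scale span_base)
    qed
    then obtain s' where s': "s' \<in> span strings" "x (s - y s') = 0" by blast
    have "x (c *\<^sub>R s + w - y (c *\<^sub>R s' + u')) = c *\<^sub>R x (s - y s') + x (w - y u')"
      by (simp add: x.add x.diff x.scaleR y.add y.scaleR algebra_simps)
    then show ?case using s' u'
      by (intro bexI[of _ "c *\<^sub>R s' + u'"]) (auto intro: span_add span_scale)
  qed
  have "\<forall>v. (y ^^ m) v = 0 \<longrightarrow> v \<in> span strings" for m
  proof (induction m)
    case 0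
    then show ?case by (simp add: span_zero)
  next
    case (Suc m)
    show ?case
    proof (intro allI impI)
      fix v assume "(y ^^ Suc m) v = 0"
      then have "y v \<in> span strings" using Suc by (simp add: funpow_swap1)
      then obtain u' where u': "u' \<in> span strings" "x (y v - y u') = 0" using lift by blast
      then have "y (v - u') = 0" using ker_x_range_y[of "v - u'"] by (simp add: y.diff)
      then have "(v - u') + u' \<in> span strings" using ker u'(1) by (intro span_add)
      then show "v \<in> span strings" by simp
    qed
  qed
  then show ?thesis using nilpotent_y[of v] by blast
qed

section \<open>The Casimir operator and isotypic components\<close>

definition casimir :: "'v \<Rightarrow> 'v" where
  "casimir v = h (h v) + 2 *\<^sub>R x (y v) + 2 *\<^sub>R y (x v)"

lemma linear_casimir: "linear casimir"
  by (rule linearI)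
    (simp_all add: casimir_def h.add x.add y.add h.scaleR x.scaleR y.scaleR algebra_simps)

lemma casimir_pow_lowest:
  assumes "v \<in> lowest k"
  shows "casimir ((x ^^ l) v) = (real k * (real k + 2)) *\<^sub>R (x ^^ l) v"
proof -
  have "x (y ((x ^^ l) v)) = (real l * (real k - real l + 1)) *\<^sub>R (x ^^ l) v"
  proof (cases l)
    case 0
    then show ?thesis using assms by (simp add: lowest_def x.zero)
  next
    case (Suc j)
    show ?thesis
      unfolding Suc y_pow_lowest[OF assms] x.scaleR by (simp add: algebra_simps)
  qed
  moreover have "y (x ((x ^^ l) v)) = ((real l + 1) * (real k - real l)) *\<^sub>R (x ^^ l) v"
    using y_pow_lowest[OF assms, of l] by simp
  moreover have "h (h ((x ^^ l) v)) = (2 * real l - real k)\<^sup>2 *\<^sub>R (x ^^ l) v"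
    by (simp add: h_pow_lowest[OF assms] h.scaleR power2_eq_square)
  ultimately have "casimir ((x ^^ l) v) = ((2 * real l - real k)\<^sup>2
      + 2 * (real l * (real k - real l + 1)) + 2 * ((real l + 1) * (real k - real l))) *\<^sub>R (x ^^ l) v"
    unfolding casimir_def by (simp only: scaleR_add_left scaleR_scaleR)
  also have "(2 * real l - real k)\<^sup>2
      + 2 * (real l * (real k - real l + 1)) + 2 * ((real l + 1) * (real k - real l))
      = real k * (real k + 2)"
    by (simp add: power2_eq_square algebra_simps)
  finally show ?thesis .
qed

lemma strings_independent:
  fixes I :: "(nat \<times> nat) set"
  assumes "finite I" "\<And>k l. (k, l) \<in> I \<Longrightarrow> l \<le> k \<and> v k l \<in> lowest k"
    and "(\<Sum>(k, l)\<in>I. (x ^^ l) (v k l)) = 0" "(k, l) \<in> I"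
  shows "v k l = 0"
proof -
  \<comment> \<open>on a string of highest weight \<open>k\<close> the eigenvalues of \<open>casimir + h\<close> lie in
    \<open>[k\<^sup>2 + k, k\<^sup>2 + 3 k]\<close>, and these intervals are disjoint\<close>
  define \<mu> where "\<mu> = (\<lambda>(k, l). real k * (real k + 2) + (2 * real l - real k))"
  have \<mu>: "\<mu> (k, l) = real (k * k + k + 2 * l)" for k l
    by (simp add: \<mu>_def algebra_simps)
  have less: "\<mu> (k, l) < \<mu> (k', l')" if "l \<le> k" "k < k'" for k l k' l'
  proof -
    obtain a where "k' = k + a + 1" using \<open>k < k'\<close> less_imp_Suc_add[of k k'] by auto
    then have "k * k + k + 2 * l < k' * k' + k' + 2 * l'" using \<open>l \<le> k\<close> by (simp add: algebra_simps)
    then show ?thesis unfolding \<mu> of_nat_less_iff .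
  qed
  have inj: "inj_on \<mu> I"
  proof (rule inj_onI, clarify)
    fix k l k' l' assume I: "(k, l) \<in> I" "(k', l') \<in> I" and eq: "\<mu> (k, l) = \<mu> (k', l')"
    have "k = k'"
      using less[of l k k' l'] less[of l' k' k l] assms(2)[OF I(1)] assms(2)[OF I(2)] eq
      by (cases k k' rule: linorder_cases) auto
    then show "k = k' \<and> l = l'" using eq unfolding \<mu> of_nat_eq_iff by simp
  qed
  have "\<forall>p\<in>I. (case p of (k, l) \<Rightarrow> (x ^^ l) (v k l)) = 0"
  proof (rule eigenvectors_independent[where T = "\<lambda>v. casimir v + h v" and \<mu> = \<mu>])
    show "linear (\<lambda>v. casimir v + h v)"
      by (intro linear_compose_add linear_casimir linear_h)
    fix p assume p: "p \<in> I"
    obtain k l where [simp]: "p = (k, l)" by fastforce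
    have "v k l \<in> lowest k" using assms(2) p by auto
    then show "casimir (case p of (k, l) \<Rightarrow> (x ^^ l) (v k l)) + h (case p of (k, l) \<Rightarrow> (x ^^ l) (v k l))
        = \<mu> p *\<^sub>R (case p of (k, l) \<Rightarrow> (x ^^ l) (v k l))"
      by (simp add: casimir_pow_lowest h_pow_lowest \<mu>_def scaleR_add_left)
  qed (use assms inj in auto)
  then have "(x ^^ l) (v k l) = 0" using assms(4) by auto
  then show ?thesis using lowest_eq_0 assms(2)[OF assms(4)] by blast
qed

text \<open>Abstract counterpart of \<open>M_space\<close>:
  \<open>irreducible_submodule_string\<close> puts every real irreducible submodule of dimension
  \<open>k + 1\<close> into it.\<close>

definition isotypic :: "nat \<Rightarrow> 'v set" where
  "isotypic k = span {(x ^^ l) v | l v. v \<in> lowest k \<and> l \<le> k}"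

lemma casimir_isotypic:
  assumes "v \<in> isotypic k"
  shows "casimir v = (real k * (real k + 2)) *\<^sub>R v"
  using assms unfolding isotypic_def
proof (induction rule: span_induct_alt)
  case base
  then show ?case using linear_casimir by (simp add: linear_0)
next
  case (step c s w)
  then show ?case
    using linear_casimir by (auto simp: linear_add linear_scale casimir_pow_lowest algebra_simps)
qed

text \<open>On the kernel of \<open>y\<close> the Casimir operator is \<open>h^2 - 2 h\<close>, so
  its eigenvalue \<open>k (k + 2)\<close> gives \<open>(h - (k + 2)) (h + k) v = 0\<close>. A
  nonzero \<open>?z = (h + k) v\<close> would have the positive weight \<open>k + 2\<close> inside
  the kernel of \<open>y\<close>.\<close>

lemma isotypic_ker_y:
  assumes "v \<in> isotypic k" "y v = 0"
  shows "v \<in> lowest k"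
proof -
  let ?z = "h v + real k *\<^sub>R v"
  have "h (h v) = 2 *\<^sub>R h v + (real k * (real k + 2)) *\<^sub>R v"
  proof -
    have "y (x v) = - h v" using xy[of v] assms(2) by (simp add: x.zero add_eq_0_iff2)
    then show ?thesis
      using casimir_isotypic[OF assms(1)] assms(2) by (simp add: casimir_def x.zero algebra_simps)
  qed
  then have "h ?z = (real k + 2) *\<^sub>R ?z"
    by (simp add: h.add h.scaleR algebra_simps)
  moreover have "x (y ?z) = 0"
    using ker_y_h[OF assms(2)] assms(2) by (simp add: y.add y.scaleR x.zero)
  ultimately have "?z = 0"
    by (intro weight_eq_zero[of ?z "real k + 2"]) (assumption, assumption, linarith)
  then show ?thesis using assms(2) by (simp add: lowest_def add_eq_0_iff2)
qed

section \<open>Invariant subspaces and irreducibility of strings\<close>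

definition invariant :: "'v set \<Rightarrow> bool" where
  "invariant W \<longleftrightarrow> subspace W \<and> (\<forall>w\<in>W. x w \<in> W \<and> h w \<in> W \<and> y w \<in> W)"

definition string :: "nat \<Rightarrow> 'v \<Rightarrow> 'v set" where
  "string k v = span ((\<lambda>l. (x ^^ l) v) ` {..k})"

lemma string_subset_isotypic: "v \<in> lowest k \<Longrightarrow> string k v \<subseteq> isotypic k"
  unfolding string_def isotypic_def by (intro span_mono) auto

lemma in_string: "v \<in> string k v"
  unfolding string_def by (intro span_base image_eqI[of _ _ 0]) auto

lemma invariant_string:
  assumes "v \<in> lowest k"
  shows "invariant (string k v)"
proof -
  let ?B = "(\<lambda>l. (x ^^ l) v) ` {..k}"
  have pow: "(x ^^ l) v \<in> string k v" for l
    using pow_lowest_eq_0[OF assms, of l]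
    by (cases "l \<le> k") (auto simp: string_def span_zero intro: span_base)
  have gen: "T w \<in> string k v" if "linear T" "\<And>l. T ((x ^^ l) v) \<in> string k v" "w \<in> string k v"
    for T :: "'v \<Rightarrow> 'v" and w
  proof -
    have "T w \<in> span (T ` ?B)"
      using that(1,3) linear_span_image[of T ?B] by (auto simp: string_def)
    moreover have "T ` ?B \<subseteq> string k v" using that(2) by auto
    ultimately show ?thesis
      using span_minimal[of "T ` ?B" "string k v"] by (auto simp: string_def)
  qed
  have "x ((x ^^ l) v) \<in> string k v" for l using pow[of "Suc l"] by simp
  moreover have "h ((x ^^ l) v) \<in> string k v" for l
    using pow[of l] unfolding h_pow_lowest[OF assms] by (simp add: string_def span_scale)
  moreover have "y ((x ^^ l) v) \<in> string k v" for l
  proof (cases l)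
    case 0
    then show ?thesis using assms by (simp add: lowest_def string_def span_zero)
  next
    case (Suc j)
    then show ?thesis
      using pow[of j] y_pow_lowest[OF assms, of j] by (simp add: string_def span_scale)
  qed
  ultimately show ?thesis
    unfolding invariant_def using gen linear_x linear_h linear_y by (auto simp: string_def)
qed

lemma string_minimal:
  assumes "invariant W" "v \<in> W"
  shows "string k v \<subseteq> W"
proof -
  have "(x ^^ l) v \<in> W" for l
    using assms by (induction l) (auto simp: invariant_def)
  then show ?thesis
    unfolding string_def using assms(1) by (intro span_minimal) (auto simp: invariant_def)
qed

lemma string_basis:
  assumes "v \<in> lowest k" "v \<noteq> 0"
  shows "inj_on (\<lambda>l. (x ^^ l) v) {..k}" "independent ((\<lambda>l. (x ^^ l) v) ` {..k})"
    "dim (string k v) = Suc k"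
proof -
  let ?f = "\<lambda>l. (x ^^ l) v"
  have zero: "\<forall>l\<in>{..k}. a l = 0" if "(\<Sum>l\<le>k. a l *\<^sub>R ?f l) = 0" for a
  proof -
    have "\<forall>l\<in>{..k}. a l *\<^sub>R ?f l = 0"
    proof (rule eigenvectors_independent[where T = h and \<mu> = "\<lambda>l. 2 * real l - real k"])
      fix l show "h (a l *\<^sub>R ?f l) = (2 * real l - real k) *\<^sub>R a l *\<^sub>R ?f l"
        by (simp add: h.scaleR h_pow_lowest[OF assms(1)])
    qed (use that linear_h in \<open>auto simp: inj_on_def\<close>)
    then show ?thesis using lowest_eq_0[OF assms(1)] assms(2) by auto
  qed
  show inj: "inj_on ?f {..k}"
  proof (rule inj_onI)
    fix i j assume ij: "i \<in> {..k}" "j \<in> {..k}" "?f i = ?f j"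
    show "i = j"
    proof (rule ccontr)
      assume "i \<noteq> j"
      \<comment> \<open>A coincidence of the vectors at \<open>i\<close> and \<open>j\<close> is the
        nontrivial relation with coefficients 1 and -1.\<close>
      then have "(\<Sum>l\<le>k. ((if l = i then 1 else 0) - (if l = j then 1 else 0)) *\<^sub>R ?f l) = 0"
        using ij by (simp add: scaleR_diff_left sum_subtractf if_distrib[of "\<lambda>r. r *\<^sub>R _"] cong: if_cong)
      from zero[OF this] show False using ij \<open>i \<noteq> j\<close> by (auto dest: bspec[of _ _ i])
    qed
  qed
  show ind: "independent (?f ` {..k})"
  proof
    assume "dependent (?f ` {..k})"
    then obtain u where u: "(\<Sum>w\<in>?f ` {..k}. u w *\<^sub>R w) = 0" "\<exists>w\<in>?f ` {..k}. u w \<noteq> 0"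
      using dependent_finite[of "?f ` {..k}"] by auto
    from u(1) have "(\<Sum>l\<le>k. u (?f l) *\<^sub>R ?f l) = 0" using inj by (simp add: sum.reindex)
    from zero[OF this] u(2) show False by auto
  qed
  show "dim (string k v) = Suc k"
    unfolding string_def using dim_span_eq_card_independent[OF ind] inj by (simp add: card_image)
qed

text \<open>The last nonzero vector among \<open>w\<close>, \<open>y w\<close>,
  \<open>y (y w)\<close> and so on lies in \<open>W\<close> and in the kernel of \<open>y\<close>.
  This intersection is \<open>h\<close>-stable, so it is spanned by lowest weight vectors, which
  cannot all be zero.\<close>

lemma invariant_lowest:
  assumes "invariant W" "W \<noteq> {0}"
  obtains k v where "v \<in> W" "v \<in> lowest k" "v \<noteq> 0"
proof -
  have sub: "subspace W" using assms(1) by (simp add: invariant_def)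
  then obtain w where w: "w \<in> W" "w \<noteq> 0" using assms(2) subspace_0[of W] by blast
  obtain m where "(y ^^ m) w = 0" using nilpotent_y by blast
  then have "\<exists>u\<in>W. u \<noteq> 0 \<and> y u = 0"
    using w
  proof (induction m arbitrary: w)
    case (Suc m)
    have "(y ^^ m) (y w) = 0" "y w \<in> W"
      using Suc.prems assms(1) by (auto simp: funpow_swap1 invariant_def)
    then show ?case using Suc.IH[of "y w"] Suc.prems by blast
  qed simp
  then obtain u where u: "u \<in> W" "u \<noteq> 0" "y u = 0" by blast
  let ?U = "W \<inter> {v. y v = 0}"
  have "u \<in> span {w \<in> ?U. \<exists>k. w \<in> lowest k}"
    using u assms(1) sub
    by (intro ker_y_decomp subspace_inter subspace_ker_y) (auto simp: ker_y_h invariant_def)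
  then obtain w' where "w' \<in> {w \<in> ?U. \<exists>k. w \<in> lowest k}" "w' \<noteq> 0"
    using span_zeros u(2) by blast
  then show thesis using that by blast
qed

text \<open>By \<open>isotypic_ker_y\<close>, \<open>u\<close> has weight \<open>-k\<close>. In the
  expansion of \<open>u\<close> in the vectors \<open>x^l v\<close>, the operator
  \<open>h + k\<close> multiplies the term at \<open>l\<close> by \<open>2 l\<close> and kills the
  sum, so only \<open>l = 0\<close> remains.\<close>

lemma string_lowest:
  assumes "v \<in> lowest k" "u \<in> string k v" "u \<in> lowest j"
  shows "\<exists>a. u = a *\<^sub>R v"
proof -
  let ?f = "\<lambda>l. (x ^^ l) v"
  have u: "u \<in> lowest k"
    using assms isotypic_ker_y string_subset_isotypic[OF assms(1)] lowest_def by blast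
  have "string k v \<subseteq> {w. \<exists>a. w = (\<Sum>l\<le>k. a l *\<^sub>R ?f l)}"
    unfolding string_def
  proof (rule span_minimal)
    show "?f ` {..k} \<subseteq> {w. \<exists>a. w = (\<Sum>l\<le>k. a l *\<^sub>R ?f l)}"
    proof clarify
      fix l assume "l \<le> k"
      then have "?f l = (\<Sum>i\<le>k. (if i = l then 1 else 0) *\<^sub>R ?f i)"
        by (simp add: if_distrib[of "\<lambda>r. r *\<^sub>R _"] cong: if_cong)
      then show "\<exists>a. ?f l = (\<Sum>i\<le>k. a i *\<^sub>R ?f i)"
        by (rule exI[of _ "\<lambda>i. if i = l then 1 else 0"])
    qed
    show "subspace {w. \<exists>a. w = (\<Sum>l\<le>k. a l *\<^sub>R ?f l)}"
    proof (rule subspaceI, goal_cases)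
      case 1
      show ?case by (auto intro!: exI[of _ "\<lambda>_. 0"])
    next
      case (2 v w)
      then obtain a b where "v = (\<Sum>l\<le>k. a l *\<^sub>R ?f l)" "w = (\<Sum>l\<le>k. b l *\<^sub>R ?f l)" by blast
      then have "v + w = (\<Sum>l\<le>k. (a l + b l) *\<^sub>R ?f l)" by (simp add: scaleR_add_left sum.distrib)
      then show ?case by (intro CollectI exI)
    next
      case (3 c v)
      then obtain a where "v = (\<Sum>l\<le>k. a l *\<^sub>R ?f l)" by blast
      then have "c *\<^sub>R v = (\<Sum>l\<le>k. (c * a l) *\<^sub>R ?f l)" by (simp add: scaleR_sum_right)
      then show ?case by (intro CollectI exI)
    qed
  qed
  then obtain a where a: "u = (\<Sum>l\<le>k. a l *\<^sub>R ?f l)" using assms(2) by blast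
  have "(\<Sum>l\<le>k. (2 * real l * a l) *\<^sub>R ?f l) = h u + real k *\<^sub>R u"
    by (simp add: a h.sum h.scaleR h_pow_lowest[OF assms(1)] scaleR_sum_right flip: sum.distrib)
      (simp add: algebra_simps)
  also have "\<dots> = 0" using u by (simp add: lowest_def)
  finally have "\<forall>l\<in>{..k}. (2 * real l * a l) *\<^sub>R ?f l = 0"
    by (intro eigenvectors_independent[where T = h and \<mu> = "\<lambda>l. 2 * real l - real k"] linear_h)
      (auto simp: inj_on_def h.scaleR h_pow_lowest[OF assms(1)])
  then have "\<forall>l\<in>{..k} - {0}. a l *\<^sub>R ?f l = 0" by fastforce
  then have "u = a 0 *\<^sub>R v"
    unfolding a by (simp add: sum.remove[of "{..k}" 0] sum.neutral del: scaleR_eq_0_iff)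
  then show ?thesis by blast
qed

text \<open>A nonzero invariant subspace contains a nonzero lowest weight vector, which inside the
  string is a multiple of \<open>v\<close>; so it contains \<open>v\<close> and with it the whole
  string.\<close>

lemma string_irreducible:
  assumes "v \<in> lowest k" "invariant U" "U \<subseteq> string k v" "U \<noteq> {0}"
  shows "U = string k v"
proof -
  obtain j u where u: "u \<in> U" "u \<in> lowest j" "u \<noteq> 0"
    using assms(2,4) by (rule invariant_lowest)
  then obtain a where a: "u = a *\<^sub>R v" using string_lowest assms(1,3) by blast
  then have "v = (1 / a) *\<^sub>R u" using u(3) by auto
  then have "v \<in> U" using u(1) assms(2) by (simp add: invariant_def subspace_scale)
  then show ?thesis using string_minimal[OF assms(2)] assms(3) by blast
qed

end

section \<open>Right vector spaces over the quaternions\<close>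

instantiation "fun" :: (type, real_vector) real_vector
begin
definition scaleR_fun :: "real \<Rightarrow> ('a \<Rightarrow> 'b) \<Rightarrow> 'a \<Rightarrow> 'b" where
  "scaleR_fun r f = (\<lambda>i. r *\<^sub>R f i)"
instance
  by standard (simp_all add: scaleR_fun_def fun_eq_iff scaleR_add_left scaleR_add_right)
end

lemma scaleR_fun_apply [simp]: "(r *\<^sub>R f) i = r *\<^sub>R f i"
  by (simp add: scaleR_fun_def)

lemma sum_fun_apply: "(\<Sum>a\<in>S. f a) i = (\<Sum>a\<in>S. f a i)"
  by (induction S rule: infinite_finite_induct) simp_all

text \<open>Vectors are extended by zero to functions on the natural numbers: the function type is a
  real vector space, which the type \<open>quat vec\<close> is not, since it contains vectors of all dimensions.\<close>

definition of_vec :: "quat vec \<Rightarrow> nat \<Rightarrow> quat" where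
  "of_vec v i = (if i < dim_vec v then v $ i else 0)"

definition mat_op :: "quat mat \<Rightarrow> (nat \<Rightarrow> quat) \<Rightarrow> nat \<Rightarrow> quat" where
  "mat_op A f i = (if i < dim_row A then \<Sum>j<dim_col A. A $$ (i, j) * f j else 0)"

definition rscale :: "(nat \<Rightarrow> quat) \<Rightarrow> quat \<Rightarrow> nat \<Rightarrow> quat" where
  "rscale f q = (\<lambda>i. f i * q)"

definition supported :: "nat \<Rightarrow> (nat \<Rightarrow> quat) set" where
  "supported n = {f. \<forall>i\<ge>n. f i = 0}"

lemma rscale_simps [simp]:
  "rscale (f + g) q = rscale f q + rscale g q" "rscale 0 q = 0" "rscale f 0 = 0" "rscale f 1 = f"
  "rscale (rscale f p) q = rscale f (p * q)" "rscale (r *\<^sub>R f) q = r *\<^sub>R rscale f q"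
  "rscale (- f) q = - rscale f q" "rscale (f - g) q = rscale f q - rscale g q"
  "rscale f (of_real r) = r *\<^sub>R f" "rscale f (- q) = - rscale f q"
  by (simp_all add: rscale_def fun_eq_iff algebra_simps of_real_def)

lemma rscale_add_right: "rscale f (p + q) = rscale f p + rscale f q"
  by (simp add: rscale_def fun_eq_iff algebra_simps)

lemma rscale_sum: "rscale (\<Sum>a\<in>S. f a) q = (\<Sum>a\<in>S. rscale (f a) q)"
  by (rule ext) (simp add: rscale_def sum_fun_apply sum_distrib_right)

lemma linear_mat_op: "linear (mat_op A)"
  by (rule linearI) (auto simp: mat_op_def fun_eq_iff algebra_simps sum.distrib scaleR_sum_right)

lemma mat_op_sum: "mat_op A (\<Sum>a\<in>S. f a) = (\<Sum>a\<in>S. mat_op A (f a))"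
  by (rule linear_sum[OF linear_mat_op])

lemma mat_op_rscale: "mat_op A (rscale f q) = rscale (mat_op A f) q"
  by (auto simp: mat_op_def rscale_def fun_eq_iff sum_distrib_right mult.assoc)

lemma mat_op_supported: "A \<in> carrier_mat n m \<Longrightarrow> mat_op A f \<in> supported n"
  by (auto simp: mat_op_def supported_def)

lemma mat_op_mult:
  assumes "A \<in> carrier_mat n m" "B \<in> carrier_mat m k"
  shows "mat_op (A * B) f = mat_op A (mat_op B f)"
proof
  fix i
  have "(\<Sum>j<k. (A * B) $$ (i, j) * f j) = (\<Sum>l<m. A $$ (i, l) * (\<Sum>j<k. B $$ (l, j) * f j))" if "i < n"
    using that assms by (subst sum_distrib_left, subst sum.swap)
      (auto simp: scalar_prod_def sum_distrib_right mult.assoc atLeast0LessThan intro!: sum.cong)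
  then show "mat_op (A * B) f i = mat_op A (mat_op B f) i"
    using assms by (auto simp: mat_op_def)
qed

lemma mat_op_one: "f \<in> supported n \<Longrightarrow> mat_op (1\<^sub>m n) f = f"
  by (auto simp: mat_op_def supported_def fun_eq_iff if_distrib[of "\<lambda>a. a * _"] cong: if_cong)

lemma mat_op_zero: "mat_op (0\<^sub>m n m) f = 0"
  by (simp add: mat_op_def fun_eq_iff)

lemma mat_op_add:
  "A \<in> carrier_mat n m \<Longrightarrow> B \<in> carrier_mat n m \<Longrightarrow> mat_op (A + B) f = mat_op A f + mat_op B f"
  by (auto simp: mat_op_def fun_eq_iff algebra_simps sum.distrib)

lemma mat_op_diff:
  assumes "A \<in> carrier_mat n m" "B \<in> carrier_mat n m"
  shows "mat_op (A - B) f = mat_op A f - mat_op B f"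
  using assms by (auto simp: mat_op_def fun_eq_iff left_diff_distrib sum_subtractf)

lemma mat_op_smult: "mat_op (of_real r \<cdot>\<^sub>m A) f = r *\<^sub>R mat_op A f"
  by (auto simp: mat_op_def fun_eq_iff scaleR_sum_right of_real_def)

lemma mat_op_unit:
  "i < dim_row A \<Longrightarrow> j < dim_col A \<Longrightarrow> mat_op A (\<lambda>l. if l = j then 1 else 0) i = A $$ (i, j)"
  by (simp add: mat_op_def if_distrib[of "\<lambda>a. _ * a"] cong: if_cong)

lemma of_vec_mult: "v \<in> carrier_vec (dim_col A) \<Longrightarrow> of_vec (A *\<^sub>v v) = mat_op A (of_vec v)"
  by (auto simp: of_vec_def mat_op_def fun_eq_iff scalar_prod_def atLeast0LessThan)

lemma of_vec_add: "v \<in> carrier_vec n \<Longrightarrow> w \<in> carrier_vec n \<Longrightarrow> of_vec (v + w) = of_vec v + of_vec w"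
  by (auto simp: of_vec_def fun_eq_iff)

lemma of_vec_rscale: "of_vec (v \<cdot>\<^sub>r q) = rscale (of_vec v) q"
  by (auto simp: of_vec_def fun_eq_iff smult_vec_right_def rscale_def)

lemma of_vec_zero: "of_vec (0\<^sub>v n) = 0"
  by (auto simp: of_vec_def fun_eq_iff)

lemma of_vec_inj: "inj_on of_vec (carrier_vec n)"
  by (rule inj_onI) (rule eq_vecI, auto simp: of_vec_def fun_eq_iff, metis)

lemma of_vec_eq_0: "v \<in> carrier_vec n \<Longrightarrow> of_vec v = 0 \<longleftrightarrow> v = 0\<^sub>v n"
  using inj_onD[OF of_vec_inj, of v "0\<^sub>v n" n] of_vec_zero[of n] by auto

lemma of_vec_carrier: "of_vec ` carrier_vec n = supported n"
proof
  show "supported n \<subseteq> of_vec ` carrier_vec n"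
    by (rule subsetI, rule image_eqI[where x = "vec n _"]) (auto simp: of_vec_def supported_def fun_eq_iff)
qed (auto simp: of_vec_def supported_def)

section \<open>Real subspaces of quaternionic n-space inside the function space\<close>

lemma subspace_supported: "subspace (supported n)"
  by (auto simp: subspace_def supported_def)

lemma right_subspace_carrier: "right_subspace K n (carrier_vec n)"
  by (auto simp: right_subspace_def smult_vec_right_def)

lemma right_subspace_span:
  assumes "S \<subseteq> carrier_vec n"
  shows "right_subspace K n (right_span K n S)"
  using right_subspace_carrier[of K n] assms unfolding right_span_def
  by (auto simp: right_subspace_def)

lemma right_span_base: "v \<in> S \<Longrightarrow> v \<in> right_span K n S"
  by (auto simp: right_span_def)

lemma right_span_minimal: "right_subspace K n W \<Longrightarrow> S \<subseteq> W \<Longrightarrow> right_span K n S \<subseteq> W"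
  by (auto simp: right_span_def)

lemma right_span_carrier_imp:
  assumes "right_span K n S \<subseteq> carrier_vec n"
  shows "S \<subseteq> carrier_vec n"
  using assms right_span_base by blast

lemma right_subspace_real_iff:
  assumes "W \<subseteq> carrier_vec n"
  shows "right_subspace \<real> n W \<longleftrightarrow> subspace (of_vec ` W)"
proof
  assume W: "right_subspace \<real> n W"
  show "subspace (of_vec ` W)"
  proof (rule subspaceI)
    show "0 \<in> of_vec ` W"
      using W by (auto simp: right_subspace_def of_vec_zero[of n] intro!: image_eqI[of _ _ "0\<^sub>v n"])
    show "f + g \<in> of_vec ` W" if fg: "f \<in> of_vec ` W" "g \<in> of_vec ` W" for f g
    proof -
      from fg obtain v w where vw: "v \<in> W" "w \<in> W" "f = of_vec v" "g = of_vec w" by blast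
      then have "f + g = of_vec (v + w)" using assms by (metis of_vec_add subsetD)
      then show ?thesis using W vw by (auto simp: right_subspace_def)
    qed
    show "r *\<^sub>R f \<in> of_vec ` W" if f: "f \<in> of_vec ` W" for r f
    proof -
      from f obtain v where v: "v \<in> W" "f = of_vec v" by blast
      then have "r *\<^sub>R f = of_vec (v \<cdot>\<^sub>r of_real r)" by (simp add: of_vec_rscale)
      then show ?thesis using W v by (auto simp: right_subspace_def)
    qed
  qed
next
  assume W: "subspace (of_vec ` W)"
  have mem: "v \<in> W" if "v \<in> carrier_vec n" "of_vec v \<in> of_vec ` W" for v
    using that assms inj_on_image_mem_iff[OF of_vec_inj] by blast
  show "right_subspace \<real> n W"
    unfolding right_subspace_def
  proof (intro conjI ballI)
    show "0\<^sub>v n \<in> W" using subspace_0[OF W] by (intro mem) (simp_all add: of_vec_zero)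
    show "v + w \<in> W" if vw: "v \<in> W" "w \<in> W" for v w
    proof (rule mem)
      show "v + w \<in> carrier_vec n" using vw assms by (metis add_carrier_vec subsetD)
      have "of_vec (v + w) = of_vec v + of_vec w" using vw assms by (metis of_vec_add subsetD)
      then show "of_vec (v + w) \<in> of_vec ` W" using subspace_add[OF W] vw by simp
    qed
    show "v \<cdot>\<^sub>r q \<in> W" if vq: "v \<in> W" "q \<in> \<real>" for v q
    proof (rule mem)
      show "v \<cdot>\<^sub>r q \<in> carrier_vec n" using vq assms by (auto simp: smult_vec_right_def)
      show "of_vec (v \<cdot>\<^sub>r q) \<in> of_vec ` W"
        using vq subspace_scale[OF W] by (auto simp: of_vec_rscale elim!: Reals_cases)
    qed
  qed (rule assms)
qed

lemma of_vec_right_span: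
  assumes "S \<subseteq> carrier_vec n"
  shows "of_vec ` right_span \<real> n S = span (of_vec ` S)"
proof
  let ?T = "{v \<in> carrier_vec n. of_vec v \<in> span (of_vec ` S)}"
  have "span (of_vec ` S) \<subseteq> supported n"
    using assms of_vec_carrier by (intro span_minimal subspace_supported) auto
  then have T: "of_vec ` ?T = span (of_vec ` S)"
    unfolding of_vec_carrier[symmetric] by blast
  have "right_subspace \<real> n ?T"
    by (subst right_subspace_real_iff) (auto simp: T)
  then have "right_span \<real> n S \<subseteq> ?T"
    by (rule right_span_minimal) (use assms in \<open>auto intro: span_base\<close>)
  then show "of_vec ` right_span \<real> n S \<subseteq> span (of_vec ` S)" by auto
  have "right_subspace \<real> n (right_span \<real> n S)" using assms by (rule right_subspace_span)
  then have "subspace (of_vec ` right_span \<real> n S)"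
    using right_subspace_real_iff[of "right_span \<real> n S" n] unfolding right_subspace_def by blast
  then show "span (of_vec ` S) \<subseteq> of_vec ` right_span \<real> n S"
    by (intro span_minimal) (auto intro: right_span_base)
qed

lemma right_basis_real_iff:
  assumes W: "right_subspace \<real> n W"
  shows "right_basis \<real> n W B \<longleftrightarrow>
    B \<subseteq> carrier_vec n \<and> span (of_vec ` B) = of_vec ` W \<and> independent (of_vec ` B)"
proof -
  have Wc: "W \<subseteq> carrier_vec n" using W by (simp add: right_subspace_def)
  have "right_span \<real> n B = W \<longleftrightarrow> span (of_vec ` B) = of_vec ` W" if "B \<subseteq> carrier_vec n"
  proof -
    have "right_span \<real> n B \<subseteq> carrier_vec n"
      using right_subspace_span[OF that, of \<real>] by (simp add: right_subspace_def)
    then show ?thesis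
      unfolding of_vec_right_span[OF that, symmetric]
      using inj_on_image_eq_iff[OF of_vec_inj] Wc by metis
  qed
  moreover have "(\<forall>b\<in>B. b \<notin> right_span \<real> n (B - {b})) \<longleftrightarrow> independent (of_vec ` B)"
    if Bc: "B \<subseteq> carrier_vec n"
  proof -
    have "b \<in> right_span \<real> n (B - {b}) \<longleftrightarrow> of_vec b \<in> span (of_vec ` B - {of_vec b})" if b: "b \<in> B" for b
    proof -
      have sub: "B - {b} \<subseteq> carrier_vec n" using Bc by blast
      have "of_vec ` B - {of_vec b} = of_vec ` (B - {b})"
        using inj_on_image_set_diff[OF of_vec_inj[of n], where A = B and B = "{b}"] Bc b by auto
      moreover have "right_span \<real> n (B - {b}) \<subseteq> carrier_vec n"
        using right_subspace_span[OF sub, of \<real>] by (simp add: right_subspace_def)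
      ultimately show ?thesis
        using of_vec_right_span[OF sub, symmetric]
          inj_on_image_mem_iff[OF of_vec_inj, of b n "right_span \<real> n (B - {b})"] Bc b by auto
    qed
    then show ?thesis by (simp add: dependent_def)
  qed
  ultimately show ?thesis
    using right_span_carrier_imp[of \<real> n B] Wc unfolding right_basis_def by metis
qed

text \<open>\<open>right_dim\<close> is the size of a basis picked by choice. Under
  \<open>of_vec\<close> it becomes a basis of a real vector space, where all bases have the same
  size.\<close>

lemma right_dim_real:
  assumes W: "right_subspace \<real> n W"
  shows "right_dim \<real> n W = dim (of_vec ` W)"
proof -
  have Wc: "W \<subseteq> carrier_vec n" using W by (simp add: right_subspace_def)
  have sub: "subspace (of_vec ` W)" using right_subspace_real_iff[OF Wc] W by simp
  have "\<exists>B. right_basis \<real> n W B"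
  proof -
    obtain B' where B': "B' \<subseteq> of_vec ` W" "independent B'" "of_vec ` W \<subseteq> span B'" "card B' = dim (of_vec ` W)"
      by (rule basis_exists)
    then obtain B where B: "B \<subseteq> W" "B' = of_vec ` B" by (meson subset_imageE)
    have "span B' = of_vec ` W" using B' span_minimal[OF B'(1) sub] by blast
    then show ?thesis using B B'(2) Wc unfolding right_basis_real_iff[OF W] by blast
  qed
  then have "right_basis \<real> n W (SOME B. right_basis \<real> n W B)" by (rule someI_ex)
  then have *: "(SOME B. right_basis \<real> n W B) \<subseteq> carrier_vec n"
    "span (of_vec ` (SOME B. right_basis \<real> n W B)) = of_vec ` W"
    "independent (of_vec ` (SOME B. right_basis \<real> n W B))"
    unfolding right_basis_real_iff[OF W] by auto
  have "dim (of_vec ` W) = card (of_vec ` (SOME B. right_basis \<real> n W B))"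
    using dim_span_eq_card_independent[OF *(3)] *(2) by simp
  also have "\<dots> = card (SOME B. right_basis \<real> n W B)"
    using inj_on_subset[OF of_vec_inj *(1)] by (rule card_image)
  finally show ?thesis by (simp add: right_dim_def)
qed

text \<open>The \<open>4 n\<close> real generators keep independent sets inside
  \<open>supported n\<close> finite, although the function space itself has infinite
  dimension.\<close>

lemma supported_finite_span: "\<exists>E. finite E \<and> supported n \<subseteq> span E"
proof (intro exI conjI)
  define u where "u = (\<lambda>(j::nat, q::quat) i. if i = j then q else 0)"
  let ?Q = "{Quat 1 0 0 0, Quat 0 1 0 0, Quat 0 0 1 0, Quat 0 0 0 1}"
  let ?E = "u ` ({..<n} \<times> ?Q)"
  show "finite ?E" by simp
  show "supported n \<subseteq> span ?E"
  proof
    fix f assume f: "f \<in> supported n"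
    have "f = (\<Sum>j<n. qRe (f j) *\<^sub>R u (j, Quat 1 0 0 0) + qI (f j) *\<^sub>R u (j, Quat 0 1 0 0)
        + qJ (f j) *\<^sub>R u (j, Quat 0 0 1 0) + qK (f j) *\<^sub>R u (j, Quat 0 0 0 1))" (is "f = sum ?g _")
    proof
      fix i
      have "?g j i = (if i = j then f j else 0)" for j
        by (auto simp: u_def quat_eq_iff plus_quat_def scaleR_quat_def zero_quat_def)
      then show "f i = sum ?g {..<n} i"
        unfolding sum_fun_apply using f by (auto simp: supported_def)
    qed
    also have "\<dots> \<in> span ?E"
      by (intro span_sum span_add span_scale span_base imageI) auto
    finally show "f \<in> span ?E" .
  qed
qed

section \<open>Bases over the quaternions\<close>

lemma right_span_real_subset:
  assumes "S \<subseteq> carrier_vec n"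
  shows "right_span \<real> n S \<subseteq> right_span UNIV n S"
  using right_subspace_span[OF assms, of UNIV]
  by (intro right_span_minimal) (auto simp: right_subspace_def intro: right_span_base)

text \<open>Real spans are contained in quaternionic ones, so irredundancy over the quaternions
  implies real independence, and this inside a finitely generated real space.\<close>

lemma right_basis_finite:
  assumes "right_basis UNIV n W B" "W \<subseteq> carrier_vec n"
  shows "finite B"
proof -
  have B: "B \<subseteq> carrier_vec n"
    using assms right_span_carrier_imp[of UNIV n B] by (simp add: right_basis_def)
  have "right_basis \<real> n (right_span \<real> n B) B"
    using assms(1) right_span_real_subset[of "B - {_}" n] B unfolding right_basis_def by blast
  then have "independent (of_vec ` B)"
    using right_basis_real_iff[OF right_subspace_span[OF B]] by blast
  moreover obtain E where "finite E" "supported n \<subseteq> span E" using supported_finite_span by blast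
  ultimately have "finite (of_vec ` B)"
    using independent_span_bound[of E "of_vec ` B"] B of_vec_carrier[of n] by blast
  then show ?thesis using finite_imageD inj_on_subset[OF of_vec_inj B] by blast
qed

text \<open>A real basis of \<open>W\<close> is a finite set that generates it over the quaternions.
  Among the finite generating sets one of least cardinality is irredundant, since a redundant member
  could be removed.\<close>

lemma right_basis_exists:
  assumes W: "right_subspace UNIV n W"
  shows "\<exists>B. right_basis UNIV n W B"
proof -
  have Wc: "W \<subseteq> carrier_vec n" using W by (simp add: right_subspace_def)
  have WR: "right_subspace \<real> n W" using W by (simp add: right_subspace_def)
  obtain B' where B': "B' \<subseteq> of_vec ` W" "independent B'" "of_vec ` W \<subseteq> span B'" "card B' = dim (of_vec ` W)"
    by (rule basis_exists)
  then obtain S0 where S0: "S0 \<subseteq> W" "B' = of_vec ` S0" by (meson subset_imageE)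
  obtain E where "finite E" "supported n \<subseteq> span E" using supported_finite_span by blast
  then have "finite B'" using independent_span_bound[of E B'] B' Wc of_vec_carrier[of n] by blast
  then have fin: "finite S0"
    using S0 Wc finite_imageD inj_on_subset[OF of_vec_inj, of S0 n] by blast
  have S0c: "S0 \<subseteq> carrier_vec n" using S0 Wc by blast
  have "of_vec ` W \<subseteq> of_vec ` right_span \<real> n S0"
    using B'(3) unfolding of_vec_right_span[OF S0c] S0 .
  moreover have "right_span \<real> n S0 \<subseteq> carrier_vec n"
    using right_subspace_span[OF S0c, of \<real>] by (simp add: right_subspace_def)
  ultimately have "W \<subseteq> right_span \<real> n S0"
    using inj_on_image_mem_iff[OF of_vec_inj] Wc by blast
  then have "right_span UNIV n S0 = W"
    using right_span_real_subset[OF S0c] right_span_minimal[OF W S0(1)] by blast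
  with fin have "\<exists>S. finite S \<and> right_span UNIV n S = W" by blast
  then obtain S where S: "finite S" "right_span UNIV n S = W"
    and min: "\<And>S'. finite S' \<Longrightarrow> right_span UNIV n S' = W \<Longrightarrow> card S \<le> card S'"
    using exists_least_iff[of "\<lambda>c. \<exists>S. finite S \<and> right_span UNIV n S = W \<and> card S = c"]
    by (metis not_le)
  have Sc: "S \<subseteq> carrier_vec n" using S(2) Wc right_span_carrier_imp by blast
  have "b \<notin> right_span UNIV n (S - {b})" if b: "b \<in> S" for b
  proof
    assume *: "b \<in> right_span UNIV n (S - {b})"
    have sub: "right_subspace UNIV n (right_span UNIV n (S - {b}))"
      using Sc by (intro right_subspace_span) blast
    have "right_span UNIV n (S - {b}) = W"
      using right_span_minimal[OF sub, of S] right_span_minimal[of UNIV n "right_span UNIV n S" "S - {b}"]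
        right_subspace_span[OF Sc] right_span_base[of _ S] right_span_base[of _ "S - {b}"] * S(2) by blast
    then show False using min[of "S - {b}"] S(1) b card_Diff1_less[of S b] by simp
  qed
  then show ?thesis using S(2) unfolding right_basis_def by blast
qed

text \<open>The basis enumerated here is the very one that \<open>right_dim\<close> chooses, so its
  size is \<open>right_dim\<close> by definition. Irredundancy becomes uniqueness of coordinates by
  dividing a relation by a nonzero coefficient.\<close>

lemma right_basis_coordinates:
  assumes W: "right_subspace UNIV n W"
  obtains b where "\<And>i. i < right_dim UNIV n W \<Longrightarrow> b i \<in> of_vec ` W"
    and "\<And>f. f \<in> of_vec ` W \<Longrightarrow> \<exists>w. f = (\<Sum>i<right_dim UNIV n W. rscale (b i) (w i))"
    and "\<And>w i. (\<Sum>i<right_dim UNIV n W. rscale (b i) (w i)) = 0 \<Longrightarrow> i < right_dim UNIV n W \<Longrightarrow> w i = 0"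
proof -
  define B where "B = (SOME B. right_basis UNIV n W B)"
  let ?t = "right_dim UNIV n W"
  have Wc: "W \<subseteq> carrier_vec n" using W by (simp add: right_subspace_def)
  have B: "right_basis UNIV n W B"
    unfolding B_def using right_basis_exists[OF W] by (rule someI_ex)
  have t: "?t = card B" by (simp add: right_dim_def B_def)
  have Bc: "B \<subseteq> carrier_vec n"
    using B Wc right_span_carrier_imp[of UNIV n B] by (simp add: right_basis_def)
  have BW: "B \<subseteq> W" using B right_span_base[of _ B UNIV n] unfolding right_basis_def by blast
  obtain c where c: "bij_betw c {..<?t} B"
    using right_basis_finite[OF B Wc] ex_bij_betw_nat_finite unfolding t atLeast0LessThan by blast
  have comb: "right_subspace UNIV n {v \<in> carrier_vec n. \<exists>w. of_vec v = (\<Sum>i\<in>I. rscale (of_vec (c i)) (w i))}"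
    (is "right_subspace UNIV n ?R") for I
    unfolding right_subspace_def
  proof (intro conjI ballI)
    show "0\<^sub>v n \<in> ?R" by (auto simp: of_vec_zero intro!: exI[of _ "\<lambda>_. 0"])
    show "v + v' \<in> ?R" if "v \<in> ?R" "v' \<in> ?R" for v v'
    proof -
      from that obtain w w' where "of_vec v = (\<Sum>i\<in>I. rscale (of_vec (c i)) (w i))"
        "of_vec v' = (\<Sum>i\<in>I. rscale (of_vec (c i)) (w' i))" by blast
      then have "of_vec (v + v') = (\<Sum>i\<in>I. rscale (of_vec (c i)) (w i + w' i))"
        using that by (subst of_vec_add[of _ n]) (auto simp: rscale_add_right sum.distrib)
      then show ?thesis using that by auto
    qed
    show "v \<cdot>\<^sub>r q \<in> ?R" if "v \<in> ?R" for v q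
    proof -
      from that obtain w where "of_vec v = (\<Sum>i\<in>I. rscale (of_vec (c i)) (w i))" by blast
      then have "of_vec (v \<cdot>\<^sub>r q) = (\<Sum>i\<in>I. rscale (of_vec (c i)) (w i * q))"
        by (simp add: of_vec_rscale rscale_sum)
      then show ?thesis using that by (auto simp: smult_vec_right_def)
    qed
  qed auto
  have in_comb: "c ` I \<subseteq> {v \<in> carrier_vec n. \<exists>w. of_vec v = (\<Sum>i\<in>I. rscale (of_vec (c i)) (w i))}"
    if "I \<subseteq> {..<?t}" for I
  proof clarify
    fix i assume i: "i \<in> I"
    have "of_vec (c i) = (\<Sum>j\<in>I. rscale (of_vec (c j)) (if j = i then 1 else 0))"
      using i finite_subset[OF that] by (simp add: if_distrib[of "rscale _"] cong: if_cong)
    moreover have "c i \<in> carrier_vec n" using i that bij_betwE[OF c] Bc by blast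
    ultimately show "c i \<in> carrier_vec n \<and> (\<exists>w. of_vec (c i) = (\<Sum>i\<in>I. rscale (of_vec (c i)) (w i)))"
      by (intro conjI exI[of _ "\<lambda>j. if j = i then 1 else 0"])
  qed
  show thesis
  proof
    show "of_vec (c i) \<in> of_vec ` W" if "i < ?t" for i
      using that BW bij_betwE[OF c] by blast
    show "\<exists>w. f = (\<Sum>i<?t. rscale (of_vec (c i)) (w i))" if "f \<in> of_vec ` W" for f
    proof -
      have "W \<subseteq> {v \<in> carrier_vec n. \<exists>w. of_vec v = (\<Sum>i<?t. rscale (of_vec (c i)) (w i))}"
        using right_span_minimal[OF comb[of "{..<?t}"] in_comb[OF order_refl]] B bij_betw_imp_surj_on[OF c]
        by (simp add: right_basis_def)
      then show ?thesis using that by blast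
    qed
    show "w i = 0" if eq: "(\<Sum>i<?t. rscale (of_vec (c i)) (w i)) = 0" and i: "i < ?t" for w i
    proof (rule ccontr)
      assume nz: "w i \<noteq> 0"
      have Ic: "c ` ({..<?t} - {i}) = B - {c i}"
        using bij_betw_imp_surj_on[OF c] inj_on_image_set_diff[OF bij_betw_imp_inj_on[OF c], where A = "{..<?t}" and B = "{i}"] i
        by auto
      have sub: "right_subspace UNIV n (right_span UNIV n (B - {c i}))"
        using Bc by (intro right_subspace_span) blast
      \<comment> \<open>Multiplying the relation on the right by \<open>inverse (w i)\<close>
        expresses \<open>c i\<close> through the other basis vectors.\<close>
      have "of_vec (c i) = rscale (rscale (of_vec (c i)) (w i)) (inverse (w i))"
        using nz by simp
      also have "rscale (of_vec (c i)) (w i) = - (\<Sum>j\<in>{..<?t} - {i}. rscale (of_vec (c j)) (w j))"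
        using eq i by (subst (asm) sum.remove[of _ i]) (auto simp: add_eq_0_iff2)
      finally have eq': "of_vec (c i) = (\<Sum>j\<in>{..<?t} - {i}. rscale (of_vec (c j)) (- w j * inverse (w i)))"
        by (simp only: rscale_simps rscale_sum sum_negf mult_minus_left)
      have span: "\<exists>v\<in>right_span UNIV n (B - {c i}). of_vec v = (\<Sum>j\<in>J. rscale (of_vec (c j)) (a j))"
        if "finite J" "J \<subseteq> {..<?t} - {i}" for J a
        using that
      proof (induction J rule: finite_induct)
        case empty
        then show ?case using sub by (auto simp: right_subspace_def of_vec_zero intro!: bexI[of _ "0\<^sub>v n"])
      next
        case (insert j J)
        then obtain v where v: "v \<in> right_span UNIV n (B - {c i})"
          "of_vec v = (\<Sum>j\<in>J. rscale (of_vec (c j)) (a j))" by auto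
        have "c j \<in> right_span UNIV n (B - {c i})"
          using insert.prems Ic by (intro right_span_base) blast
        then have j: "c j \<cdot>\<^sub>r a j \<in> right_span UNIV n (B - {c i})"
          using sub by (simp add: right_subspace_def)
        then have "c j \<cdot>\<^sub>r a j + v \<in> right_span UNIV n (B - {c i})"
          using sub v(1) by (simp add: right_subspace_def)
        moreover have "of_vec (c j \<cdot>\<^sub>r a j + v) = of_vec (c j \<cdot>\<^sub>r a j) + of_vec v"
          using sub j v(1) by (intro of_vec_add[of _ n]) (auto simp: right_subspace_def)
        ultimately show ?case
          unfolding sum.insert[OF insert.hyps] of_vec_rscale v(2) by blast
      qed
      have "\<exists>v\<in>right_span UNIV n (B - {c i}). of_vec v = of_vec (c i)"
        unfolding eq' by (rule span) auto
      then obtain v where v: "v \<in> right_span UNIV n (B - {c i})" "of_vec v = of_vec (c i)" by blast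
      have "v = c i"
        using v sub Bc bij_betwE[OF c] i inj_onD[OF of_vec_inj, of v "c i" n]
        by (auto simp: right_subspace_def)
      then show False using v(1) B bij_betwE[OF c] i by (auto simp: right_basis_def)
    qed
  qed
qed

section \<open>Block diagonal matrices and the reduced norm\<close>

lemma diag_block_mat_carrier:
  assumes "\<And>b. b \<in> set bs \<Longrightarrow> F b \<in> carrier_mat (s b) (s b)"
  shows "diag_block_mat (map F bs) \<in> carrier_mat (sum_list (map s bs)) (sum_list (map s bs))"
  using assms by (induction bs) (auto simp: Let_def)

lemma diag_block_mat_mult:
  fixes F G :: "'b \<Rightarrow> 'a::ring_1 mat"
  assumes "\<And>b. b \<in> set bs \<Longrightarrow> F b \<in> carrier_mat (s b) (s b)"
    and "\<And>b. b \<in> set bs \<Longrightarrow> G b \<in> carrier_mat (s b) (s b)"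
  shows "diag_block_mat (map F bs) * diag_block_mat (map G bs) = diag_block_mat (map (\<lambda>b. F b * G b) bs)"
  using assms
proof (induction bs)
  case (Cons a bs)
  let ?m = "sum_list (map s bs)"
  have c: "F a \<in> carrier_mat (s a) (s a)" "G a \<in> carrier_mat (s a) (s a)"
    "diag_block_mat (map F bs) \<in> carrier_mat ?m ?m" "diag_block_mat (map G bs) \<in> carrier_mat ?m ?m"
    using Cons.prems by (auto intro!: diag_block_mat_carrier)
  have IH: "diag_block_mat (map F bs) * diag_block_mat (map G bs)
      = diag_block_mat (map (\<lambda>b. F b * G b) bs)"
    using Cons by auto
  then have "diag_block_mat (map (\<lambda>b. F b * G b) bs) \<in> carrier_mat ?m ?m"
    using c by (metis mult_carrier_mat)
  then show ?case
    using c IH by (simp add: Let_def mult_four_block_mat[OF c(1) zero_carrier_mat zero_carrier_mat c(3)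
        c(2) zero_carrier_mat zero_carrier_mat c(4)])
qed simp

text \<open>The index map \<open>e\<close> sends position \<open>i\<close> of block \<open>b\<close> to the corresponding row (or column) of
  the block diagonal matrix.\<close>

lemma diag_block_mat_index:
  assumes "distinct bs"
  obtains e where "bij_betw e (SIGMA b:set bs. {..<s b}) {..<sum_list (map s bs)}"
    and "\<And>(F :: 'b \<Rightarrow> 'a::zero mat) b c i j. (\<And>b. b \<in> set bs \<Longrightarrow> F b \<in> carrier_mat (s b) (s b)) \<Longrightarrow>
      b \<in> set bs \<Longrightarrow> c \<in> set bs \<Longrightarrow> i < s b \<Longrightarrow> j < s c \<Longrightarrow>
      diag_block_mat (map F bs) $$ (e (b, i), e (c, j)) = (if b = c then F b $$ (i, j) else 0)"
  using assms
proof (induction bs arbitrary: thesis)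
  case Nil
  then show ?case by (simp add: bij_betw_def)
next
  case (Cons a bs)
  let ?m = "sum_list (map s bs)"
  obtain e where e: "bij_betw e (SIGMA b:set bs. {..<s b}) {..<?m}"
    and ent: "\<And>(F :: 'b \<Rightarrow> 'a mat) b c i j. (\<And>b. b \<in> set bs \<Longrightarrow> F b \<in> carrier_mat (s b) (s b)) \<Longrightarrow>
      b \<in> set bs \<Longrightarrow> c \<in> set bs \<Longrightarrow> i < s b \<Longrightarrow> j < s c \<Longrightarrow>
      diag_block_mat (map F bs) $$ (e (b, i), e (c, j)) = (if b = c then F b $$ (i, j) else 0)"
    using Cons.IH Cons.prems(2) by auto
  have lt: "e (b, i) < ?m" if "b \<in> set bs" "i < s b" for b i
    using bij_betwE[OF e] that by auto
  have a: "a \<notin> set bs" using Cons.prems(2) by simp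
  define e' where "e' = (\<lambda>(b, i). if b = a then i else s a + e (b, i))"
  show ?case
  proof (rule Cons.prems(1))
    show "bij_betw e' (SIGMA b:set (a # bs). {..<s b}) {..<sum_list (map s (a # bs))}"
      unfolding bij_betw_def
    proof
      show "inj_on e' (SIGMA b:set (a # bs). {..<s b})"
      proof (rule inj_onI, clarify)
        fix b i c j
        assume *: "b \<in> set (a # bs)" "c \<in> set (a # bs)" "i < s b" "j < s c"
          and eq: "e' (b, i) = e' (c, j)"
        show "b = c \<and> i = j"
        proof (cases "b = a \<or> c = a")
          case True
          then show ?thesis using * eq by (auto simp: e'_def split: if_splits)
        next
          case False
          then have "e (b, i) = e (c, j)" using eq by (simp add: e'_def)
          then show ?thesis using inj_onD[OF bij_betw_imp_inj_on[OF e]] * False by fastforce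
        qed
      qed
      have "e' ` (SIGMA b:set (a # bs). {..<s b}) = {..<s a} \<union> (\<lambda>r. s a + r) ` (e ` (SIGMA b:set bs. {..<s b}))"
        using a by (force simp: e'_def image_iff split: if_splits)
      also have "\<dots> = {..<s a} \<union> (\<lambda>r. s a + r) ` {..<?m}"
        using bij_betw_imp_surj_on[OF e] by simp
      also have "\<dots> = {..<s a + ?m}"
        by (auto simp: image_iff) (metis add_diff_inverse_nat add_less_cancel_left lessThan_iff)
      finally show "e' ` (SIGMA b:set (a # bs). {..<s b}) = {..<sum_list (map s (a # bs))}" by simp
    qed
    fix F :: "'b \<Rightarrow> 'a mat" and b c i j
    assume F: "\<And>b. b \<in> set (a # bs) \<Longrightarrow> F b \<in> carrier_mat (s b) (s b)"
      and bc: "b \<in> set (a # bs)" "c \<in> set (a # bs)" "i < s b" "j < s c"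
    have D: "diag_block_mat (map F bs) \<in> carrier_mat ?m ?m"
      using F by (intro diag_block_mat_carrier) simp
    have Fa: "F a \<in> carrier_mat (s a) (s a)" using F by simp
    have *: "diag_block_mat (map F bs) $$ (e (b, i), e (c, j)) = (if b = c then F b $$ (i, j) else 0)"
      if "b \<noteq> a" "c \<noteq> a"
      using bc that F by (intro ent) simp_all
    have "b \<noteq> a \<Longrightarrow> e (b, i) < ?m" "c \<noteq> a \<Longrightarrow> e (c, j) < ?m"
      using bc lt by auto
    then show "diag_block_mat (map F (a # bs)) $$ (e' (b, i), e' (c, j)) = (if b = c then F b $$ (i, j) else 0)"
      using bc D Fa * by (cases "b = a"; cases "c = a") (simp_all add: Let_def e'_def)
  qed
qed

lemma sum_diag_block_index:
  fixes f :: "nat \<Rightarrow> 'a::comm_monoid_add" and s :: "'b \<Rightarrow> nat"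
  assumes "bij_betw e (SIGMA b:set bs. {..<s b}) {..<m}"
  shows "(\<Sum>r<m. f r) = (\<Sum>b\<in>set bs. \<Sum>i<s b. f (e (b, i)))"
proof -
  have "(\<Sum>r<m. f r) = (\<Sum>q\<in>(SIGMA b:set bs. {..<s b}). f (e q))"
    by (rule sum.reindex_bij_betw[OF assms, symmetric])
  also have "\<dots> = (\<Sum>b\<in>set bs. \<Sum>i<s b. f (e (b, i)))"
    by (subst sum.Sigma) (auto simp: split_def)
  finally show ?thesis .
qed

section \<open>The reduced norm of products and of block diagonal matrices\<close>

lemma det_reindex:
  fixes A :: "'a::comm_ring_1 mat"
  assumes A: "A \<in> carrier_mat n n" and p: "p permutes {0..<n}"
  shows "det (mat n n (\<lambda>(i, j). A $$ (p i, p j))) = det A"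
proof -
  let ?B = "mat n n (\<lambda>(i, j). A $$ (i, p j))"
  have lt: "p i < n" if "i < n" for i using permutes_in_image[OF p, of i] that by auto
  have "mat n n (\<lambda>(i, j). A $$ (p i, p j)) = mat n n (\<lambda>(i, j). ?B $$ (p i, j))"
    by (rule eq_matI) (auto simp: lt)
  \<comment> \<open>The sign of \<open>p\<close> enters here for the rows and again, after
    transposition, for the columns; its square is 1.\<close>
  then have "det (mat n n (\<lambda>(i, j). A $$ (p i, p j))) = signof p * det ?B"
    using det_permute_rows[OF _ p, of ?B] by simp
  also have "det ?B = det (transpose_mat ?B)"
    by (rule det_transpose[symmetric]) auto
  also have "transpose_mat ?B = mat n n (\<lambda>(i, j). transpose_mat A $$ (p i, j))"
    using A by (intro eq_matI) (auto simp: lt)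
  also have "det \<dots> = signof p * det A"
    using det_permute_rows[OF _ p, of "transpose_mat A"] A by (simp add: det_transpose)
  finally show ?thesis by (simp add: mult.assoc[symmetric] flip: of_int_mult)
qed

lemma complexify_carrier: "A \<in> carrier_mat n m \<Longrightarrow> complexify A \<in> carrier_mat (n + n) (m + m)"
  unfolding complexify_def by auto

text \<open>For complex \<open>z\<close> one has \<open>j z = cnj z j\<close>, so
  \<open>(P + Q j) (P' + Q' j)\<close> has the components \<open>P P' - Q cnj Q'\<close> and
  \<open>P Q' + Q cnj P'\<close>, which form the first block row of the product.\<close>

lemma complexify_mult:
  assumes A: "A \<in> carrier_mat n m" and B: "B \<in> carrier_mat m k"
  shows "complexify (A * B) = complexify A * complexify B"
proof -
  have sum: "qRe (sum f S) = (\<Sum>i\<in>S. qRe (f i))" "qI (sum f S) = (\<Sum>i\<in>S. qI (f i))"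
    "qJ (sum f S) = (\<Sum>i\<in>S. qJ (f i))" "qK (sum f S) = (\<Sum>i\<in>S. qK (f i))" for f :: "nat \<Rightarrow> quat" and S
    by (induction S rule: infinite_finite_induct) (simp_all add: zero_quat_def plus_quat_def)
  show ?thesis
    unfolding complexify_def
    apply (subst mult_four_block_mat[of _ n m _ m _ n _ _ k _ k])
    using A B apply auto[8]
    apply (intro arg_cong4[where f = four_block_mat] eq_matI)
    using A B
    by (auto simp: scalar_prod_def sum complex_eq_iff times_quat_def simp flip: sum.distrib sum_negf sum_subtractf
        intro!: sum.cong)
qed

lemma complexify_one: "complexify (1\<^sub>m n) = 1\<^sub>m (n + n)"
  unfolding complexify_def
  by (intro eq_matI) (auto simp: one_quat_def zero_quat_def complex_eq_iff)

lemma Nrd_mult: "A \<in> carrier_mat n n \<Longrightarrow> B \<in> carrier_mat n n \<Longrightarrow> Nrd (A * B) = Nrd A * Nrd B"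
  unfolding Nrd_def by (simp add: complexify_mult[of A n n B n] det_mult[of _ "n + n"] complexify_carrier)

lemma Nrd_one: "Nrd (1\<^sub>m n) = 1"
  unfolding Nrd_def complexify_one by simp

lemma Nrd_four_block:
  assumes A: "A \<in> carrier_mat a a" and B: "B \<in> carrier_mat b b"
  shows "Nrd (four_block_mat A (0\<^sub>m a b) (0\<^sub>m b a) B) = Nrd A * Nrd B"
proof -
  let ?M = "four_block_mat A (0\<^sub>m a b) (0\<^sub>m b a) B"
  let ?n = "(a + b) + (a + b)"
  \<comment> \<open>\<open>complexify ?M\<close> has its rows and columns in groups of sizes
    \<open>a, b, a, b\<close>. The permutation exchanges the two middle groups, so that both groups
    of \<open>A\<close> precede both groups of \<open>B\<close>; \<open>q\<close> is its
    inverse.\<close>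
  define p where "p i = (if a \<le> i \<and> i < a + a then i + b else if a + a \<le> i \<and> i < a + a + b then i - a else i)" for i
  define q where "q i = (if a \<le> i \<and> i < a + b then i + a else if a + b \<le> i \<and> i < a + a + b then i - b else i)" for i
  have "p permutes {0..<?n}"
  proof (rule bij_imp_permutes)
    show "bij_betw p {0..<?n} {0..<?n}"
      by (rule bij_betw_byWitness[where f' = q]) (auto simp: p_def q_def)
  qed (auto simp: p_def)
  then have "Nrd ?M = det (mat ?n ?n (\<lambda>(i, j). complexify ?M $$ (p i, p j)))"
    unfolding Nrd_def using A B by (intro det_reindex[symmetric] complexify_carrier) auto
  also have "mat ?n ?n (\<lambda>(i, j). complexify ?M $$ (p i, p j))
      = four_block_mat (complexify A) (0\<^sub>m (a + a) (b + b)) (0\<^sub>m (b + b) (a + a)) (complexify B)"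
  proof (rule eq_matI)
    fix i j
    assume "i < dim_row (four_block_mat (complexify A) (0\<^sub>m (a + a) (b + b)) (0\<^sub>m (b + b) (a + a)) (complexify B))"
      and "j < dim_col (four_block_mat (complexify A) (0\<^sub>m (a + a) (b + b)) (0\<^sub>m (b + b) (a + a)) (complexify B))"
    then have "i < ?n" "j < ?n"
      using complexify_carrier[OF A] complexify_carrier[OF B] by auto
    moreover have "(k < a \<or> (\<exists>r<a. k = a + r)) \<or> (\<exists>r<b. k = a + a + r) \<or> (\<exists>r<b. k = a + a + b + r)"
      if "k < ?n" for k
      using that by presburger
    ultimately have "(i < a \<or> (\<exists>r<a. i = a + r)) \<or> (\<exists>r<b. i = a + a + r) \<or> (\<exists>r<b. i = a + a + b + r)"
      "(j < a \<or> (\<exists>r<a. j = a + r)) \<or> (\<exists>r<b. j = a + a + r) \<or> (\<exists>r<b. j = a + a + b + r)"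
      by blast+
    then show "mat ?n ?n (\<lambda>(i, j). complexify ?M $$ (p i, p j)) $$ (i, j)
        = four_block_mat (complexify A) (0\<^sub>m (a + a) (b + b)) (0\<^sub>m (b + b) (a + a)) (complexify B) $$ (i, j)"
      using A B unfolding complexify_def
      by (elim disjE exE conjE) (simp_all add: p_def complex_eq_iff zero_quat_def)
  qed (use complexify_carrier[OF A] complexify_carrier[OF B] in auto)
  also have "det \<dots> = Nrd A * Nrd B"
    unfolding Nrd_def using A B
    by (intro det_four_block_mat_upper_right_zero complexify_carrier) (auto intro!: complexify_carrier)
  finally show ?thesis .
qed

lemma Nrd_diag_block_mat:
  assumes "\<And>b. b \<in> set bs \<Longrightarrow> F b \<in> carrier_mat (s b) (s b)"
  shows "Nrd (diag_block_mat (map F bs)) = prod_list (map (\<lambda>b. Nrd (F b)) bs)"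
  using assms
proof (induction bs)
  case Nil
  have "0\<^sub>m 0 0 = (1\<^sub>m 0 :: quat mat)" by (rule eq_matI) auto
  then show ?case using Nrd_one[of 0] by simp
next
  case (Cons a bs)
  have "diag_block_mat (map F bs) \<in> carrier_mat (sum_list (map s bs)) (sum_list (map s bs))"
    "F a \<in> carrier_mat (s a) (s a)"
    using Cons.prems by (auto intro!: diag_block_mat_carrier)
  moreover from this have "dim_row (F a) = s a" "dim_col (F a) = s a" by auto
  ultimately show ?case
    using Cons Nrd_four_block[of "F a" "s a" "diag_block_mat (map F bs)"] by (auto simp: Let_def)
qed

text \<open>Compare the traces: the real part is a trace form on the quaternions.\<close>

lemma two_sided_inverse_square:
  fixes P Q :: "quat mat"
  assumes P: "P \<in> carrier_mat n m" and Q: "Q \<in> carrier_mat m n" and PQ: "P * Q = 1\<^sub>m n" "Q * P = 1\<^sub>m m"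
  shows "n = m"
proof -
  have sum: "qRe (sum f S) = (\<Sum>i\<in>S. qRe (f i))" for f :: "nat \<Rightarrow> quat" and S
    by (induction S rule: infinite_finite_induct) (simp_all add: zero_quat_def plus_quat_def)
  have tr: "(\<Sum>i<k. qRe (1\<^sub>m k $$ (i, i))) = real k" for k
    by (simp add: one_quat_def)
  have "real n = (\<Sum>i<n. \<Sum>j<m. qRe (P $$ (i, j) * Q $$ (j, i)))"
    unfolding tr[of n, symmetric] PQ(1)[symmetric] using P Q
    by (intro sum.cong refl) (simp add: scalar_prod_def sum atLeast0LessThan)
  also have "\<dots> = (\<Sum>j<m. \<Sum>i<n. qRe (Q $$ (j, i) * P $$ (i, j)))"
    by (subst sum.swap) (simp add: times_quat_def mult.commute)
  also have "\<dots> = real m"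
    unfolding tr[of m, symmetric] PQ(2)[symmetric] using P Q
    by (intro sum.cong refl) (simp add: scalar_prod_def sum atLeast0LessThan)
  finally show ?thesis by simp
qed

section \<open>The general linear group and the adjoint action\<close>

lemma carrier_GL:
  "carrier (GL n) = {A \<in> carrier_mat n n. \<exists>B\<in>carrier_mat n n. B * A = 1\<^sub>m n \<and> A * B = 1\<^sub>m n}"
  by (auto simp: GL_def units_of_def Units_def ring_mat_def)

lemma mult_GL: "A \<otimes>\<^bsub>GL n\<^esub> B = A * B" and one_GL: "\<one>\<^bsub>GL n\<^esub> = 1\<^sub>m n"
  by (simp_all add: GL_def units_of_def ring_mat_def)

lemma group_GL: "group (GL n)"
proof -
  interpret semiring "ring_mat TYPE(quat) n ()" by (rule semiring_mat)
  show ?thesis unfolding GL_def by (rule units_group)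
qed

lemma inv_GL:
  assumes "g \<in> carrier (GL n)"
  shows "inv\<^bsub>GL n\<^esub> g \<in> carrier_mat n n" "inv\<^bsub>GL n\<^esub> g * g = 1\<^sub>m n" "g * inv\<^bsub>GL n\<^esub> g = 1\<^sub>m n"
  using group.inv_closed[OF group_GL assms] group.l_inv[OF group_GL assms] group.r_inv[OF group_GL assms]
  by (auto simp: mult_GL one_GL carrier_GL)

lemma Ad_eq_iff:
  assumes g: "g \<in> carrier (GL n)" and Z: "Z \<in> carrier_mat n n"
  shows "Ad n g Z = Z \<longleftrightarrow> g * Z = Z * g"
proof -
  let ?i = "inv\<^bsub>GL n\<^esub> g"
  note i = inv_GL[OF g]
  have c: "g \<in> carrier_mat n n" using g by (simp add: carrier_GL)
  have "Ad n g Z * g = g * Z * (?i * g)"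
    unfolding Ad_def by (rule assoc_mult_mat) (use c Z i in auto)
  moreover have "Z * g * ?i = Z * (g * ?i)"
    by (rule assoc_mult_mat) (use c Z i in auto)
  moreover have "g * Z \<in> carrier_mat n n" using c Z by simp
  ultimately have "Ad n g Z * g = g * Z" "Z * g * ?i = Z"
    using Z i by (simp_all add: right_mult_one_mat)
  then show ?thesis unfolding Ad_def by metis
qed

section \<open>The isotypic components of a triple\<close>

definition mat_norm :: "quat mat \<Rightarrow> real" where
  "mat_norm A = (\<Sum>i<dim_row A. \<Sum>j<dim_col A. norm (A $$ (i, j)))"

lemma mat_norm_mult:
  assumes A: "A \<in> carrier_mat n n" and B: "B \<in> carrier_mat n n"
  shows "mat_norm (A * B) \<le> mat_norm A * mat_norm B"
proof -
  have "mat_norm (A * B) \<le> (\<Sum>i<n. \<Sum>j<n. \<Sum>l<n. norm (A $$ (i, l)) * norm (B $$ (l, j)))"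
    unfolding mat_norm_def using A B
    by (auto intro!: sum_mono norm_sum[THEN order_trans] simp: scalar_prod_def atLeast0LessThan norm_mult)
  also have "\<dots> = (\<Sum>i<n. \<Sum>l<n. norm (A $$ (i, l)) * (\<Sum>j<n. norm (B $$ (l, j))))"
    by (rule sum.cong[OF refl], subst sum.swap) (simp add: sum_distrib_left)
  also have "\<dots> \<le> (\<Sum>i<n. \<Sum>l<n. norm (A $$ (i, l)) * mat_norm B)"
  proof (intro sum_mono mult_left_mono)
    fix l assume "l \<in> {..<n}"
    then show "(\<Sum>j<n. norm (B $$ (l, j))) \<le> mat_norm B"
      unfolding mat_norm_def using B
      by (intro member_le_sum[of l "{..<n}" "\<lambda>l. \<Sum>j<n. norm (B $$ (l, j))", THEN order_trans])
        (auto intro: sum_nonneg)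
  qed simp
  also have "\<dots> = mat_norm A * mat_norm B"
    unfolding mat_norm_def using A by (simp add: sum_distrib_right)
  finally show ?thesis .
qed

lemma mat_norm_nonneg: "mat_norm A \<ge> 0"
  by (simp add: mat_norm_def sum_nonneg)

lemma mat_norm_eq_0: "A \<in> carrier_mat n m \<Longrightarrow> mat_norm A = 0 \<Longrightarrow> A = 0\<^sub>m n m"
  by (auto simp: mat_norm_def sum_nonneg_eq_0_iff sum_nonneg)

lemma mat_op_pow:
  assumes "A \<in> carrier_mat n n"
  shows "mat_op (A ^\<^sub>m Suc k) f = (mat_op A ^^ Suc k) f"
proof (induction k arbitrary: f)
  case 0
  show ?case using assms by simp
next
  case (Suc k)
  have "mat_op (A ^\<^sub>m Suc (Suc k)) f = mat_op (A ^\<^sub>m Suc k) (mat_op A f)"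
    using mat_op_mult[of "A ^\<^sub>m Suc k" n n A n f] assms pow_carrier_mat[OF assms, of "Suc k"] by simp
  then show ?case unfolding Suc by (simp only: funpow_Suc_right o_apply)
qed

lemma weight_pow:
  fixes y h :: "'v::real_vector \<Rightarrow> 'v"
  assumes "linear y" "\<And>v. h (y v) = y (h v) - 2 *\<^sub>R y v"
  shows "h ((y ^^ m) v) = (y ^^ m) (h v) - (2 * real m) *\<^sub>R (y ^^ m) v"
proof (induction m)
  case (Suc m)
  show ?case
    by (simp add: assms(2) Suc linear_diff[OF assms(1)] linear_scale[OF assms(1)] algebra_simps)
qed simp

text \<open>From \<open>[H, Y\<^sup>k] = - 2 k Y\<^sup>k\<close>, any submultiplicative norm gives \<open>2 k \<bar>Y\<^sup>k\<bar> \<le> 2 \<bar>H\<bar> \<bar>Y\<^sup>k\<bar>\<close>.\<close>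

lemma weight_nilpotent:
  assumes H: "H \<in> carrier_mat n n" and Y: "Y \<in> carrier_mat n n"
    and hy: "\<And>f. mat_op H (mat_op Y f) = mat_op Y (mat_op H f) - 2 *\<^sub>R mat_op Y f"
  shows "\<exists>m. \<forall>f. (mat_op Y ^^ m) f = 0"
proof -
  \<comment> \<open>For \<open>W\<close>, the power of \<open>Y\<close> with exponent
    \<open>k + 1\<close>, the estimate reads
    \<open>(k + 1 - mat_norm H) * mat_norm W \<le> 0\<close>; with \<open>k\<close> above
    \<open>mat_norm H\<close> it leaves only \<open>W = 0\<close>.\<close>
  obtain k :: nat where k: "real k > mat_norm H" using reals_Archimedean2 by blast
  let ?y = "mat_op Y" and ?h = "mat_op H"
  note comm = weight_pow[OF linear_mat_op hy]
  define W where "W = Y ^\<^sub>m Suc k"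
  have W: "W \<in> carrier_mat n n" unfolding W_def using Y by (rule pow_carrier_mat)
  have Wop: "mat_op W f = (?y ^^ Suc k) f" for f
    unfolding W_def by (rule mat_op_pow[OF Y])
  have "(2 * real (Suc k)) * mat_norm W = (\<Sum>i<n. \<Sum>j<n. norm ((2 * real (Suc k)) *\<^sub>R W $$ (i, j)))"
    unfolding mat_norm_def using W by (simp add: sum_distrib_left)
  also have "\<dots> = (\<Sum>i<n. \<Sum>j<n. norm ((W * H) $$ (i, j) - (H * W) $$ (i, j)))"
  proof (intro sum.cong refl arg_cong[of _ _ norm])
    fix i j assume ij: "i \<in> {..<n}" "j \<in> {..<n}"
    let ?u = "\<lambda>l. if l = j then 1 else (0::quat)"
    have "mat_op (H * W) ?u = mat_op (W * H) ?u - (2 * real (Suc k)) *\<^sub>R mat_op W ?u"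
      unfolding mat_op_mult[OF H W] mat_op_mult[OF W H] Wop by (rule comm)
    then have "mat_op (H * W) ?u i = mat_op (W * H) ?u i - (2 * real (Suc k)) *\<^sub>R mat_op W ?u i"
      by simp
    moreover have "mat_op (H * W) ?u i = (H * W) $$ (i, j)" "mat_op (W * H) ?u i = (W * H) $$ (i, j)"
      "mat_op W ?u i = W $$ (i, j)"
      by (rule mat_op_unit; use ij H W in simp)+
    ultimately show "(2 * real (Suc k)) *\<^sub>R W $$ (i, j) = (W * H) $$ (i, j) - (H * W) $$ (i, j)" by simp
  qed
  also have "\<dots> \<le> (\<Sum>i<n. \<Sum>j<n. norm ((W * H) $$ (i, j)) + norm ((H * W) $$ (i, j)))"
    by (intro sum_mono norm_triangle_ineq4)
  also have "\<dots> = mat_norm (W * H) + mat_norm (H * W)"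
    unfolding mat_norm_def using W H by (simp add: sum.distrib)
  also have "\<dots> \<le> 2 * mat_norm H * mat_norm W"
    using mat_norm_mult[OF W H] mat_norm_mult[OF H W] mult.commute[of "mat_norm W" "mat_norm H"] by linarith
  finally have "(real (Suc k) - mat_norm H) * mat_norm W \<le> 0"
    by (simp add: algebra_simps)
  then have "mat_norm W = 0"
    using k mat_norm_nonneg[of W] by (simp add: mult_le_0_iff)
  then have "W = 0\<^sub>m n n" using mat_norm_eq_0 W by blast
  then have "(?y ^^ Suc k) f = 0" for f
    using Wop[of f] mat_op_zero[of n n f] by simp
  then show ?thesis by blast
qed

section \<open>The representation on functions given by a triple\<close>

locale quat_triple =
  fixes n :: nat and X H Y :: "quat mat"
  assumes triple: "sl2_triple n X H Y" and nilpotent: "nilpotent_mat X"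
begin

lemma carrier: "X \<in> carrier_mat n n" "H \<in> carrier_mat n n" "Y \<in> carrier_mat n n"
  using triple by (auto simp: sl2_triple_def sl_def lie_algebra_def)

lemma bracket_op:
  assumes "A \<in> carrier_mat n n" "B \<in> carrier_mat n n"
  shows "mat_op (bracket A B) f = mat_op A (mat_op B f) - mat_op B (mat_op A f)"
  using assms by (simp add: bracket_def mat_op_diff[of _ n n] mat_op_mult[of _ n n _ n])

lemma op_relations:
  "mat_op H (mat_op X f) = mat_op X (mat_op H f) + 2 *\<^sub>R mat_op X f"
  "mat_op H (mat_op Y f) = mat_op Y (mat_op H f) - 2 *\<^sub>R mat_op Y f"
  "mat_op X (mat_op Y f) = mat_op Y (mat_op X f) + mat_op H f"
proof -
  have "mat_op (bracket H X) f = 2 *\<^sub>R mat_op X f" "mat_op (bracket H Y) f = (- 2) *\<^sub>R mat_op Y f"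
    "mat_op (bracket X Y) f = mat_op H f"
    using triple mat_op_smult[of 2 X f] mat_op_smult[of "- 2" Y f] by (auto simp: sl2_triple_def)
  then show "mat_op H (mat_op X f) = mat_op X (mat_op H f) + 2 *\<^sub>R mat_op X f"
    "mat_op H (mat_op Y f) = mat_op Y (mat_op H f) - 2 *\<^sub>R mat_op Y f"
    "mat_op X (mat_op Y f) = mat_op Y (mat_op X f) + mat_op H f"
    by (simp_all add: bracket_op carrier diff_eq_eq add.commute)
qed

lemma x_nilpotent: "\<exists>m. \<forall>f. (mat_op X ^^ m) f = 0"
proof -
  obtain k where "X ^\<^sub>m k = 0\<^sub>m n n" using nilpotent carrier by (auto simp: nilpotent_mat_def)
  then have "X ^\<^sub>m Suc k = 0\<^sub>m n n" using carrier by simp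
  then show ?thesis using mat_op_pow[OF carrier(1), of k] mat_op_zero[of n n] by metis
qed

sublocale sl2_rep "mat_op X" "mat_op H" "mat_op Y"
proof (rule sl2_rep.intro)
  show "\<exists>m. (mat_op X ^^ m) v = 0" for v using x_nilpotent by blast
  show "\<exists>m. (mat_op Y ^^ m) v = 0" for v
    using weight_nilpotent[OF carrier(2,3) op_relations(2)] by blast
qed (use op_relations linear_mat_op in auto)

lemma pow_supported: "f \<in> supported n \<Longrightarrow> (mat_op X ^^ l) f \<in> supported n"
  by (cases l) (auto intro: mat_op_supported carrier)

text \<open>Functions that vanish below \<open>n\<close> are killed by all three operators and so
  belong to \<open>lowest 0\<close>; strings must therefore be cut down to
  \<open>supported n\<close>. Multiplication by \<open>1\<^sub>m n\<close> is this truncation, and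
  it commutes with the triple, hence maps strings to strings.\<close>

lemma span_strings_supported:
  assumes "f \<in> supported n"
  shows "f \<in> span {(mat_op X ^^ l) v | l k v. v \<in> lowest k \<inter> supported n \<and> l \<le> k}"
proof -
  let ?p = "mat_op (1\<^sub>m n)"
  have comm: "?p (mat_op A v) = mat_op A (?p v)" if "A \<in> carrier_mat n n" for A v
    using that mat_op_mult[of "1\<^sub>m n" n n A n v] mat_op_mult[of A n n "1\<^sub>m n" n v] by simp
  have "?p ((mat_op X ^^ l) v) = (mat_op X ^^ l) (?p v)" for l v
    by (induction l) (simp_all add: comm carrier)
  moreover have "?p v \<in> lowest k \<inter> supported n" if "v \<in> lowest k" for k v
    using that comm[OF carrier(2), of v] comm[OF carrier(3), of v] linear_mat_op[of "1\<^sub>m n"]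
    by (auto simp: lowest_def linear_0 linear_scale linear_neg mat_op_supported[OF one_carrier_mat])
  ultimately have "?p ` strings \<subseteq> {(mat_op X ^^ l) v | l k v. v \<in> lowest k \<inter> supported n \<and> l \<le> k}"
    unfolding strings_def by blast
  moreover have "?p f \<in> span (?p ` strings)"
    using span_strings[of f] linear_span_image[OF linear_mat_op, of "1\<^sub>m n" strings] by blast
  ultimately show ?thesis
    unfolding mat_op_one[OF assms] by (meson span_mono subsetD)
qed

section \<open>Irreducible submodules and the spaces L(k)\<close>

lemma triple_span_op:
  assumes "w \<in> carrier_vec n"
  shows "of_vec ((of_real a \<cdot>\<^sub>m X + of_real b \<cdot>\<^sub>m H + of_real c \<cdot>\<^sub>m Y) *\<^sub>v w)
    = a *\<^sub>R mat_op X (of_vec w) + b *\<^sub>R mat_op H (of_vec w) + c *\<^sub>R mat_op Y (of_vec w)"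
proof -
  have "of_real a \<cdot>\<^sub>m X + of_real b \<cdot>\<^sub>m H + of_real c \<cdot>\<^sub>m Y \<in> carrier_mat n n"
    using carrier by auto
  with assms show ?thesis
    using carrier by (subst of_vec_mult) (auto simp: mat_op_add[of _ n n] mat_op_smult)
qed

lemma real_submodule_iff:
  assumes W: "W \<subseteq> carrier_vec n"
  shows "real_submodule n (triple_span X H Y) W \<longleftrightarrow> invariant (of_vec ` W)"
proof
  assume *: "real_submodule n (triple_span X H Y) W"
  have "a *\<^sub>R mat_op X (of_vec w) + b *\<^sub>R mat_op H (of_vec w) + c *\<^sub>R mat_op Y (of_vec w) \<in> of_vec ` W"
    if "w \<in> W" for a b c w
  proof -
    have "(of_real a \<cdot>\<^sub>m X + of_real b \<cdot>\<^sub>m H + of_real c \<cdot>\<^sub>m Y) *\<^sub>v w \<in> W"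
      using * that unfolding real_submodule_def triple_span_def by blast
    then show ?thesis using triple_span_op[of w a b c] W that by (metis image_eqI subsetD)
  qed
  from this[of _ 1 0 0] this[of _ 0 1 0] this[of _ 0 0 1] show "invariant (of_vec ` W)"
    using * right_subspace_real_iff[OF W] by (auto simp: invariant_def real_submodule_def)
next
  assume *: "invariant (of_vec ` W)"
  have "A *\<^sub>v w \<in> W" if A: "A \<in> triple_span X H Y" and w: "w \<in> W" for A w
  proof -
    obtain a b c where A: "A = of_real a \<cdot>\<^sub>m X + of_real b \<cdot>\<^sub>m H + of_real c \<cdot>\<^sub>m Y"
      using A unfolding triple_span_def by blast
    have wc: "w \<in> carrier_vec n" using w W by blast
    have "subspace (of_vec ` W)" using * by (simp add: invariant_def)
    then have "of_vec (A *\<^sub>v w) \<in> of_vec ` W"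
      unfolding A triple_span_op[OF wc] using * w
      by (intro subspace_add subspace_scale) (auto simp: invariant_def)
    moreover have "A *\<^sub>v w \<in> carrier_vec n" 
      unfolding A using carrier wc by (intro mult_mat_vec_carrier[of _ n n]) auto
    ultimately show ?thesis using inj_on_image_mem_iff[OF of_vec_inj] W by blast
  qed
  then show "real_submodule n (triple_span X H Y) W"
    using * right_subspace_real_iff[OF W] by (auto simp: invariant_def real_submodule_def)
qed

lemma string_supported: "f \<in> supported n \<Longrightarrow> string k f \<subseteq> supported n"
  unfolding string_def by (intro span_minimal subspace_supported) (auto intro: pow_supported)

lemma preimage_of_vec: "U \<subseteq> supported n \<Longrightarrow> of_vec ` {w \<in> carrier_vec n. of_vec w \<in> U} = U"
  unfolding of_vec_carrier[symmetric] by blast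

lemma string_irreducible_submodule:
  assumes v: "v \<in> lowest k" "v \<in> supported n" "v \<noteq> 0"
  defines "W \<equiv> {w \<in> carrier_vec n. of_vec w \<in> string k v}"
  shows "irreducible_submodule n (triple_span X H Y) W" "right_dim \<real> n W = k + 1"
proof -
  have W: "W \<subseteq> carrier_vec n" by (auto simp: W_def)
  have im: "of_vec ` W = string k v"
    unfolding W_def using v(2) by (intro preimage_of_vec string_supported)
  have inv: "invariant (of_vec ` W)" unfolding im using v(1) by (rule invariant_string)
  have "v \<in> of_vec ` W" unfolding im by (rule in_string)
  then have "W \<noteq> {0\<^sub>v n}" using v(3) of_vec_zero[of n] by auto
  moreover have "U = {0\<^sub>v n} \<or> U = W"
    if U: "real_submodule n (triple_span X H Y) U" "U \<subseteq> W" for U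
  proof -
    have Uc: "U \<subseteq> carrier_vec n" using U(2) W by blast
    have "of_vec ` U = {0} \<or> of_vec ` U = of_vec ` W"
      using string_irreducible[OF v(1), of "of_vec ` U"] real_submodule_iff[OF Uc] U im by blast
    moreover have "{0} = of_vec ` {0\<^sub>v n}" by (simp add: of_vec_zero)
    ultimately show ?thesis
      using inj_on_image_eq_iff[OF of_vec_inj Uc, of "{0\<^sub>v n}"] inj_on_image_eq_iff[OF of_vec_inj Uc W] by auto
  qed
  ultimately show "irreducible_submodule n (triple_span X H Y) W"
    unfolding irreducible_submodule_def using real_submodule_iff[OF W] inv by blast
  have "right_subspace \<real> n W"
    using right_subspace_real_iff[OF W] inv by (simp add: invariant_def)
  then show "right_dim \<real> n W = k + 1"
    using right_dim_real im string_basis(3)[OF v(1,3)] by simp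
qed

text \<open>An irreducible submodule contains a nonzero lowest weight vector and with it an entire
  string, which must be all of it; comparing the dimensions \<open>j + 1\<close> and
  \<open>k + 1\<close> gives \<open>j = k\<close>.\<close>

lemma irreducible_submodule_string:
  assumes irr: "irreducible_submodule n (triple_span X H Y) W" and dim: "right_dim \<real> n W = k + 1"
  shows "of_vec ` W \<subseteq> isotypic k"
proof -
  have sub: "right_subspace \<real> n W"
    using irr by (simp add: irreducible_submodule_def real_submodule_def)
  then have W: "W \<subseteq> carrier_vec n" by (simp add: right_subspace_def)
  have inv: "invariant (of_vec ` W)"
    using irr real_submodule_iff[OF W] by (simp add: irreducible_submodule_def)
  have "of_vec ` W \<noteq> of_vec ` {0\<^sub>v n}"
    using irr inj_on_image_eq_iff[OF of_vec_inj W, of "{0\<^sub>v n}"] by (simp add: irreducible_submodule_def)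
  then have "of_vec ` W \<noteq> {0}" by (simp add: of_vec_zero)
  with inv obtain j u where u: "u \<in> of_vec ` W" "u \<in> lowest j" "u \<noteq> 0"
    by (rule invariant_lowest)
  let ?U = "{w \<in> carrier_vec n. of_vec w \<in> string j u}"
  have us: "u \<in> supported n" using u(1) W of_vec_carrier[of n] by blast
  have im: "of_vec ` ?U = string j u" by (rule preimage_of_vec[OF string_supported[OF us]])
  have U: "irreducible_submodule n (triple_span X H Y) ?U" "right_dim \<real> n ?U = j + 1"
    using string_irreducible_submodule[OF u(2) us u(3)] by auto
  have "of_vec ` ?U \<subseteq> of_vec ` W" unfolding im using string_minimal[OF inv u(1)] .
  then have "?U \<subseteq> W" using inj_on_image_mem_iff[OF of_vec_inj] W by blast
  moreover have "real_submodule n (triple_span X H Y) ?U" "?U \<noteq> {0\<^sub>v n}"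
    using U(1) unfolding irreducible_submodule_def by blast+
  ultimately have "?U = W" using irr unfolding irreducible_submodule_def by blast
  then have "j = k" "of_vec ` W = string j u" using U(2) dim im by auto
  then show ?thesis using string_subset_isotypic u(2) by simp
qed

text \<open>\<open>M_space\<close> lies in \<open>isotypic k\<close>, where vectors killed by
  \<open>Y\<close> have weight \<open>-k\<close>. Conversely a nonzero lowest weight vector lies in
  its own string, an irreducible submodule of dimension \<open>k + 1\<close>. In this description,
  unlike in the real span, stability under right scalars is evident.\<close>

lemma L_space_eq: "L_space n X H Y k = {v \<in> carrier_vec n. of_vec v \<in> lowest k}"
proof -
  let ?S = "\<Union>{W. irreducible_submodule n (triple_span X H Y) W \<and> right_dim \<real> n W = k + 1}"
  have S: "?S \<subseteq> carrier_vec n"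
    by (auto simp: irreducible_submodule_def real_submodule_def right_subspace_def)
  have M: "of_vec ` M_space n X H Y k = span (of_vec ` ?S)"
    unfolding M_space_def by (rule of_vec_right_span[OF S])
  have Mc: "M_space n X H Y k \<subseteq> carrier_vec n"
    using right_subspace_span[OF S, of \<real>] by (simp add: M_space_def right_subspace_def)
  have y: "Y *\<^sub>v v = 0\<^sub>v n \<longleftrightarrow> mat_op Y (of_vec v) = 0" if "v \<in> carrier_vec n" for v
    using of_vec_mult[of v Y] of_vec_eq_0[of "Y *\<^sub>v v" n] carrier that by auto
  show ?thesis
  proof (intro subset_antisym subsetI)
    fix v assume v: "v \<in> L_space n X H Y k"
    then have "of_vec v \<in> span (of_vec ` ?S)" using M by (auto simp: L_space_def)
    moreover have "of_vec ` ?S \<subseteq> isotypic k" using irreducible_submodule_string by blast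
    ultimately have "of_vec v \<in> isotypic k"
      using span_minimal[of "of_vec ` ?S" "isotypic k"] by (auto simp: isotypic_def)
    then show "v \<in> {v \<in> carrier_vec n. of_vec v \<in> lowest k}"
      using v y isotypic_ker_y by (auto simp: L_space_def)
  next
    fix v assume v: "v \<in> {v \<in> carrier_vec n. of_vec v \<in> lowest k}"
    have "v \<in> M_space n X H Y k"
    proof (cases "of_vec v = 0")
      \<comment> \<open>The zero vector generates no irreducible submodule; it is in
        \<open>M_space\<close> only as the zero of a subspace.\<close>
      case True
      then have "v = 0\<^sub>v n" using v of_vec_eq_0 by blast
      then show ?thesis
        using right_subspace_span[OF S, of \<real>] by (simp add: M_space_def right_subspace_def)
    next
      case False
      have "of_vec v \<in> supported n" using v of_vec_carrier[of n] by blast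
      then have "v \<in> ?S"
        using string_irreducible_submodule[of "of_vec v" k] v False in_string[of "of_vec v" k] by blast
      then show ?thesis unfolding M_space_def by (rule right_span_base)
    qed
    then show "v \<in> L_space n X H Y k" using v y by (auto simp: L_space_def lowest_def)
  qed
qed

lemma lowest_rscale: "v \<in> lowest k \<Longrightarrow> rscale v q \<in> lowest k"
  by (auto simp: lowest_def mat_op_rscale)

lemma of_vec_L_space: "of_vec ` L_space n X H Y k = lowest k \<inter> supported n"
  unfolding L_space_eq of_vec_carrier[symmetric] by blast

lemma right_subspace_L_space: "right_subspace UNIV n (L_space n X H Y k)"
  unfolding right_subspace_def L_space_eq
proof (intro conjI ballI)
  show "0\<^sub>v n \<in> {v \<in> carrier_vec n. of_vec v \<in> lowest k}"
    using subspace_0[OF subspace_lowest[of k]] by (simp add: of_vec_zero)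
  show "v + w \<in> {v \<in> carrier_vec n. of_vec v \<in> lowest k}"
    if "v \<in> {v \<in> carrier_vec n. of_vec v \<in> lowest k}" "w \<in> {v \<in> carrier_vec n. of_vec v \<in> lowest k}"
    for v w
    using that subspace_add[OF subspace_lowest[of k]] by (simp add: of_vec_add[of _ n])
  show "v \<cdot>\<^sub>r q \<in> {v \<in> carrier_vec n. of_vec v \<in> lowest k}"
    if "v \<in> {v \<in> carrier_vec n. of_vec v \<in> lowest k}" for v q
    using that lowest_rscale by (simp add: of_vec_rscale) (simp add: smult_vec_right_def)
qed auto

text \<open>At \<open>d = 0\<close> truncated subtraction repeats the case \<open>d = 1\<close>;
  this is harmless, as \<open>parts\<close> admits only \<open>d \<ge> 1\<close>.\<close>

lemma lowest_basis:
  assumes "t = multiplicity_of n X H Y d"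
  obtains b where "\<And>i. i < t \<Longrightarrow> b i \<in> lowest (d - 1) \<inter> supported n"
    and "\<And>f. f \<in> lowest (d - 1) \<inter> supported n \<Longrightarrow> \<exists>w. f = (\<Sum>i<t. rscale (b i) (w i))"
    and "\<And>w i. (\<Sum>i<t. rscale (b i) (w i)) = 0 \<Longrightarrow> i < t \<Longrightarrow> w i = 0"
proof (rule right_basis_coordinates[OF right_subspace_L_space[of "d - 1"],
      folded multiplicity_of_def assms, unfolded of_vec_L_space], goal_cases)
  case (1 b)
  show thesis by (rule that[of b]) (fact 1)+
qed

text \<open>A nonzero lowest weight vector \<open>v\<close> for the part \<open>d\<close> has
  \<open>X^(d-1) v\<close> nonzero, so \<open>d\<close> cannot exceed an exponent that annihilates
  \<open>X\<close>.\<close>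

lemma finite_parts: "finite (parts n X H Y)"
proof -
  obtain m where m: "\<And>f. (mat_op X ^^ m) f = 0" using x_nilpotent by blast
  have "d \<le> m" if d: "d \<in> parts n X H Y" for d
  proof (rule ccontr)
    assume "\<not> d \<le> m"
    then have le: "m \<le> d - 1" by simp
    let ?t = "multiplicity_of n X H Y d"
    obtain b where b: "\<And>i. i < ?t \<Longrightarrow> b i \<in> lowest (d - 1) \<inter> supported n"
      "\<And>w i. (\<Sum>i<?t. rscale (b i) (w i)) = 0 \<Longrightarrow> i < ?t \<Longrightarrow> w i = 0"
      using lowest_basis[OF refl] by metis
    have t: "0 < ?t" using d by (simp add: parts_def)
    have "b i = 0" if "i < ?t" for i
      using b(1)[OF that] lowest_eq_0[OF _ le m] by blast
    then have "(\<Sum>i<?t. rscale (b i) 1) = 0" by simp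
    then have "(1::quat) = 0" using b(2)[of "\<lambda>_. 1" 0] t by simp
    then show False by simp
  qed
  then show ?thesis by (meson atMost_iff finite_atMost finite_subset subsetI)
qed

end

section \<open>The centralizer in a basis of strings\<close>

abbreviation unit_fun :: "nat \<Rightarrow> nat \<Rightarrow> quat" where
  "unit_fun j \<equiv> \<lambda>l. if l = j then 1 else 0"

lemma mat_op_unit_eqI:
  assumes "A \<in> carrier_mat n m" "B \<in> carrier_mat n m"
    and "\<And>j. j < m \<Longrightarrow> mat_op A (unit_fun j) = mat_op B (unit_fun j)"
  shows "A = B"
proof (rule eq_matI)
  fix i j assume ij: "i < dim_row B" "j < dim_col B"
  have "A $$ (i, j) = mat_op A (unit_fun j) i" "B $$ (i, j) = mat_op B (unit_fun j) i"
    by (rule mat_op_unit[symmetric]; use assms(1,2) ij in simp)+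
  then show "A $$ (i, j) = B $$ (i, j)" using assms(2) assms(3)[of j] ij by auto
qed (use assms in auto)

lemma unit_fun_supported: "j < n \<Longrightarrow> unit_fun j \<in> supported n"
  by (auto simp: supported_def)

lemma sum_in_subspace_rscale:
  assumes "subspace W" "\<And>f q. f \<in> W \<Longrightarrow> rscale f q \<in> W" "\<And>i. i \<in> I \<Longrightarrow> b i \<in> W"
  shows "(\<Sum>i\<in>I. rscale (b i) (w i)) \<in> W"
  using assms by (intro subspace_sum) auto

text \<open>\<open>P\<close> may be rectangular. The columns of \<open>Q\<close> come from preimages
  of the unit vectors, so \<open>P Q = 1\<close>; then \<open>P (Q P - 1) = 0\<close>, and
  injectivity gives the other identity.\<close>

lemma invertible_matI:
  fixes P :: "quat mat"
  assumes P: "P \<in> carrier_mat n m"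
    and surj: "\<And>f. f \<in> supported n \<Longrightarrow> \<exists>g. mat_op P g = f"
    and inj: "\<And>g. g \<in> supported m \<Longrightarrow> mat_op P g = 0 \<Longrightarrow> g = 0"
  obtains Q where "Q \<in> carrier_mat m n" "P * Q = 1\<^sub>m n" "Q * P = 1\<^sub>m m"
proof -
  have "\<forall>r. \<exists>g. r < n \<longrightarrow> mat_op P g = unit_fun r"
    using surj unit_fun_supported by blast
  then obtain g where g: "\<And>r. r < n \<Longrightarrow> mat_op P (g r) = unit_fun r" by metis
  define Q where "Q = mat m n (\<lambda>(c, r). g r c)"
  have Q: "Q \<in> carrier_mat m n" by (simp add: Q_def)
  \<comment> \<open>A preimage \<open>g r\<close> may have entries beyond \<open>m\<close>;
    truncation by \<open>1\<^sub>m m\<close> does not change its image under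
    \<open>P\<close>.\<close>
  have P1: "mat_op P (mat_op (1\<^sub>m m) f) = mat_op P f" for f
    using mat_op_mult[OF P one_carrier_mat, of f] P by simp
  have PQ: "P * Q = 1\<^sub>m n"
  proof (rule mat_op_unit_eqI)
    fix r assume r: "r < n"
    have "mat_op Q (unit_fun r) = mat_op (1\<^sub>m m) (g r)"
    proof
      fix c
      show "mat_op Q (unit_fun r) c = mat_op (1\<^sub>m m) (g r) c"
      proof (cases "c < m")
        case True
        then have "mat_op Q (unit_fun r) c = g r c"
          using r by (subst mat_op_unit) (auto simp: Q_def)
        moreover have "mat_op (1\<^sub>m m) (g r) c = g r c"
          using True by (simp add: mat_op_def if_distrib[of "\<lambda>a. a * _"] cong: if_cong)
        ultimately show ?thesis by simp
      next
        case False
        then show ?thesis using Q by (simp add: mat_op_def)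
      qed
    qed
    then have "mat_op (P * Q) (unit_fun r) = unit_fun r"
      unfolding mat_op_mult[OF P Q] using P1 g[OF r] by simp
    also have "\<dots> = mat_op (1\<^sub>m n) (unit_fun r)"
      using mat_op_one[OF unit_fun_supported[OF r]] by simp
    finally show "mat_op (P * Q) (unit_fun r) = mat_op (1\<^sub>m n) (unit_fun r)" .
  qed (use P Q in auto)
  moreover have "Q * P = 1\<^sub>m m"
  proof (rule mat_op_unit_eqI)
    fix c assume c: "c < m"
    have "mat_op P (mat_op (Q * P) (unit_fun c)) = mat_op (P * (Q * P)) (unit_fun c)"
      using mat_op_mult[OF P, of "Q * P" m "unit_fun c"] P Q by simp
    also have "P * (Q * P) = P"
      using assoc_mult_mat[OF P Q P] PQ P by simp
    finally have "mat_op P (mat_op (Q * P) (unit_fun c) - unit_fun c) = 0"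
      by (simp only: linear_diff[OF linear_mat_op] diff_self)
    moreover have "mat_op (Q * P) (unit_fun c) - unit_fun c \<in> supported m"
      by (intro subspace_diff subspace_supported unit_fun_supported c mat_op_supported[of _ m m])
        (use P Q in auto)
    ultimately have "mat_op (Q * P) (unit_fun c) - unit_fun c = 0" by (rule inj[rotated])
    then have "mat_op (Q * P) (unit_fun c) = unit_fun c" by (simp only: right_minus_eq)
    also have "\<dots> = mat_op (1\<^sub>m m) (unit_fun c)"
      using mat_op_one[OF unit_fun_supported[OF c]] by simp
    finally show "mat_op (Q * P) (unit_fun c) = mat_op (1\<^sub>m m) (unit_fun c)" .
  qed (use P Q in auto)
  ultimately show thesis using that Q by blast
qed

section \<open>The change of basis matrix\<close>

lemma (in quat_triple) pow_rscale: "(mat_op X ^^ l) (rscale f q) = rscale ((mat_op X ^^ l) f) q"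
  by (induction l) (simp_all add: mat_op_rscale)

text \<open>Fixes the choices behind the basis: \<open>b d\<close> is a quaternionic basis of the
  lowest weight space for \<open>d\<close>, \<open>bl\<close> lists one block \<open>(d, l)\<close>
  for each \<open>l < d\<close>, and \<open>e\<close> numbers the positions within all blocks, so
  that the columns of the basis matrix and of block diagonal matrices are indexed alike.\<close>

locale triple_basis = quat_triple +
  fixes t :: "nat \<Rightarrow> nat" and N :: "nat set" and b :: "nat \<Rightarrow> nat \<Rightarrow> nat \<Rightarrow> quat"
    and bl :: "(nat \<times> nat) list" and e :: "(nat \<times> nat) \<times> nat \<Rightarrow> nat"
  assumes N_def: "N = {d. 1 \<le> d \<and> 0 < t d}"
    and b_lowest: "\<And>d i. i < t d \<Longrightarrow> b d i \<in> lowest (d - 1) \<inter> supported n"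
    and b_span: "\<And>d f. f \<in> lowest (d - 1) \<inter> supported n \<Longrightarrow> \<exists>w. f = (\<Sum>i<t d. rscale (b d i) (w i))"
    and b_indep: "\<And>d w i. (\<Sum>i<t d. rscale (b d i) (w i)) = 0 \<Longrightarrow> i < t d \<Longrightarrow> w i = 0"
    and set_bl: "set bl = (SIGMA d:N. {..<d})" and distinct_bl: "distinct bl"
    and e_bij: "bij_betw e (SIGMA p:set bl. {..<t (fst p)}) {..<sum_list (map (\<lambda>p. t (fst p)) bl)}"
    and e_entry: "\<And>(F :: _ \<Rightarrow> quat mat) p q i j.
      (\<And>p. p \<in> set bl \<Longrightarrow> F p \<in> carrier_mat (t (fst p)) (t (fst p))) \<Longrightarrow>
      p \<in> set bl \<Longrightarrow> q \<in> set bl \<Longrightarrow> i < t (fst p) \<Longrightarrow> j < t (fst q) \<Longrightarrow>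
      diag_block_mat (map F bl) $$ (e (p, i), e (q, j)) = (if p = q then F p $$ (i, j) else 0)"
begin

definition col_fun :: "nat \<times> nat \<Rightarrow> nat \<Rightarrow> nat \<Rightarrow> quat" where
  "col_fun p i = (mat_op X ^^ snd p) (b (fst p) i)"

definition m :: nat where "m = sum_list (map (\<lambda>p. t (fst p)) bl)"

definition idx :: "nat \<Rightarrow> (nat \<times> nat) \<times> nat" where
  "idx = inv_into (SIGMA p:set bl. {..<t (fst p)}) e"

definition P :: "quat mat" where
  "P = mat n m (\<lambda>(r, c). col_fun (fst (idx c)) (snd (idx c)) r)"

lemma P_carrier: "P \<in> carrier_mat n m"
  by (simp add: P_def)

lemma e_less: "p \<in> set bl \<Longrightarrow> i < t (fst p) \<Longrightarrow> e (p, i) < m"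
  using bij_betwE[OF e_bij] by (auto simp: m_def)

lemma e_inj:
  assumes "p \<in> set bl" "i < t (fst p)" "q \<in> set bl" "j < t (fst q)"
  shows "e (p, i) = e (q, j) \<longleftrightarrow> p = q \<and> i = j"
  using inj_onD[OF bij_betw_imp_inj_on[OF e_bij], of "(p, i)" "(q, j)"] assms by auto

lemma e_surj:
  assumes "c < m"
  obtains p i where "p \<in> set bl" "i < t (fst p)" "c = e (p, i)"
proof -
  have "c \<in> e ` (SIGMA p:set bl. {..<t (fst p)})"
    using bij_betw_imp_surj_on[OF e_bij] assms by (simp add: m_def)
  then show thesis using that by auto
qed

lemma idx_e: "p \<in> set bl \<Longrightarrow> i < t (fst p) \<Longrightarrow> idx (e (p, i)) = (p, i)"
  unfolding idx_def by (intro inv_into_f_f bij_betw_imp_inj_on[OF e_bij]) auto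

lemma b_supported: "i < t d \<Longrightarrow> b d i \<in> supported n"
  using b_lowest by blast

lemma col_fun_supported: "i < t (fst p) \<Longrightarrow> col_fun p i \<in> supported n"
  unfolding col_fun_def by (intro pow_supported b_supported)

lemma mat_op_P: "mat_op P g = (\<Sum>p\<in>set bl. \<Sum>i<t (fst p). rscale (col_fun p i) (g (e (p, i))))"
proof
  fix r
  show "mat_op P g r = (\<Sum>p\<in>set bl. \<Sum>i<t (fst p). rscale (col_fun p i) (g (e (p, i)))) r"
  proof (cases "r < n")
    case True
    then have "mat_op P g r = (\<Sum>c<m. P $$ (r, c) * g c)" by (simp add: mat_op_def P_def)
    also have "\<dots> = (\<Sum>p\<in>set bl. \<Sum>i<t (fst p). P $$ (r, e (p, i)) * g (e (p, i)))"
      by (rule sum_diag_block_index[OF e_bij[folded m_def]])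
    also have "\<dots> = (\<Sum>p\<in>set bl. \<Sum>i<t (fst p). col_fun p i r * g (e (p, i)))"
      using True by (intro sum.cong refl) (simp add: P_def e_less idx_e)
    finally show ?thesis by (simp add: sum_fun_apply rscale_def)
  next
    case False
    then have "col_fun p i r = 0" if "i < t (fst p)" for p i
      using col_fun_supported[OF that] by (simp add: supported_def)
    then show ?thesis using False by (simp add: sum_fun_apply rscale_def mat_op_def P_def)
  qed
qed

lemma mat_op_P_unit:
  assumes "q \<in> set bl" "j < t (fst q)"
  shows "mat_op P (unit_fun (e (q, j))) = col_fun q j"
proof -
  have "mat_op P (unit_fun (e (q, j)))
      = (\<Sum>p\<in>set bl. if p = q then \<Sum>i<t (fst p). if i = j then col_fun p i else 0 else 0)"
    unfolding mat_op_P
  proof (rule sum.cong[OF refl])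
    fix p assume p: "p \<in> set bl"
    have "rscale (col_fun p i) (unit_fun (e (q, j)) (e (p, i))) = (if p = q then if i = j then col_fun p i else 0 else 0)"
      if "i < t (fst p)" for i
      using e_inj[OF p that assms] by simp
    then show "(\<Sum>i<t (fst p). rscale (col_fun p i) (unit_fun (e (q, j)) (e (p, i))))
        = (if p = q then \<Sum>i<t (fst p). if i = j then col_fun p i else 0 else 0)"
      by simp
  qed
  then show ?thesis using assms by simp
qed

lemma block_in_bl: "d \<in> N \<Longrightarrow> l < d \<Longrightarrow> (d, l) \<in> set bl"
  by (simp add: set_bl)

lemma P_surj:
  assumes "f \<in> supported n"
  shows "\<exists>g. mat_op P g = f"
proof -
  let ?S = "{(mat_op X ^^ l) v | l k v. v \<in> lowest k \<inter> supported n \<and> l \<le> k}"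
  have "?S \<subseteq> range (mat_op P)"
  proof clarify
    fix l k v assume v: "v \<in> lowest k" "v \<in> supported n" and l: "l \<le> k"
    obtain w where w: "v = (\<Sum>i<t (Suc k). rscale (b (Suc k) i) (w i))"
      using b_span[of v "Suc k"] v by auto
    show "(mat_op X ^^ l) v \<in> range (mat_op P)"
    proof (cases "t (Suc k) = 0")
      \<comment> \<open>Here \<open>Suc k\<close> is not a part, so there is no block for it, and
        \<open>v\<close> is an empty combination.\<close>
      case True
      then have "v = 0" unfolding w by simp
      then show ?thesis using linear_0[OF linear_mat_op, of P] by (metis pow_zero rangeI)
    next
      case False
      let ?q = "(Suc k, l)"
      have q: "?q \<in> set bl" using False l by (intro block_in_bl) (auto simp: N_def)
      \<comment> \<open>The coordinates of \<open>v\<close>, placed in the block that belongs to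
        \<open>X^l\<close>.\<close>
      define g where "g c = (if fst (idx c) = ?q then w (snd (idx c)) else 0)" for c
      have "mat_op P g = (\<Sum>p\<in>set bl. if p = ?q then \<Sum>i<t (fst p). rscale (col_fun p i) (w i) else 0)"
        unfolding mat_op_P by (intro sum.cong refl) (auto simp: g_def idx_e intro!: sum.neutral sum.cong)
      also have "\<dots> = (\<Sum>i<t (Suc k). rscale (col_fun ?q i) (w i))"
        using q by simp
      also have "\<dots> = (mat_op X ^^ l) v"
        unfolding w col_fun_def linear_sum[OF linear_pow] fst_conv snd_conv pow_rscale ..
      finally have "(mat_op X ^^ l) v = mat_op P g" ..
      then show ?thesis by (rule image_eqI[where x = g]) (rule UNIV_I)
    qed
  qed
  then have "span ?S \<subseteq> range (mat_op P)"
    by (intro span_minimal linear_subspace_image[OF linear_mat_op] subspace_UNIV)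
  then show ?thesis using span_strings_supported[OF assms] by blast
qed

text \<open>Grouped by blocks, \<open>P g\<close> is a sum of terms \<open>X^l (v k l)\<close> with
  \<open>v k l\<close> in \<open>lowest k\<close>. Independence of strings annihilates every
  \<open>v k l\<close> that occurs, and independence of \<open>b\<close> then annihilates the
  coordinates.\<close>

lemma P_inj:
  assumes g: "g \<in> supported m" "mat_op P g = 0"
  shows "g = 0"
proof -
  define v where "v k l = (\<Sum>i<t (Suc k). rscale (b (Suc k) i) (g (e ((Suc k, l), i))))" for k l
  let ?I = "(\<lambda>(d, l). (d - 1, l)) ` set bl"
  have d1: "1 \<le> d" if "(d, l) \<in> set bl" for d l
    using that by (auto simp: set_bl N_def)
  have inj: "inj_on (\<lambda>(d, l). (d - 1, l)) (set bl)"
    by (rule inj_onI) (auto dest!: d1)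
  have "v k l \<in> lowest k" for k l
    unfolding v_def using b_lowest[of _ "Suc k"]
    by (intro sum_in_subspace_rscale subspace_lowest lowest_rscale) auto
  moreover have "l \<le> k" if "(k, l) \<in> ?I" for k l
    using that d1 by (force simp: set_bl)
  moreover have "(\<Sum>(k, l)\<in>?I. (mat_op X ^^ l) (v k l)) = 0"
  proof -
    have "(\<Sum>(k, l)\<in>?I. (mat_op X ^^ l) (v k l)) = (\<Sum>p\<in>set bl. (mat_op X ^^ snd p) (v (fst p - 1) (snd p)))"
      by (subst sum.reindex[OF inj]) (simp add: split_def o_def)
    also have "\<dots> = (\<Sum>p\<in>set bl. \<Sum>i<t (fst p). rscale (col_fun p i) (g (e (p, i))))"
    proof (rule sum.cong[OF refl])
      fix p assume "p \<in> set bl"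
      then have "Suc (fst p - 1) = fst p" using d1[of "fst p" "snd p"] by simp
      then show "(mat_op X ^^ snd p) (v (fst p - 1) (snd p))
          = (\<Sum>i<t (fst p). rscale (col_fun p i) (g (e (p, i))))"
        unfolding v_def col_fun_def linear_sum[OF linear_pow] pow_rscale by simp
    qed
    finally show ?thesis using g(2) unfolding mat_op_P by simp
  qed
  ultimately have v0: "v k l = 0" if "(k, l) \<in> ?I" for k l
    using strings_independent[of ?I v k l] that by blast
  have "g (e (p, i)) = 0" if p: "p \<in> set bl" and i: "i < t (fst p)" for p i
  proof -
    have s: "Suc (fst p - 1) = fst p" using d1[of "fst p" "snd p"] p by simp
    have "(fst p - 1, snd p) \<in> ?I" using p by (auto simp: image_iff split_def)
    then have "(\<Sum>i<t (fst p). rscale (b (fst p) i) (g (e (p, i)))) = 0"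
      using v0[of "fst p - 1" "snd p"] unfolding v_def s by simp
    then show ?thesis using i by (rule b_indep)
  qed
  then have "g c = 0" for c
    using g(1) by (cases "c < m") (auto elim!: e_surj simp: supported_def)
  then show ?thesis by (simp add: fun_eq_iff)
qed

text \<open>The column count \<open>m\<close> is the sum of \<open>t d * d\<close> over the parts,
  so this says that the parts with their multiplicities form a partition of
  \<open>n\<close>.\<close>

lemma m_eq_n: "m = n"
  using invertible_matI[OF P_carrier P_surj P_inj] two_sided_inverse_square[OF P_carrier] by metis

lemma P_inverse:
  obtains Q where "Q \<in> carrier_mat n n" "P * Q = 1\<^sub>m n" "Q * P = 1\<^sub>m n"
  using invertible_matI[OF P_carrier P_surj P_inj] unfolding m_eq_n by blast

definition Q :: "quat mat" where
  "Q = (SOME Q. Q \<in> carrier_mat n n \<and> P * Q = 1\<^sub>m n \<and> Q * P = 1\<^sub>m n)"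

lemma Q: "Q \<in> carrier_mat n n" "P * Q = 1\<^sub>m n" "Q * P = 1\<^sub>m n"
  unfolding atomize_conj Q_def by (rule someI_ex) (use P_inverse in blast)

lemma P_carrier': "P \<in> carrier_mat n n"
  using P_carrier by (simp add: m_eq_n)

section \<open>Block diagonal matrices with repeated blocks\<close>

definition block_family :: "(nat \<Rightarrow> quat mat) \<Rightarrow> bool" where
  "block_family A \<longleftrightarrow> (\<forall>d\<in>N. A d \<in> carrier_mat (t d) (t d))"

definition D :: "(nat \<Rightarrow> quat mat) \<Rightarrow> quat mat" where
  "D A = diag_block_mat (map (\<lambda>p. A (fst p)) bl)"

lemma block_familyD: "block_family A \<Longrightarrow> p \<in> set bl \<Longrightarrow> A (fst p) \<in> carrier_mat (t (fst p)) (t (fst p))"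
  by (auto simp: block_family_def set_bl)

lemma D_carrier: "block_family A \<Longrightarrow> D A \<in> carrier_mat n n"
  unfolding D_def m_eq_n[symmetric] m_def by (intro diag_block_mat_carrier block_familyD)

lemma D_entry:
  assumes "block_family A" "p \<in> set bl" "q \<in> set bl" "i < t (fst p)" "j < t (fst q)"
  shows "D A $$ (e (p, i), e (q, j)) = (if p = q then A (fst p) $$ (i, j) else 0)"
  unfolding D_def using assms block_familyD by (intro e_entry) auto

lemma D_mult:
  assumes "block_family A" "block_family B"
  shows "D A * D B = D (\<lambda>d. A d * B d)"
  unfolding D_def using assms block_familyD by (intro diag_block_mat_mult[of bl _ "\<lambda>p. t (fst p)"])

lemma D_one: "D (\<lambda>d. 1\<^sub>m (t d)) = 1\<^sub>m n"
proof -
  have "D (\<lambda>d. 1\<^sub>m (t d)) = diag_block_mat (map (\<lambda>A. 1\<^sub>m (dim_row A)) (map (\<lambda>p. (1\<^sub>m (t (fst p)) :: quat mat)) bl))"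
    by (simp add: D_def o_def)
  also have "\<dots> = 1\<^sub>m m"
    unfolding diag_block_one_mat by (simp add: m_def o_def)
  finally show ?thesis by (simp add: m_eq_n)
qed

lemma mat_op_PD_unit:
  assumes A: "block_family A" and q: "q \<in> set bl" "j < t (fst q)"
  shows "mat_op (P * D A) (unit_fun (e (q, j))) = (\<Sum>i<t (fst q). rscale (col_fun q i) (A (fst q) $$ (i, j)))"
proof -
  have "mat_op (P * D A) (unit_fun (e (q, j))) = mat_op P (mat_op (D A) (unit_fun (e (q, j))))"
    by (rule mat_op_mult[OF P_carrier' D_carrier[OF A]])
  also have "\<dots> = (\<Sum>p\<in>set bl. if p = q then \<Sum>i<t (fst p). rscale (col_fun p i) (A (fst p) $$ (i, j)) else 0)"
    unfolding mat_op_P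
  proof (rule sum.cong[OF refl])
    fix p assume p: "p \<in> set bl"
    have "mat_op (D A) (unit_fun (e (q, j))) (e (p, i)) = (if p = q then A (fst p) $$ (i, j) else 0)"
      if i: "i < t (fst p)" for i
      using D_entry[OF A p q(1) i q(2)] mat_op_unit[of "e (p, i)" "D A" "e (q, j)"]
        D_carrier[OF A] e_less[OF p i] e_less[OF q] by (simp add: m_eq_n)
    then show "(\<Sum>i<t (fst p). rscale (col_fun p i) (mat_op (D A) (unit_fun (e (q, j))) (e (p, i))))
        = (if p = q then \<Sum>i<t (fst p). rscale (col_fun p i) (A (fst p) $$ (i, j)) else 0)"
      by (auto intro!: sum.neutral sum.cong)
  qed
  also have "\<dots> = (\<Sum>i<t (fst q). rscale (col_fun q i) (A (fst q) $$ (i, j)))"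
    using q(1) by simp
  finally show ?thesis .
qed

lemma mat_mult_P_eqI:
  assumes "A \<in> carrier_mat n n" "B \<in> carrier_mat n n"
    and "\<And>q j. q \<in> set bl \<Longrightarrow> j < t (fst q) \<Longrightarrow>
      mat_op A (col_fun q j) = mat_op B (unit_fun (e (q, j)))"
  shows "A * P = B"
proof (rule mat_op_unit_eqI)
  fix c assume "c < n"
  then obtain q j where q: "q \<in> set bl" "j < t (fst q)" "c = e (q, j)"
    using e_surj[of c] m_eq_n by auto
  show "mat_op (A * P) (unit_fun c) = mat_op B (unit_fun c)"
    unfolding mat_op_mult[OF assms(1) P_carrier'] q(3) mat_op_P_unit[OF q(1,2)] by (rule assms(3)[OF q(1,2)])
qed (use assms P_carrier' in auto)

lemma cancel_P:
  assumes "A \<in> carrier_mat n n" "B \<in> carrier_mat n n" "A * P = B * P"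
  shows "A = B"
proof -
  have "A * P * Q = A" "B * P * Q = B"
    using assms(1,2) assoc_mult_mat[OF _ P_carrier' Q(1)] Q(2) by auto
  then show ?thesis using assms(3) by metis
qed

section \<open>Commuting with the triple and block form\<close>

definition commuting :: "quat mat \<Rightarrow> bool" where
  "commuting g \<longleftrightarrow> g \<in> carrier_mat n n \<and> g * X = X * g \<and> g * H = H * g \<and> g * Y = Y * g"

lemma commuting_op:
  assumes "commuting g"
  shows "mat_op g (mat_op X f) = mat_op X (mat_op g f)" "mat_op g (mat_op H f) = mat_op H (mat_op g f)"
    "mat_op g (mat_op Y f) = mat_op Y (mat_op g f)"
proof -
  have g: "g \<in> carrier_mat n n" using assms by (simp add: commuting_def)
  have "mat_op g (mat_op Z f) = mat_op Z (mat_op g f)" if "Z \<in> carrier_mat n n" "g * Z = Z * g" for Z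
    using mat_op_mult[OF g that(1), of f] mat_op_mult[OF that(1) g, of f] that(2) by simp
  then show "mat_op g (mat_op X f) = mat_op X (mat_op g f)" "mat_op g (mat_op H f) = mat_op H (mat_op g f)"
    "mat_op g (mat_op Y f) = mat_op Y (mat_op g f)"
    using carrier assms by (auto simp: commuting_def)
qed

lemma commuting_lowest:
  assumes "commuting g" "v \<in> lowest k"
  shows "mat_op g v \<in> lowest k"
proof -
  have "mat_op Y (mat_op g v) = 0" "mat_op H (mat_op g v) = - real k *\<^sub>R mat_op g v"
    using assms(2) linear_0[OF linear_mat_op] linear_scale[OF linear_mat_op, of g "- real k" v]
    unfolding commuting_op[OF assms(1), symmetric] lowest_def by auto
  then show ?thesis unfolding lowest_def by blast
qed

text \<open>\<open>A d\<close> is the matrix of \<open>g\<close> on \<open>lowest (d - 1)\<close> in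
  the basis \<open>b d\<close>. As \<open>g\<close> commutes with \<open>X^l\<close>, the same
  matrix describes \<open>g\<close> on the image under \<open>X^l\<close>, whence the repeated
  blocks.\<close>

lemma commuting_block:
  assumes g: "commuting g"
  shows "\<exists>A. block_family A \<and> g * P = P * D A"
proof -
  have gc: "g \<in> carrier_mat n n" using g by (simp add: commuting_def)
  have "\<exists>w. mat_op g (b d j) = (\<Sum>i<t d. rscale (b d i) (w i))" if "j < t d" for d j
    using b_span[of "mat_op g (b d j)" d] b_lowest[OF that] commuting_lowest[OF g] mat_op_supported[OF gc]
    by blast
  then have "\<forall>d j. \<exists>w. j < t d \<longrightarrow> mat_op g (b d j) = (\<Sum>i<t d. rscale (b d i) (w i))" by blast
  then obtain w where w: "\<And>d j. j < t d \<Longrightarrow> mat_op g (b d j) = (\<Sum>i<t d. rscale (b d i) (w d j i))"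
    by metis
  define A where "A d = mat (t d) (t d) (\<lambda>(i, j). w d j i)" for d
  have A: "block_family A" by (simp add: block_family_def A_def)
  have pow: "mat_op g ((mat_op X ^^ l) f) = (mat_op X ^^ l) (mat_op g f)" for l f
    by (induction l) (simp_all add: commuting_op[OF g])
  have "g * P = P * D A"
  proof (rule mat_mult_P_eqI)
    fix q j assume q: "q \<in> set bl" "j < t (fst q)"
    have "mat_op g (col_fun q j) = (mat_op X ^^ snd q) (\<Sum>i<t (fst q). rscale (b (fst q) i) (w (fst q) j i))"
      unfolding col_fun_def pow w[OF q(2)] ..
    also have "\<dots> = (\<Sum>i<t (fst q). rscale (col_fun q i) (w (fst q) j i))"
      unfolding linear_sum[OF linear_pow] pow_rscale col_fun_def ..
    also have "\<dots> = (\<Sum>i<t (fst q). rscale (col_fun q i) (A (fst q) $$ (i, j)))"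
      using q(2) by (intro sum.cong refl) (simp add: A_def)
    finally show "mat_op g (col_fun q j) = mat_op (P * D A) (unit_fun (e (q, j)))"
      unfolding mat_op_PD_unit[OF A q] .
  qed (use gc P_carrier' D_carrier[OF A] in auto)
  then show ?thesis using A by blast
qed

text \<open>Each of \<open>X\<close>, \<open>H\<close>, \<open>Y\<close> sends the columns of a
  block \<open>(d, l)\<close> to those of some \<open>(d, l')\<close>, times a real factor that is
  the same for all \<open>i\<close>. Real factors are central and \<open>g\<close> acts through the
  same \<open>A d\<close> for \<open>l\<close> and \<open>l'\<close>, so the actions
  commute.\<close>

lemma block_commuting:
  assumes A: "block_family A" and g: "g \<in> carrier_mat n n" "g * P = P * D A"
  shows "commuting g"
proof -
  \<comment> \<open>The range of \<open>l\<close> includes \<open>l = d\<close>, which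
    \<open>X\<close> reaches from the last block; for \<open>l \<ge> d\<close> both sides are
    zero.\<close>
  have on_col: "mat_op g (col_fun (d, l) j) = (\<Sum>i<t d. rscale (col_fun (d, l) i) (A d $$ (i, j)))"
    if d: "d \<in> N" and j: "j < t d" for d l j
  proof (cases "l < d")
    case True
    then have q: "(d, l) \<in> set bl" using d by (intro block_in_bl)
    have "mat_op g (col_fun (d, l) j) = mat_op g (mat_op P (unit_fun (e ((d, l), j))))"
      using mat_op_P_unit[OF q] j by simp
    also have "\<dots> = mat_op (P * D A) (unit_fun (e ((d, l), j)))"
      unfolding mat_op_mult[OF g(1) P_carrier', symmetric] g(2) ..
    finally show ?thesis using mat_op_PD_unit[OF A q] j by simp
  next
    case False
    have "col_fun (d, l) i = 0" if "i < t d" for i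
      unfolding col_fun_def fst_conv snd_conv
      by (rule pow_lowest_eq_0) (use b_lowest[OF that] d False in \<open>auto simp: N_def\<close>)
    then show ?thesis using j linear_0[OF linear_mat_op] by (auto intro!: sum.neutral[symmetric])
  qed
  have gen: "g * Z = Z * g"
    if Z: "Z \<in> carrier_mat n n"
      and act: "\<And>d l. d \<in> N \<Longrightarrow> \<exists>c l'. \<forall>i<t d. mat_op Z (col_fun (d, l) i) = c *\<^sub>R col_fun (d, l') i"
    for Z
  proof (rule cancel_P)
    have "(g * Z) * P = (Z * g) * P"
    proof (rule mat_mult_P_eqI)
      fix q j assume q: "q \<in> set bl" "j < t (fst q)"
      obtain d l where ql: "q = (d, l)" by fastforce
      have d: "d \<in> N" and j: "j < t d" using q ql by (auto simp: set_bl)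
      obtain c l' where c: "\<And>i. i < t d \<Longrightarrow> mat_op Z (col_fun (d, l) i) = c *\<^sub>R col_fun (d, l') i"
        using act[OF d] by blast
      have "mat_op (g * Z) (col_fun q j) = c *\<^sub>R mat_op g (col_fun (d, l') j)"
        unfolding mat_op_mult[OF g(1) Z] ql c[OF j] linear_scale[OF linear_mat_op] ..
      also have "\<dots> = (\<Sum>i<t d. rscale (c *\<^sub>R col_fun (d, l') i) (A d $$ (i, j)))"
        unfolding on_col[OF d j] scaleR_sum_right rscale_simps ..
      also have "\<dots> = (\<Sum>i<t d. mat_op Z (rscale (col_fun (d, l) i) (A d $$ (i, j))))"
        by (rule sum.cong[OF refl]) (simp only: c mat_op_rscale lessThan_iff)
      also have "\<dots> = mat_op (Z * g) (col_fun q j)"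
        unfolding mat_op_sum[symmetric] mat_op_mult[OF Z g(1)] ql on_col[OF d j] ..
      also have "\<dots> = mat_op ((Z * g) * P) (unit_fun (e (q, j)))"
        unfolding mat_op_P_unit[OF q, symmetric] by (rule mat_op_mult[symmetric, OF _ P_carrier']) (use Z g in auto)
      finally show "mat_op (g * Z) (col_fun q j) = mat_op (Z * g * P) (unit_fun (e (q, j)))" .
    qed (intro mult_carrier_mat[of _ n n] Z g(1) P_carrier')+
    then show "g * Z * P = Z * g * P" .
  qed (use Z g in auto)
  have "g * X = X * g"
  proof (rule gen[OF carrier(1)])
    fix d l
    have "\<forall>i<t d. mat_op X (col_fun (d, l) i) = 1 *\<^sub>R col_fun (d, Suc l) i"
      by (simp add: col_fun_def)
    then show "\<exists>c l'. \<forall>i<t d. mat_op X (col_fun (d, l) i) = c *\<^sub>R col_fun (d, l') i" by blast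
  qed
  moreover have "g * H = H * g"
  proof (rule gen[OF carrier(2)])
    fix d l
    have "\<forall>i<t d. mat_op H (col_fun (d, l) i) = (2 * real l - real (d - 1)) *\<^sub>R col_fun (d, l) i"
      using b_lowest h_pow_lowest unfolding col_fun_def by auto
    then show "\<exists>c l'. \<forall>i<t d. mat_op H (col_fun (d, l) i) = c *\<^sub>R col_fun (d, l') i" by blast
  qed
  moreover have "g * Y = Y * g"
  proof (rule gen[OF carrier(3)])
    fix d l
    show "\<exists>c l'. \<forall>i<t d. mat_op Y (col_fun (d, l) i) = c *\<^sub>R col_fun (d, l') i"
    proof (cases l)
      case 0
      then have "\<forall>i<t d. mat_op Y (col_fun (d, l) i) = 0 *\<^sub>R col_fun (d, l) i"
        using b_lowest by (auto simp: col_fun_def lowest_def)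
      then show ?thesis by blast
    next
      case (Suc j)
      then have "\<forall>i<t d. mat_op Y (col_fun (d, l) i)
          = ((real j + 1) * (real (d - 1) - real j)) *\<^sub>R col_fun (d, j) i"
        using b_lowest y_pow_lowest unfolding col_fun_def fst_conv snd_conv by blast
      then show ?thesis by blast
    qed
  qed
  ultimately show ?thesis using g(1) by (simp add: commuting_def)
qed

end

section \<open>The isomorphism\<close>

lemma topspace_mat_topology [simp]: "topspace (mat_topology k) = carrier_mat k k"
  by (auto simp: mat_topology_def topspace_pullback_topology)

lemma continuous_map_into_mat_topology:
  assumes "\<And>x. x \<in> topspace X \<Longrightarrow> f x \<in> carrier_mat k k"
    and "\<And>i j. i < k \<Longrightarrow> j < k \<Longrightarrow> continuous_map X euclidean (\<lambda>x. f x $$ (i, j))"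
  shows "continuous_map X (mat_topology k) f"
  unfolding mat_topology_def
proof (rule continuous_map_pullback')
  show "continuous_map X (product_topology (\<lambda>_. euclidean) ({..<k} \<times> {..<k}))
      ((\<lambda>A. \<lambda>ij\<in>{..<k} \<times> {..<k}. A $$ ij) \<circ> f)"
    unfolding continuous_map_componentwise o_def using assms(2) by auto
qed (use assms(1) in auto)

lemma continuous_map_mat_entry:
  assumes "i < k" "j < k"
  shows "continuous_map (mat_topology k) euclidean (\<lambda>A. A $$ (i, j))"
proof -
  have "continuous_map (mat_topology k) euclidean
      ((\<lambda>h. h (i, j)) \<circ> (\<lambda>A. \<lambda>ij\<in>{..<k} \<times> {..<k}. A $$ ij))"
    unfolding mat_topology_def
    using assms by (intro continuous_map_pullback continuous_map_product_projection) auto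
  then show ?thesis using assms by (simp add: o_def)
qed

lemma continuous_map_mult_const:
  fixes f :: "'a \<Rightarrow> 'b::real_normed_algebra"
  assumes "continuous_map X euclidean f"
  shows "continuous_map X euclidean (\<lambda>x. c * f x * d)"
proof -
  have "continuous_map euclidean euclidean (\<lambda>y::'b. c * y * d)"
    by (simp add: continuous_map_iff_continuous2 continuous_intros)
  from continuous_map_compose[OF assms this] show ?thesis by (simp add: o_def)
qed

text \<open>An entry of the product is a finite sum of entries of \<open>F x\<close> with constants
  on both sides, which cannot be collected on one side because quaternions do not commute.\<close>

lemma continuous_map_sandwich_entry:
  assumes F: "\<And>x. x \<in> topspace X \<Longrightarrow> F x \<in> carrier_mat k k"
    and cont: "\<And>i j. i < k \<Longrightarrow> j < k \<Longrightarrow> continuous_map X euclidean (\<lambda>x. F x $$ (i, j))"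
    and C: "C \<in> carrier_mat k k" and E: "E \<in> carrier_mat k k" and ij: "i < k" "j < k"
  shows "continuous_map X euclidean (\<lambda>x. (C * F x * E) $$ (i, j) :: quat)"
proof (rule continuous_map_eq)
  show "continuous_map X euclidean (\<lambda>x. \<Sum>l<k. \<Sum>r<k. C $$ (i, r) * F x $$ (r, l) * E $$ (l, j))"
    by (intro continuous_map_sum continuous_map_mult_const cont) auto
  fix x assume "x \<in> topspace X"
  from F[OF this] show "(\<Sum>l<k. \<Sum>r<k. C $$ (i, r) * F x $$ (r, l) * E $$ (l, j)) = (C * F x * E) $$ (i, j)"
    using C E ij
    by (simp add: scalar_prod_def atLeast0LessThan sum_distrib_right del: assoc_mult_mat)
qed

text \<open>\<open>ed d\<close> numbers the rows of the single factor
  \<open>GL_diagonal (t d) d\<close>, whereas \<open>e\<close> numbers those of the whole block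
  matrix.\<close>

locale triple_basis_top = triple_basis +
  fixes ed :: "nat \<Rightarrow> nat \<times> nat \<Rightarrow> nat"
  assumes ed_bij: "\<And>d. bij_betw (ed d) (SIGMA l:set [0..<d]. {..<t d}) {..<sum_list (map (\<lambda>_. t d) [0..<d])}"
    and ed_entry: "\<And>d (F :: _ \<Rightarrow> quat mat) k l i j.
      (\<And>l. l \<in> set [0..<d] \<Longrightarrow> F l \<in> carrier_mat (t d) (t d)) \<Longrightarrow>
      k \<in> set [0..<d] \<Longrightarrow> l \<in> set [0..<d] \<Longrightarrow> i < t d \<Longrightarrow> j < t d \<Longrightarrow>
      diag_block_mat (map F [0..<d]) $$ (ed d (k, i), ed d (l, j)) = (if k = l then F k $$ (i, j) else 0)"
begin

section \<open>Repeated blocks in one factor and the norm condition\<close>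

definition rep :: "nat \<Rightarrow> quat mat \<Rightarrow> quat mat" where
  "rep d A = diag_block_mat (replicate d A)"

definition unrep :: "nat \<Rightarrow> quat mat \<Rightarrow> quat mat" where
  "unrep d M = mat (t d) (t d) (\<lambda>(i, j). M $$ (ed d (0, i), ed d (0, j)))"

lemma rep_map: "rep d A = diag_block_mat (map (\<lambda>_. A) [0..<d])"
  by (simp add: rep_def map_replicate_const)

lemma sum_list_const: "sum_list (map (\<lambda>_. t d) [0..<d]) = t d * d"
  by (simp add: sum_list_triv mult.commute)

lemma rep_carrier: "A \<in> carrier_mat (t d) (t d) \<Longrightarrow> rep d A \<in> carrier_mat (t d * d) (t d * d)"
  unfolding rep_map sum_list_const[symmetric] by (rule diag_block_mat_carrier)

lemma rep_entry:
  assumes "A \<in> carrier_mat (t d) (t d)" "k < d" "l < d" "i < t d" "j < t d"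
  shows "rep d A $$ (ed d (k, i), ed d (l, j)) = (if k = l then A $$ (i, j) else 0)"
  unfolding rep_map using assms by (intro ed_entry) auto

lemma ed_less: "l < d \<Longrightarrow> i < t d \<Longrightarrow> ed d (l, i) < t d * d"
  using bij_betwE[OF ed_bij[of d]] unfolding sum_list_const by auto

lemma ed_surj:
  assumes "r < t d * d"
  obtains l i where "l < d" "i < t d" "r = ed d (l, i)"
proof -
  have "r \<in> ed d ` (SIGMA l:set [0..<d]. {..<t d})"
    using bij_betw_imp_surj_on[OF ed_bij[of d]] assms unfolding sum_list_const by simp
  then show thesis using that by auto
qed

lemma rep_mult:
  assumes "A \<in> carrier_mat (t d) (t d)" "B \<in> carrier_mat (t d) (t d)"
  shows "rep d A * rep d B = rep d (A * B)"
  unfolding rep_map using assms by (intro diag_block_mat_mult[of _ _ "\<lambda>_. t d"])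

lemma unrep_rep:
  assumes "A \<in> carrier_mat (t d) (t d)" "d \<in> N"
  shows "unrep d (rep d A) = A"
proof -
  have "0 < d" using assms(2) by (simp add: N_def)
  then show ?thesis
    unfolding unrep_def using assms(1) by (intro eq_matI) (auto simp: rep_entry)
qed

lemma Nrd_rep: "A \<in> carrier_mat (t d) (t d) \<Longrightarrow> Nrd (rep d A) = Nrd A ^ d"
  unfolding rep_map by (subst Nrd_diag_block_mat[of _ _ "\<lambda>_. t d"]) (simp_all add: map_replicate_const)

lemma finite_N: "finite N"
proof (rule finite_subset)
  show "N \<subseteq> fst ` set bl"
    by (rule subsetI, rule image_eqI[where x = "(_, 0)"]) (auto simp: set_bl N_def)
qed simp

text \<open>By \<open>Nrd_rep\<close> the same product arises from the tuple of the
  \<open>rep d (A d)\<close>, so \<open>Nrd g = 1\<close> on one side is the defining condition of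
  \<open>S_product\<close> on the other.\<close>

lemma Nrd_D:
  assumes "block_family A"
  shows "Nrd (D A) = (\<Prod>d\<in>N. Nrd (A d) ^ d)"
proof -
  have "Nrd (D A) = prod_list (map (\<lambda>p. Nrd (A (fst p))) bl)"
    unfolding D_def using block_familyD[OF assms] by (rule Nrd_diag_block_mat)
  also have "\<dots> = (\<Prod>p\<in>set bl. Nrd (A (fst p)))"
    using distinct_bl by (simp add: prod.distinct_set_conv_list)
  also have "\<dots> = (\<Prod>d\<in>N. \<Prod>l<d. Nrd (A d))"
    unfolding set_bl using finite_N by (subst prod.Sigma) (auto simp: split_def)
  finally show ?thesis by simp
qed

lemma Nrd_conj:
  assumes "g \<in> carrier_mat n n" "block_family A" "g * P = P * D A"
  shows "Nrd g = Nrd (D A)"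
proof -
  have "Nrd P * Nrd Q = 1"
    using Nrd_mult[OF P_carrier' Q(1)] Nrd_one[of n] Q(2) by simp
  moreover have "Nrd g * Nrd P = Nrd P * Nrd (D A)"
    using arg_cong[OF assms(3), of Nrd]
    unfolding Nrd_mult[OF assms(1) P_carrier'] Nrd_mult[OF P_carrier' D_carrier[OF assms(2)]] .
  ultimately show ?thesis by (auto simp: mult.commute[of _ "Nrd P"])
qed

text \<open>A formula in \<open>Q * g * P\<close> and not a choice based on
  \<open>commuting_block\<close>, so that the entries depend continuously on \<open>g\<close>. The
  block \<open>(d, 0)\<close> represents the \<open>d\<close> equal ones.\<close>

definition blk :: "quat mat \<Rightarrow> nat \<Rightarrow> quat mat" where
  "blk g d = mat (t d) (t d) (\<lambda>(i, j). (Q * g * P) $$ (e ((d, 0), i), e ((d, 0), j)))"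

lemma blk_carrier: "blk g d \<in> carrier_mat (t d) (t d)"
  by (simp add: blk_def)

lemma blk_family: "block_family (blk g)"
  by (simp add: block_family_def blk_carrier)

lemma blk_eq:
  assumes g: "g \<in> carrier_mat n n" and A: "block_family A" and eq: "g * P = P * D A" and d: "d \<in> N"
  shows "blk g d = A d"
proof -
  have "(d, 0) \<in> set bl" using d by (intro block_in_bl) (auto simp: N_def)
  moreover have "Q * g * P = D A"
  proof -
    have "Q * g * P = Q * (g * P)" by (rule assoc_mult_mat[OF Q(1) g P_carrier'])
    also have "\<dots> = Q * P * D A"
      unfolding eq by (rule assoc_mult_mat[OF Q(1) P_carrier' D_carrier[OF A], symmetric])
    finally show ?thesis using D_carrier[OF A] Q(3) by simp
  qed
  moreover have "A d \<in> carrier_mat (t d) (t d)" using A d by (simp add: block_family_def)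
  ultimately show ?thesis
    unfolding blk_def by (intro eq_matI) (auto simp: D_entry[OF A])
qed

lemma D_cong: "(\<And>d. d \<in> N \<Longrightarrow> A d = B d) \<Longrightarrow> D A = D B"
  unfolding D_def by (intro arg_cong[of _ _ diag_block_mat] map_cong refl) (auto simp: set_bl)

lemma commuting_blk:
  assumes "commuting g"
  shows "g * P = P * D (blk g)"
proof -
  obtain A where A: "block_family A" "g * P = P * D A" using commuting_block[OF assms] by blast
  have "D (blk g) = D A"
    using blk_eq[OF _ A] assms by (intro D_cong) (simp add: commuting_def)
  then show ?thesis using A(2) by simp
qed

lemma PD_mult:
  assumes g: "g \<in> carrier_mat n n" "g * P = P * D A" and g': "g' \<in> carrier_mat n n" "g' * P = P * D B"
    and AB: "block_family A" "block_family B"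
  shows "(g * g') * P = P * D (\<lambda>d. A d * B d)"
proof -
  note c = D_carrier[OF AB(1)] D_carrier[OF AB(2)]
  have "(g * g') * P = g * (P * D B)"
    using assoc_mult_mat[OF g(1) g'(1) P_carrier'] g'(2) by simp
  also have "\<dots> = (g * P) * D B" using assoc_mult_mat[OF g(1) P_carrier' c(2)] by simp
  also have "\<dots> = P * (D A * D B)" unfolding g(2) using assoc_mult_mat[OF P_carrier' c] by simp
  finally show ?thesis unfolding D_mult[OF AB] .
qed

lemma block_family_mult: "block_family A \<Longrightarrow> block_family B \<Longrightarrow> block_family (\<lambda>d. A d * B d)"
  by (auto simp: block_family_def)

lemma blk_mult:
  assumes "commuting g" "commuting g'" "d \<in> N"
  shows "blk (g * g') d = blk g d * blk g' d"
proof -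
  have c: "g \<in> carrier_mat n n" "g' \<in> carrier_mat n n" using assms by (auto simp: commuting_def)
  show ?thesis
    using blk_eq[OF _ block_family_mult[OF blk_family blk_family]
        PD_mult[OF c(1) commuting_blk[OF assms(1)] c(2) commuting_blk[OF assms(2)] blk_family blk_family] assms(3)]
      c by simp
qed

lemma blk_one: "d \<in> N \<Longrightarrow> blk (1\<^sub>m n) d = 1\<^sub>m (t d)"
  using P_carrier' D_one by (intro blk_eq) (auto simp: block_family_def)

lemma commuting_inverse:
  assumes g: "commuting g" and g': "g' \<in> carrier_mat n n" "g' * g = 1\<^sub>m n" "g * g' = 1\<^sub>m n"
  shows "commuting g'"
proof -
  have gc: "g \<in> carrier_mat n n" using g by (simp add: commuting_def)
  have "g' * Z = Z * g'" if Z: "Z \<in> carrier_mat n n" "g * Z = Z * g" for Z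
  proof -
    have "g' * Z = g' * (Z * g) * g'"
    proof -
      have "g' * (Z * g) * g' = g' * (Z * g * g')"
        by (rule assoc_mult_mat) (use Z gc g' in auto)
      also have "Z * g * g' = Z * (g * g')" by (rule assoc_mult_mat) (use Z gc g' in auto)
      finally show ?thesis using Z(1) g'(3) by simp
    qed
    also have "g' * (Z * g) = g' * g * Z"
      unfolding Z(2)[symmetric] by (rule assoc_mult_mat[symmetric]) (use Z gc g' in auto)
    finally show ?thesis using Z(1) g'(2) by simp
  qed
  then show ?thesis using g g'(1) carrier by (auto simp: commuting_def)
qed

lemma blk_GL:
  assumes g: "commuting g" "g \<in> carrier (GL n)" and d: "d \<in> N"
  shows "blk g d \<in> carrier (GL (t d))"
proof -
  obtain g' where g': "g' \<in> carrier_mat n n" "g' * g = 1\<^sub>m n" "g * g' = 1\<^sub>m n"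
    using g(2) by (auto simp: carrier_GL)
  have "commuting g'" using g(1) g' by (rule commuting_inverse)
  then have "blk g' d * blk g d = 1\<^sub>m (t d)" "blk g d * blk g' d = 1\<^sub>m (t d)"
    using blk_mult[OF _ _ d] g(1) g' blk_one[OF d] by metis+
  moreover have "blk g d \<in> carrier_mat (t d) (t d)" "blk g' d \<in> carrier_mat (t d) (t d)"
    by (auto simp: blk_def)
  ultimately show ?thesis unfolding carrier_GL by blast
qed

abbreviation C :: "quat mat monoid" where "C \<equiv> triple_centralizer n (SL n) X H Y"

abbreviation S :: "(nat \<Rightarrow> quat mat) monoid" where "S \<equiv> S_product N (\<lambda>d. GL_diagonal (t d) d)"

lemma carrier_C: "carrier C = {g \<in> carrier (GL n). Nrd g = 1 \<and> commuting g}"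
proof -
  have "Ad n g X = X \<and> Ad n g H = H \<and> Ad n g Y = Y \<longleftrightarrow> commuting g" if "g \<in> carrier (GL n)" for g
    using Ad_eq_iff[OF that] carrier that by (auto simp: commuting_def carrier_GL)
  then show ?thesis by (auto simp: triple_centralizer_def SL_def)
qed

lemma carrier_S: "carrier S = {h \<in> \<Pi>\<^sub>E d\<in>N. rep d ` carrier (GL (t d)). (\<Prod>d\<in>N. Nrd (h d)) = 1}"
  by (simp add: S_product_def GL_diagonal_def rep_def[abs_def])

section \<open>The isomorphism and its inverse\<close>

definition \<Phi> :: "quat mat \<Rightarrow> nat \<Rightarrow> quat mat" where
  "\<Phi> g = (\<lambda>d\<in>N. rep d (blk g d))"

definition \<Psi> :: "(nat \<Rightarrow> quat mat) \<Rightarrow> quat mat" where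
  "\<Psi> h = P * D (\<lambda>d. unrep d (h d)) * Q"

lemma \<Phi>_in: "g \<in> carrier C \<Longrightarrow> \<Phi> g \<in> carrier S"
proof -
  assume "g \<in> carrier C"
  then have g: "g \<in> carrier (GL n)" "Nrd g = 1" "commuting g" by (auto simp: carrier_C)
  have gc: "g \<in> carrier_mat n n" using g(3) by (simp add: commuting_def)
  have "(\<Prod>d\<in>N. Nrd (\<Phi> g d)) = (\<Prod>d\<in>N. Nrd (blk g d) ^ d)"
    by (intro prod.cong refl) (simp add: \<Phi>_def Nrd_rep blk_def)
  also have "\<dots> = 1"
    using Nrd_conj[OF gc blk_family commuting_blk[OF g(3)]] g(2) Nrd_D[OF blk_family] by simp
  finally show "\<Phi> g \<in> carrier S"
    unfolding carrier_S using blk_GL[OF g(3,1)] by (simp add: \<Phi>_def)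
qed

lemma S_blocks:
  assumes "h \<in> carrier S"
  obtains A where "\<And>d. d \<in> N \<Longrightarrow> A d \<in> carrier (GL (t d))" "\<And>d. d \<in> N \<Longrightarrow> h d = rep d (A d)"
    "(\<Prod>d\<in>N. Nrd (h d)) = 1"
proof -
  have "\<forall>d\<in>N. \<exists>A. A \<in> carrier (GL (t d)) \<and> h d = rep d A"
    using assms unfolding carrier_S by (auto simp: PiE_iff image_iff)
  then obtain A where "\<forall>d\<in>N. A d \<in> carrier (GL (t d)) \<and> h d = rep d (A d)" by metis
  then show thesis using that assms unfolding carrier_S by blast
qed

lemma PDQ:
  assumes "block_family A"
  shows "P * D A * Q \<in> carrier_mat n n" "P * D A * Q * P = P * D A"
proof -
  note c = P_carrier' Q(1) D_carrier[OF assms]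
  show "P * D A * Q \<in> carrier_mat n n" using c by (intro mult_carrier_mat[of _ n n]) auto
  have "P * D A * Q * P = P * D A * (Q * P)"
    by (rule assoc_mult_mat) (use c in auto)
  also have "\<dots> = P * D A"
    unfolding Q(3) by (rule right_mult_one_mat[OF mult_carrier_mat[OF c(1,3)]])
  finally show "P * D A * Q * P = P * D A" .
qed

lemma \<Psi>_in:
  assumes "h \<in> carrier S"
  shows "\<Psi> h \<in> carrier C" "\<Phi> (\<Psi> h) = h"
proof -
  obtain A where A: "\<And>d. d \<in> N \<Longrightarrow> A d \<in> carrier (GL (t d))" "\<And>d. d \<in> N \<Longrightarrow> h d = rep d (A d)"
    and Nrd: "(\<Prod>d\<in>N. Nrd (h d)) = 1"
    using S_blocks[OF assms] by metis
  have Ac: "\<And>d. d \<in> N \<Longrightarrow> A d \<in> carrier_mat (t d) (t d)" using A(1) by (auto simp: carrier_GL)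
  then have Af: "block_family A" by (simp add: block_family_def)
  have "D (\<lambda>d. unrep d (h d)) = D A"
    using A(2) Ac unrep_rep by (intro D_cong) auto
  then have \<Psi>: "\<Psi> h = P * D A * Q" by (simp add: \<Psi>_def)
  note g = PDQ[OF Af, folded \<Psi>]
  \<comment> \<open>The blockwise inverses \<open>B d\<close> yield \<open>P * D B * Q\<close> as
    the inverse of \<open>\<Psi> h\<close>.\<close>
  have "\<forall>d\<in>N. \<exists>B. B \<in> carrier_mat (t d) (t d) \<and> B * A d = 1\<^sub>m (t d) \<and> A d * B = 1\<^sub>m (t d)"
    using A(1) by (auto simp: carrier_GL)
  then obtain B where B: "\<And>d. d \<in> N \<Longrightarrow> B d \<in> carrier_mat (t d) (t d)"
    "\<And>d. d \<in> N \<Longrightarrow> B d * A d = 1\<^sub>m (t d)" "\<And>d. d \<in> N \<Longrightarrow> A d * B d = 1\<^sub>m (t d)" by metis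
  have Bf: "block_family B" using B(1) by (simp add: block_family_def)
  note g' = PDQ[OF Bf]
  let ?g' = "P * D B * Q"
  have 1: "D (\<lambda>d. A d * B d) = 1\<^sub>m n" "D (\<lambda>d. B d * A d) = 1\<^sub>m n"
    unfolding D_one[symmetric] using B by (auto intro!: D_cong)
  note P1 = left_mult_one_mat[OF P_carrier'] right_mult_one_mat[OF P_carrier']
  have "\<Psi> h * ?g' * P = 1\<^sub>m n * P" "?g' * \<Psi> h * P = 1\<^sub>m n * P"
    unfolding PD_mult[OF g g' Af Bf] PD_mult[OF g' g Bf Af] 1 P1 by (rule refl)+
  then have "\<Psi> h * ?g' = 1\<^sub>m n" "?g' * \<Psi> h = 1\<^sub>m n"
    using cancel_P[OF mult_carrier_mat[OF g(1) g'(1)] one_carrier_mat]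
      cancel_P[OF mult_carrier_mat[OF g'(1) g(1)] one_carrier_mat] by auto
  then have "\<Psi> h \<in> carrier (GL n)" using g(1) g'(1) unfolding carrier_GL by blast
  moreover have "Nrd (\<Psi> h) = 1"
  proof -
    have "Nrd (\<Psi> h) = (\<Prod>d\<in>N. Nrd (A d) ^ d)"
      using Nrd_conj[OF g(1) Af g(2)] Nrd_D[OF Af] by simp
    also have "\<dots> = (\<Prod>d\<in>N. Nrd (h d))"
      using A(2) Ac by (intro prod.cong refl) (simp add: Nrd_rep)
    finally show ?thesis using Nrd by simp
  qed
  moreover have "commuting (\<Psi> h)" using Af g by (rule block_commuting)
  ultimately show "\<Psi> h \<in> carrier C" by (simp add: carrier_C)
  have "h \<in> extensional N" using assms by (auto simp: carrier_S PiE_iff)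
  then show "\<Phi> (\<Psi> h) = h"
    unfolding \<Phi>_def using A(2) blk_eq[OF g(1) Af g(2)] by (intro extensionalityI) auto
qed

lemma \<Psi>_\<Phi>:
  assumes "g \<in> carrier C"
  shows "\<Psi> (\<Phi> g) = g"
proof -
  have g: "commuting g" "g \<in> carrier_mat n n" using assms by (auto simp: carrier_C commuting_def)
  have "D (\<lambda>d. unrep d (\<Phi> g d)) = D (blk g)"
    by (intro D_cong) (simp add: \<Phi>_def unrep_rep blk_def)
  then have "\<Psi> (\<Phi> g) * P = g * P"
    using PDQ(2)[OF blk_family] commuting_blk[OF g(1)] by (simp add: \<Psi>_def)
  moreover have "\<Psi> (\<Phi> g) \<in> carrier_mat n n"
    using \<Psi>_in(1)[OF \<Phi>_in[OF assms]] by (auto simp: carrier_C carrier_GL)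
  ultimately show ?thesis using g(2) by (rule cancel_P[rotated 2])
qed

lemma \<Phi>_iso: "\<Phi> \<in> iso C S"
  unfolding iso_def
proof (intro CollectI conjI)
  show "\<Phi> \<in> hom C S"
  proof (rule homI)
    fix g g' assume "g \<in> carrier C" "g' \<in> carrier C"
    then have g: "commuting g" "commuting g'" by (auto simp: carrier_C)
    have "g \<otimes>\<^bsub>C\<^esub> g' = g * g'"
      by (simp add: triple_centralizer_def SL_def mult_GL)
    moreover have "\<Phi> g \<otimes>\<^bsub>S\<^esub> \<Phi> g' = (\<lambda>d\<in>N. \<Phi> g d * \<Phi> g' d)"
      by (simp add: S_product_def GL_diagonal_def mult_GL)
    moreover have "\<Phi> (g * g') = (\<lambda>d\<in>N. \<Phi> g d * \<Phi> g' d)"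
      unfolding \<Phi>_def by (rule restrict_ext) (simp add: blk_mult[OF g] rep_mult[OF blk_carrier blk_carrier])
    ultimately show "\<Phi> (g \<otimes>\<^bsub>C\<^esub> g') = \<Phi> g \<otimes>\<^bsub>S\<^esub> \<Phi> g'" by simp
  qed (rule \<Phi>_in)
  show "bij_betw \<Phi> (carrier C) (carrier S)"
    by (rule bij_betw_byWitness[where f' = \<Psi>]) (auto simp: \<Psi>_\<Phi> \<Psi>_in \<Phi>_in)
qed

section \<open>Continuity in both directions\<close>

abbreviation TC :: "quat mat topology" where
  "TC \<equiv> subtopology (mat_topology n) (carrier C)"

abbreviation TS :: "(nat \<Rightarrow> quat mat) topology" where
  "TS \<equiv> subtopology (product_topology (\<lambda>d. mat_topology (t d * d)) N) (carrier S)"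

text \<open>Once rows and columns are named through \<open>ed\<close>, an entry of a component of
  \<open>\<Phi> g\<close> is either constantly 0 or an entry of \<open>Q * g * P\<close>, hence a
  fixed finite sum in the entries of \<open>g\<close>.\<close>

lemma \<Phi>_continuous: "continuous_map TC TS \<Phi>"
  unfolding continuous_map_in_subtopology continuous_map_componentwise
proof (intro conjI ballI)
  show "\<Phi> ` topspace TC \<subseteq> extensional N" by (auto simp: \<Phi>_def)
  show "\<Phi> \<in> topspace TC \<rightarrow> carrier S" using \<Phi>_in by auto
  fix d assume d: "d \<in> N"
  have "continuous_map TC (mat_topology (t d * d)) (\<lambda>g. rep d (blk g d))"
  proof (rule continuous_map_into_mat_topology)
    show "rep d (blk g d) \<in> carrier_mat (t d * d) (t d * d)" for g
      by (rule rep_carrier) (simp add: blk_def)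
    fix r s assume "r < t d * d" "s < t d * d"
    then obtain k i l j where r: "k < d" "i < t d" "r = ed d (k, i)" and s: "l < d" "j < t d" "s = ed d (l, j)"
      by (elim ed_surj)
    have q: "(d, 0) \<in> set bl" using d by (intro block_in_bl) (auto simp: N_def)
    have "continuous_map TC euclidean (\<lambda>g. (Q * g * P) $$ (e ((d, 0), i), e ((d, 0), j)))"
      using e_less[OF q, of i] e_less[OF q, of j] r s m_eq_n P_carrier' Q(1)
      by (intro continuous_map_sandwich_entry[of _ _ n] continuous_map_from_subtopology[OF continuous_map_mat_entry])
        auto
    moreover have "rep d (blk g d) $$ (r, s)
        = (if k = l then (Q * g * P) $$ (e ((d, 0), i), e ((d, 0), j)) else 0)" for g
      using r s rep_entry[of "blk g d" d k l i j] by (simp add: blk_def)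
    ultimately show "continuous_map TC euclidean (\<lambda>g. rep d (blk g d) $$ (r, s))"
      by (cases "k = l") simp_all
  qed
  then show "continuous_map TC (mat_topology (t d * d)) (\<lambda>g. \<Phi> g d)"
    using d by (simp add: \<Phi>_def)
qed

lemma \<Psi>_continuous: "continuous_map TS TC \<Psi>"
  unfolding continuous_map_in_subtopology
proof
  show "\<Psi> \<in> topspace TS \<rightarrow> carrier C" using \<Psi>_in(1) by auto
  have f: "block_family (\<lambda>d. unrep d (h d))" for h
    by (simp add: block_family_def unrep_def)
  show "continuous_map TS (mat_topology n) \<Psi>"
  proof (rule continuous_map_into_mat_topology)
    show "\<Psi> h \<in> carrier_mat n n" for h unfolding \<Psi>_def by (rule PDQ(1)[OF f])
    fix i j assume ij: "i < n" "j < n"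
    show "continuous_map TS euclidean (\<lambda>h. \<Psi> h $$ (i, j))"
      unfolding \<Psi>_def
    proof (rule continuous_map_sandwich_entry[OF _ _ P_carrier' Q(1) ij])
      show "D (\<lambda>d. unrep d (h d)) \<in> carrier_mat n n" for h by (rule D_carrier[OF f])
      fix r s assume "r < n" "s < n"
      then obtain p i q j where r: "p \<in> set bl" "i < t (fst p)" "r = e (p, i)"
        and s: "q \<in> set bl" "j < t (fst q)" "s = e (q, j)"
        unfolding m_eq_n[symmetric] by (elim e_surj)
      have eq: "D (\<lambda>d. unrep d (h d)) $$ (r, s)
          = (if p = q then h (fst p) $$ (ed (fst p) (0, i), ed (fst p) (0, j)) else 0)" for h
        unfolding r(3) s(3) D_entry[OF f r(1) s(1) r(2) s(2)] using r(2) s(2) by (auto simp: unrep_def)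
      show "continuous_map TS euclidean (\<lambda>h. D (\<lambda>d. unrep d (h d)) $$ (r, s))"
      proof (cases "p = q")
        case True
        obtain d l where p: "p = (d, l)" by fastforce
        have d: "d \<in> N" "0 < d" using r(1) p by (auto simp: set_bl)
        have "continuous_map TS (mat_topology (t d * d)) (\<lambda>h. h d)"
          by (rule continuous_map_from_subtopology[OF continuous_map_product_projection[OF d(1)]])
        from continuous_map_compose[OF this continuous_map_mat_entry]
        have "continuous_map TS euclidean (\<lambda>h. h d $$ (ed d (0, i), ed d (0, j)))"
          using r s p True d(2) ed_less[of 0 d i] ed_less[of 0 d j] by (simp add: o_def)
        then show ?thesis unfolding eq using True p by auto
      next
        case False
        then show ?thesis by (simp add: eq)
      qed
    qed
  qed
qed

lemma centralizer_isomorphic: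
  "topological_group_isomorphic (mat_topology n) C (product_topology (\<lambda>d. mat_topology (t d * d)) N) S"
  unfolding topological_group_isomorphic_def homeomorphic_map_maps homeomorphic_maps_def
  using \<Phi>_iso \<Phi>_continuous \<Psi>_continuous \<Psi>_\<Phi> \<Psi>_in(2)
  by (intro bexI[of _ \<Phi>] exI[of _ \<Psi>]) auto

end

theorem proposition3p32:
  fixes n :: nat and X H Y :: "quat mat" and t :: "nat \<Rightarrow> nat" and N :: "nat set"
  assumes "X \<in> sl n" and "X \<noteq> 0\<^sub>m n n" and "nilpotent_mat X"
    and "sl2_triple n X H Y"
  defines "t \<equiv> multiplicity_of n X H Y"
    and "N \<equiv> parts n X H Y"
  shows "topological_group_isomorphic
    (mat_topology n)
    (triple_centralizer n (SL n) X H Y)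
    (product_topology (\<lambda>d. mat_topology (t d * d)) N)
    (S_product N (\<lambda>d. GL_diagonal (t d) d))"
proof -
  interpret quat_triple n X H Y
    using assms(3,4) by unfold_locales
  \<comment> \<open>The basis properties for \<open>d\<close> are bundled in one predicate, so that
    bases for all \<open>d\<close> can be chosen simultaneously.\<close>
  define basis where "basis d f \<longleftrightarrow> (\<forall>i<t d. f i \<in> lowest (d - 1) \<inter> supported n) \<and>
      (\<forall>v\<in>lowest (d - 1) \<inter> supported n. \<exists>w. v = (\<Sum>i<t d. rscale (f i) (w i))) \<and>
      (\<forall>w. (\<Sum>i<t d. rscale (f i) (w i)) = 0 \<longrightarrow> (\<forall>i<t d. w i = 0))" for d f
  have "\<exists>f. basis d f" for d
  proof (rule lowest_basis[of "t d" d])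
    fix f
    assume "\<And>i. i < t d \<Longrightarrow> f i \<in> lowest (d - 1) \<inter> supported n"
      and "\<And>v. v \<in> lowest (d - 1) \<inter> supported n \<Longrightarrow> \<exists>w. v = (\<Sum>i<t d. rscale (f i) (w i))"
      and "\<And>w i. (\<Sum>i<t d. rscale (f i) (w i)) = 0 \<Longrightarrow> i < t d \<Longrightarrow> w i = 0"
    then show "\<exists>f. basis d f" unfolding basis_def by blast
  qed (simp add: t_def)
  then obtain b where b: "\<And>d. basis d (b d)" by metis
  have "finite (SIGMA d:N. {..<d})" unfolding N_def using finite_parts by auto
  then obtain bl where bl: "set bl = (SIGMA d:N. {..<d})" "distinct bl"
    using finite_distinct_list by blast
  obtain e where e: "bij_betw e (SIGMA p:set bl. {..<t (fst p)}) {..<sum_list (map (\<lambda>p. t (fst p)) bl)}"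
    "\<And>(F :: _ \<Rightarrow> quat mat) p q i j.
      (\<And>p. p \<in> set bl \<Longrightarrow> F p \<in> carrier_mat (t (fst p)) (t (fst p))) \<Longrightarrow>
      p \<in> set bl \<Longrightarrow> q \<in> set bl \<Longrightarrow> i < t (fst p) \<Longrightarrow> j < t (fst q) \<Longrightarrow>
      diag_block_mat (map F bl) $$ (e (p, i), e (q, j)) = (if p = q then F p $$ (i, j) else 0)"
    by (rule diag_block_mat_index[OF bl(2), of "\<lambda>p. t (fst p)"]) blast
  define index where "index d f \<longleftrightarrow>
      bij_betw f (SIGMA l:set [0..<d]. {..<t d}) {..<sum_list (map (\<lambda>_. t d) [0..<d])} \<and>
      (\<forall>(F :: _ \<Rightarrow> quat mat) k l i j. (\<forall>l\<in>set [0..<d]. F l \<in> carrier_mat (t d) (t d)) \<longrightarrow>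
        k \<in> set [0..<d] \<longrightarrow> l \<in> set [0..<d] \<longrightarrow> i < t d \<longrightarrow> j < t d \<longrightarrow>
        diag_block_mat (map F [0..<d]) $$ (f (k, i), f (l, j)) = (if k = l then F k $$ (i, j) else 0))" for d f
  have "\<exists>f. index d f" for d
    by (rule diag_block_mat_index[OF distinct_upt, of 0 d "\<lambda>_. t d"]) (unfold index_def, blast)
  then obtain ed where ed: "\<And>d. index d (ed d)" by metis
  interpret triple_basis_top n X H Y t N b bl e ed
  proof (unfold_locales, goal_cases)
    case 1
    show ?case by (simp add: N_def t_def parts_def)
  next
    case (2 d i)
    then show ?case using b[of d] unfolding basis_def by blast
  next
    case (3 d f)
    then show ?case using b[of d] unfolding basis_def by blast
  next
    case (4 d w i)
    then show ?case using b[of d] unfolding basis_def by blast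
  next
    case 5
    show ?case by (rule bl)
  next
    case 6
    show ?case by (rule bl)
  next
    case 7
    show ?case by (rule e)
  next
    case (8 F p q i j)
    then show ?case by (rule e(2))
  next
    case (9 d)
    show ?case using ed[of d] unfolding index_def by blast
  next
    case (10 d F k l i j)
    then show ?case using ed[of d] unfolding index_def by blast
  qed
  show ?thesis by (rule centralizer_isomorphic)
qed

end
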